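(* Let $n\ge3$, $N\ge\frac52 n$ an integer, $p>n+3$, $p>N$, $p>\frac{2n}{n-2}$, $\Omega=\{x\in\mathbb{R}^n:|x|>1\}$, $f(u)=|u|^{p-1}u$. Let $u_0\in H^{N+1}(\Omega)$, $u_1\in H^N(\Omega)$ be radial with $(u_0,u_1,f)$ satisfying the nonlinear compatibility conditions of order $N$ and $\|(u_0,u_1)\|_M<\infty$ for some $M>1$, let $\epsilon=\epsilon(u_0,u_1)>0$ be such that for all $(v_0,v_1)\in H^{N+1}(\Omega)\times H^N(\Omega)$ with $(v_0,v_1,f)$ satisfying the nonlinear compatibility conditions of order $N$ and $\|u_0-v_0\|_{H^{N+1}}<\epsilon$, $\|u_1-v_1\|_{H^N}<\epsilon$ the problem $\partial_t^2v-\Delta v+|v|^{p-1}v=0$ on $\mathbb{R}^+\times\Omega$, $v(0)=v_0$, $\partial_tv(0)=v_1$, $v|_{\partial\Omega}=0$ has a global solution $v\in C^k(\mathbb{R}^+;H^{N-k}(\Omega))$ ($0\le k\le N+1$), $v\in C^{N-1}(\mathbb{R}^+;H^1_0(\Omega))$; fix such $(v_0,v_1)$ and such a solution $v$. Let $T>0$, let $I$ be an open interval containing $[0,T]$, and let $\underline v\in C(I;H^1_0(\Omega))\cap C^1(I;L^2(\Omega))\cap L^\infty(I;L^{p+1}(\Omega))$ be a distributional solution for $0\le t\le T$ of the same problem with the same initial data $(v_0,v_1)$, satisfying the energy inequality $E(\underline v(t))\le E(\underline v(0))$, where $E(w(t))=\tfrac12\|\partial_{t,x}w(t)\|_{L^2(\Omega)}^2+\tfrac1{p+1}\int_\Omega|w(t)|^{p+1}dx$.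 Then $\underline v(t)=v(t)$ for $0\le t\le T$.
   Context: $\|(u_0,u_1)\|_M:=C_M(u_0,u_1)+\|u_0\|_{H^2}+\|u_1\|_{H^1}+\|\langle x\rangle^{n\frac{p-1}{p+1}-1}u_0\|_{L^{p+1}}$, with $C_M(u_0,u_1)=\|u_0\|_{H^{N_0+1,N_0}(|x|\ge M)}+\|u_1\|_{H^{N_0,N_0+1}(|x|\ge M)}$, $N_0=\lfloor n/2\rfloor+1$, where $H^{s,k}(|x|\ge M)$ is a weighted Sobolev space on $\{|x|\ge M\}$ with regularity $s$ and polynomial weight of order $k$ (standard reading $\|\langle x\rangle^kf\|_{H^s}$). Nonlinear compatibility conditions of order $N$ for $(w_0,w_1,f)$: with $\psi_0=w_0$, $\psi_1=w_1$ and, for $j\ge2$, $\psi_j$ the formal value of $\partial_t^jw(0)$ obtained by differentiating the equation $j-2$ times in $t$ at $t=0$ and substituting $\psi_k$ for $\partial_t^kw(0)$, $k\le j-2$, one requires $(w_0,w_1)\in H^{N+1}\times H^N$, $f\in C^{N-2}$, and $\psi_j\in H^1_0(\Omega)$ for $0\le j\le N$. *)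

theory Defs
  imports "HOL-Analysis.Analysis" "HOL-Library.Disjoint_Sets"
begin

definition pd :: "'a::euclidean_space \<Rightarrow> ('a \<Rightarrow> real) \<Rightarrow> 'a \<Rightarrow> real" where
  "pd b f x = deriv (\<lambda>h. f (x + h *\<^sub>R b)) 0"

fun pds :: "'a::euclidean_space list \<Rightarrow> ('a \<Rightarrow> real) \<Rightarrow> 'a \<Rightarrow> real" where
  "pds [] f = f"
| "pds (b # bs) f = pd b (pds bs f)"

definition smooth_on_set :: "'a::euclidean_space set \<Rightarrow> ('a \<Rightarrow> real) \<Rightarrow> bool" where
  "smooth_on_set U f \<longleftrightarrow>
     (\<forall>bs. set bs \<subseteq> Basis \<longrightarrow>
        continuous_on U (pds bs f) \<and>
        (\<forall>b\<in>Basis. \<forall>x\<in>U. (\<lambda>h. pds bs f (x + h *\<^sub>R b)) differentiable (at 0)))"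

definition tsupport :: "('a::real_normed_vector \<Rightarrow> real) \<Rightarrow> 'a set" where
  "tsupport f = closure {x. f x \<noteq> 0}"

definition test_fun :: "'a::euclidean_space set \<Rightarrow> ('a \<Rightarrow> real) \<Rightarrow> bool" where
  "test_fun U \<phi> \<longleftrightarrow> smooth_on_set U \<phi> \<and> compact (tsupport \<phi>) \<and> tsupport \<phi> \<subseteq> U"

definition L2 :: "'a::euclidean_space set \<Rightarrow> ('a \<Rightarrow> real) \<Rightarrow> bool" where
  "L2 U f \<longleftrightarrow> (\<lambda>x. indicator U x * f x) \<in> borel_measurable lebesgue
      \<and> set_integrable lebesgue U (\<lambda>x. (f x)^2)"

definition loc_int :: "'a::euclidean_space set \<Rightarrow> ('a \<Rightarrow> real) \<Rightarrow> bool" where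
  "loc_int U f \<longleftrightarrow> (\<forall>K. compact K \<and> K \<subseteq> U \<longrightarrow> set_integrable lebesgue K f)"

definition weak_deriv :: "'a::euclidean_space set \<Rightarrow> 'a list \<Rightarrow> ('a \<Rightarrow> real) \<Rightarrow> ('a \<Rightarrow> real) \<Rightarrow> bool" where
  "weak_deriv U \<alpha> f g \<longleftrightarrow> loc_int U f \<and> loc_int U g \<and>
     (\<forall>\<phi>. test_fun U \<phi> \<longrightarrow>
        (LINT x:U|lebesgue. f x * pds \<alpha> \<phi> x) = (-1) ^ length \<alpha> * (LINT x:U|lebesgue. g x * \<phi> x))"

definition wd :: "'a::euclidean_space set \<Rightarrow> 'a list \<Rightarrow> ('a \<Rightarrow> real) \<Rightarrow> 'a \<Rightarrow> real" where
  "wd U \<alpha> f = (SOME g. weak_deriv U \<alpha> f g)"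

definition multi_idx :: "nat \<Rightarrow> 'a::euclidean_space list set" where
  "multi_idx k = {\<alpha>. set \<alpha> \<subseteq> Basis \<and> length \<alpha> \<le> k}"

definition Hk :: "nat \<Rightarrow> 'a::euclidean_space set \<Rightarrow> ('a \<Rightarrow> real) \<Rightarrow> bool" where
  "Hk k U f \<longleftrightarrow> L2 U f \<and> (\<forall>\<alpha>\<in>multi_idx k. \<exists>g. L2 U g \<and> weak_deriv U \<alpha> f g)"

(* the H^k(U) norm (equivalent form: sum over ordered lists of directions) *)
definition Hnorm :: "nat \<Rightarrow> 'a::euclidean_space set \<Rightarrow> ('a \<Rightarrow> real) \<Rightarrow> real" where
  "Hnorm k U f = sqrt (\<Sum>\<alpha>\<in>multi_idx k. LINT x:U|lebesgue. (wd U \<alpha> f x)^2)"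

definition H10 :: "'a::euclidean_space set \<Rightarrow> ('a \<Rightarrow> real) \<Rightarrow> bool" where
  "H10 U f \<longleftrightarrow> Hk 1 U f \<and>
     (\<exists>\<phi>s. (\<forall>k. test_fun U (\<phi>s k)) \<and> (\<lambda>k. Hnorm 1 U (\<lambda>x. \<phi>s k x - f x)) \<longlonglongrightarrow> 0)"

definition lap :: "'a::euclidean_space set \<Rightarrow> ('a \<Rightarrow> real) \<Rightarrow> 'a \<Rightarrow> real" where
  "lap U g = (\<lambda>x. \<Sum>b\<in>Basis. wd U [b, b] g x)"

definition cont_H :: "nat \<Rightarrow> 'a::euclidean_space set \<Rightarrow> real set \<Rightarrow> (real \<Rightarrow> 'a \<Rightarrow> real) \<Rightarrow> bool" where
  "cont_H s U J v \<longleftrightarrow> (\<forall>t\<in>J. Hk s U (v t) \<and>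
      ((\<lambda>\<tau>. Hnorm s U (\<lambda>x. v \<tau> x - v t x)) \<longlongrightarrow> 0) (at t within J))"

definition deriv_H :: "nat \<Rightarrow> 'a::euclidean_space set \<Rightarrow> real set \<Rightarrow> (real \<Rightarrow> 'a \<Rightarrow> real) \<Rightarrow> (real \<Rightarrow> 'a \<Rightarrow> real) \<Rightarrow> bool" where
  "deriv_H s U J v w \<longleftrightarrow> (\<forall>t\<in>J.
      ((\<lambda>\<tau>. Hnorm s U (\<lambda>x. (v \<tau> x - v t x) / (\<tau> - t) - w t x)) \<longlongrightarrow> 0) (at t within J))"

definition Omega :: "(real^'n::finite) set" where
  "Omega = {x. norm x > 1}"

definition fp :: "real \<Rightarrow> real \<Rightarrow> real" where
  "fp p u = \<bar>u\<bar> powr (p - 1) * u"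

definition japan :: "'a::real_normed_vector \<Rightarrow> real" where
  "japan x = sqrt (1 + (norm x)^2)"

definition Ck_real :: "nat \<Rightarrow> (real \<Rightarrow> real) \<Rightarrow> bool" where
  "Ck_real m f \<longleftrightarrow> (\<forall>k<m. \<forall>x. ((deriv ^^ k) f has_real_derivative (deriv ^^ Suc k) f x) (at x))
      \<and> continuous_on UNIV ((deriv ^^ m) f)"

(* formal value of \<partial>_t^j f(w)(0) (Faa di Bruno), given the list L of formal values \<psi>_0, \<psi>_1, ... *)
definition formal_comp_deriv :: "(real \<Rightarrow> real) \<Rightarrow> ('a \<Rightarrow> real) list \<Rightarrow> nat \<Rightarrow> 'a \<Rightarrow> real" where
  "formal_comp_deriv f L j = (\<lambda>x. \<Sum>P\<in>{P. partition_on {0..<j} P}.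
       (deriv ^^ card P) f ((L ! 0) x) * (\<Prod>B\<in>P. (L ! card B) x))"

primrec psiL :: "'a::euclidean_space set \<Rightarrow> ('a \<Rightarrow> real) \<Rightarrow> ('a \<Rightarrow> real) \<Rightarrow> (real \<Rightarrow> real) \<Rightarrow> nat \<Rightarrow> ('a \<Rightarrow> real) list" where
  "psiL U w0 w1 f 0 = [w0]"
| "psiL U w0 w1 f (Suc m) =
     (if m = 0 then [w0, w1]
      else psiL U w0 w1 f m @
           [(\<lambda>x. lap U (psiL U w0 w1 f m ! (m - 1)) x - formal_comp_deriv f (psiL U w0 w1 f m) (m - 1) x)])"

definition psi :: "'a::euclidean_space set \<Rightarrow> ('a \<Rightarrow> real) \<Rightarrow> ('a \<Rightarrow> real) \<Rightarrow> (real \<Rightarrow> real) \<Rightarrow> nat \<Rightarrow> 'a \<Rightarrow> real" where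
  "psi U w0 w1 f j = psiL U w0 w1 f j ! j"

definition compat :: "nat \<Rightarrow> 'a::euclidean_space set \<Rightarrow> ('a \<Rightarrow> real) \<Rightarrow> ('a \<Rightarrow> real) \<Rightarrow> (real \<Rightarrow> real) \<Rightarrow> bool" where
  "compat N U w0 w1 f \<longleftrightarrow> Hk (N + 1) U w0 \<and> Hk N U w1 \<and> Ck_real (N - 2) f \<and>
      (\<forall>j\<le>N. H10 U (psi U w0 w1 f j))"

definition radial_on :: "'a::euclidean_space set \<Rightarrow> ('a \<Rightarrow> real) \<Rightarrow> bool" where
  "radial_on U u \<longleftrightarrow> (\<exists>g. (\<forall>x y. norm x = norm y \<longrightarrow> g x = g y) \<and> (AE x in lebesgue. x \<in> U \<longrightarrow> u x = g x))"

definition M_norm_finite :: "real \<Rightarrow> real \<Rightarrow> (real^'n::finite \<Rightarrow> real) \<Rightarrow> (real^'n \<Rightarrow> real) \<Rightarrow> bool" where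
  "M_norm_finite p M u0 u1 \<longleftrightarrow>
     (let n = CARD('n); N0 = n div 2 + 1; E = {x::real^'n. norm x > M} in
       Hk (N0 + 1) E (\<lambda>x. japan x ^ N0 * u0 x) \<and>
       Hk N0 E (\<lambda>x. japan x ^ (N0 + 1) * u1 x) \<and>
       Hk 2 Omega u0 \<and> Hk 1 Omega u1 \<and>
       (\<lambda>x. indicator Omega x * (japan x powr (real n * (p - 1) / (p + 1) - 1) * u0 x))
          \<in> borel_measurable lebesgue \<and>
       set_integrable lebesgue Omega
          (\<lambda>x. \<bar>japan x powr (real n * (p - 1) / (p + 1) - 1) * u0 x\<bar> powr (p + 1)))"

definition global_sol :: "nat \<Rightarrow> (real \<Rightarrow> real) \<Rightarrow> (real^'n::finite \<Rightarrow> real) \<Rightarrow> (real^'n \<Rightarrow> real)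
     \<Rightarrow> (real \<Rightarrow> real^'n \<Rightarrow> real) \<Rightarrow> bool" where
  "global_sol N f w0 w1 v \<longleftrightarrow>
     (\<exists>ws. ws 0 = v \<and>
        (\<forall>k\<le>N. (\<forall>j\<le>k. cont_H (N - k) Omega {0..} (ws j)) \<and>
                (\<forall>j<k. deriv_H (N - k) Omega {0..} (ws j) (ws (Suc j)))) \<and>
        (\<forall>j\<le>N - 1. \<forall>t\<ge>0. H10 Omega (ws j t)) \<and>
        (AE x in lebesgue. x \<in> Omega \<longrightarrow> v 0 x = w0 x) \<and>
        (AE x in lebesgue. x \<in> Omega \<longrightarrow> ws 1 0 x = w1 x) \<and>
        (\<forall>t\<ge>0. AE x in lebesgue. x \<in> Omega \<longrightarrow>
             ws 2 t x - lap Omega (v t) x + f (v t x) = 0))"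

(* energy E(w(t)) with time derivative wt *)
definition energy :: "real \<Rightarrow> (real^'n::finite \<Rightarrow> real) \<Rightarrow> (real^'n \<Rightarrow> real) \<Rightarrow> real" where
  "energy p w wt = 1/2 * (LINT x:Omega|lebesgue. (wt x)^2 + (\<Sum>b\<in>Basis. (wd Omega [b] w x)^2))
      + 1 / (p + 1) * (LINT x:Omega|lebesgue. \<bar>w x\<bar> powr (p + 1))"

definition distr_sol :: "real \<Rightarrow> (real \<Rightarrow> real) \<Rightarrow> (real \<Rightarrow> real^'n::finite \<Rightarrow> real) \<Rightarrow> bool" where
  "distr_sol T f w \<longleftrightarrow>
     (\<forall>\<phi> :: real \<times> (real^'n) \<Rightarrow> real. test_fun ({0<..<T} \<times> Omega) \<phi> \<longrightarrow>
        (LINT t:{0..T}|lborel. LINT x:Omega|lebesgue.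
            w t x * pds [(1::real, 0 :: real^'n), (1, 0)] \<phi> (t, x)
          - w t x * (\<Sum>b\<in>(Basis :: (real^'n) set). pds [(0::real, b), (0, b)] \<phi> (t, x))
          + f (w t x) * \<phi> (t, x)) = 0)"

end

theory Submission
  imports Defs
begin

text \<open>
  Write \<open>u\<close> for the weak and \<open>v\<close> for the strong solution, \<open>w = u - v\<close>, \<open>f(s) = |s|^(p-1) s\<close> and \<open>F' = f\<close>.
  The energy inequality for \<open>u\<close> bounds the relative energy
  \<open>|w_t|^2 / 2 + |grad w|^2 / 2 + \<integral> F(u) - F(v) - f(v) w\<close>
  by a quantity \<open>R(t)\<close> with \<open>R(0) = 0\<close> that pairs \<open>u\<close> only with the smooth \<open>v\<close>; testing the equation of \<open>u\<close>
  against \<open>v_t\<close> gives \<open>R' = \<integral> (f(u) - f(v) - f'(v) w) v_t\<close>. As \<open>v\<close> and \<open>v_t\<close> are bounded and \<open>F\<close> is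
  convex with \<open>F(u) - F(v) - f(v) w\<close> of order \<open>|u|^(p+1)\<close> for large \<open>u\<close>, the integrand is at most a multiple of
  \<open>w^2 + (F(u) - F(v) - f(v) w)\<close>, and Gronwall's inequality for \<open>R + |w|^2\<close> yields \<open>w = 0\<close>.

  Boundedness of \<open>v\<close> and \<open>v_t\<close> comes from a crude Sobolev embedding of \<open>H^n\<close>: from every point of the exterior
  domain the coordinate cube pointing away from the origin stays in the domain. Testing against \<open>v_t\<close>, which is only
  in \<open>H^1_0\<close> and bounded, is possible because \<open>f(u)\<close> is integrable: \<open>v_t\<close> is approximated by truncated test functions.
\<close>

subsection \<open>Smooth functions\<close>

text \<open>The obstacle is that u has no regularity beyond its energy: u_t is merely continuous
  into L2, so the equation of u cannot be tested against u_t or w_t, and for large p the power f(u)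
  need not pair with a general H^1 function. Expanding the relative energy leaves E(u(t)), which the
  hypothesis replaces by the constant E(u(0)), and terms that are at most linear in u and u_t. The
  delicate one is the pairing of u_t with v_t. Its derivative exists because the pairing of u_t with
  a fixed bounded Dirichlet function is C^1 in time: the bound in L^(p+1) and continuity in L2 make
  f(u(t)) continuous in t against bounded functions. The square |w|^2 joins Gronwall's inequality
  because the convexity defect of F degenerates where u and v are small and does not control w^2
  there. An embedding that spends n derivatives is affordable: N >= 5n/2 and n >= 3 leave v_t at
  least n of them.\<close>

abbreviation smooth :: "('a::euclidean_space \<Rightarrow> real) \<Rightarrow> bool" where
  "smooth \<equiv> smooth_on_set UNIV"

lemma pds_append: "pds (xs @ ys) f = pds xs (pds ys f)"
  by (induction xs) auto

lemma pd_eqI: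
  "((\<lambda>h. f (x + h *\<^sub>R b)) has_real_derivative d) (at 0) \<Longrightarrow> pd b f x = d"
  unfolding pd_def by (rule DERIV_imp_deriv)

lemma pd_has_derivI:
  "(\<lambda>h. f (x + h *\<^sub>R b)) differentiable (at (0::real)) \<Longrightarrow>
    ((\<lambda>h. f (x + h *\<^sub>R b)) has_real_derivative pd b f x) (at 0)"
  unfolding pd_def by (simp add: DERIV_deriv_iff_real_differentiable)

lemma real_differentiableI_DERIV: "(f has_real_derivative d) (at x) \<Longrightarrow> f differentiable (at x)"
  by (auto simp: real_differentiable_def)

text \<open>Induction on the list of directions: a class closed under partial derivatives contains
  every iterated derivative of its members. The basic smoothness proofs below consist in guessing
  such a class.\<close>

lemma smooth_coinduct:
  assumes "P f"
    and "\<And>f. P f \<Longrightarrow> continuous_on UNIV f"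
    and "\<And>f b x. P f \<Longrightarrow> b \<in> Basis \<Longrightarrow> (\<lambda>h. f (x + h *\<^sub>R b)) differentiable (at (0::real))"
    and "\<And>f b. P f \<Longrightarrow> b \<in> Basis \<Longrightarrow> P (pd b f)"
  shows "smooth f"
proof -
  have "P (pds bs f)" if "set bs \<subseteq> Basis" for bs
    using that by (induction bs) (auto intro: assms)
  then show ?thesis
    unfolding smooth_on_set_def using assms by blast
qed

lemma smooth_continuous: "smooth f \<Longrightarrow> continuous_on UNIV f"
  unfolding smooth_on_set_def by (metis empty_subsetI list.set(1) pds.simps(1))

lemma smooth_pds:
  assumes "smooth f" "set cs \<subseteq> Basis" shows "smooth (pds cs f)"
  unfolding smooth_on_set_def
proof (intro allI impI)
  fix bs :: "'a list" assume "set bs \<subseteq> Basis"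
  with assms have "set (bs @ cs) \<subseteq> Basis" by auto
  with assms(1) show "continuous_on UNIV (pds bs (pds cs f)) \<and>
     (\<forall>b\<in>Basis. \<forall>x\<in>UNIV. (\<lambda>h. pds bs (pds cs f) (x + h *\<^sub>R b)) differentiable at (0::real))"
    unfolding smooth_on_set_def pds_append[symmetric] by blast
qed

lemma smooth_pd: "smooth f \<Longrightarrow> b \<in> Basis \<Longrightarrow> smooth (pd b f)"
  using smooth_pds[of f "[b]"] by simp

lemma smooth_differentiable:
  "smooth f \<Longrightarrow> b \<in> Basis \<Longrightarrow> (\<lambda>h. f (x + h *\<^sub>R b)) differentiable (at (0::real))"
  unfolding smooth_on_set_def by (metis UNIV_I empty_subsetI list.set(1) pds.simps(1))

lemma smooth_has_deriv:
  "smooth f \<Longrightarrow> b \<in> Basis \<Longrightarrow>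
    ((\<lambda>h. f (x + h *\<^sub>R b)) has_real_derivative pd b f x) (at 0)"
  by (intro pd_has_derivI smooth_differentiable)

lemma smooth_has_deriv_line:
  assumes "smooth f" "b \<in> Basis"
  shows "((\<lambda>h. f (x + h *\<^sub>R b)) has_real_derivative pd b f (x + s *\<^sub>R b)) (at s)"
proof -
  have "((\<lambda>h. f ((x + s *\<^sub>R b) + h *\<^sub>R b)) has_real_derivative pd b f (x + s *\<^sub>R b)) (at 0)"
    by (rule smooth_has_deriv[OF assms])
  then have "((\<lambda>h. f (x + (s + h) *\<^sub>R b)) has_real_derivative pd b f (x + s *\<^sub>R b)) (at 0)"
    by (simp add: algebra_simps)
  then show ?thesis
    using DERIV_at_within_shift[of "\<lambda>h. f (x + h *\<^sub>R b)" "pd b f (x + s *\<^sub>R b)" s 0 UNIV]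
    by (simp add: o_def)
qed

section \<open>Differentiation rules and closure properties of smooth functions\<close>

lemma pd_add:
  assumes "(\<lambda>h. f (x + h *\<^sub>R b)) differentiable (at (0::real))"
    and "(\<lambda>h. g (x + h *\<^sub>R b)) differentiable (at (0::real))"
  shows "pd b (\<lambda>x. f x + g x) x = pd b f x + pd b g x"
  by (rule pd_eqI) (intro DERIV_add pd_has_derivI assms)

lemma pd_mult:
  assumes "(\<lambda>h. f (x + h *\<^sub>R b)) differentiable (at (0::real))"
    and "(\<lambda>h. g (x + h *\<^sub>R b)) differentiable (at (0::real))"
  shows "pd b (\<lambda>x. f x * g x) x = pd b f x * g x + f x * pd b g x"
  by (rule pd_eqI)
    (use DERIV_mult'[OF pd_has_derivI[OF assms(1)] pd_has_derivI[OF assms(2)]]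
     in \<open>simp add: algebra_simps\<close>)

text \<open>The product rule leads out of a class of mere products, so the invariant for
  \<open>smooth_coinduct\<close> is generated under sums and products. It then suffices that
  derivatives of generators fall into the hull.\<close>

inductive alg_hull :: "(('a \<Rightarrow> real) \<Rightarrow> bool) \<Rightarrow> ('a \<Rightarrow> real) \<Rightarrow> bool" for B where
  base: "B f \<Longrightarrow> alg_hull B f"
| add: "alg_hull B f \<Longrightarrow> alg_hull B g \<Longrightarrow> alg_hull B (\<lambda>x. f x + g x)"
| mult: "alg_hull B f \<Longrightarrow> alg_hull B g \<Longrightarrow> alg_hull B (\<lambda>x. f x * g x)"

lemma alg_hull_smooth:
  assumes cont: "\<And>f. B f \<Longrightarrow> continuous_on UNIV f"
    and diff: "\<And>f b x. B f \<Longrightarrow> b \<in> Basis \<Longrightarrow> (\<lambda>h. f (x + h *\<^sub>R b)) differentiable (at (0::real))"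
    and pd: "\<And>f b. B f \<Longrightarrow> b \<in> Basis \<Longrightarrow> alg_hull B (pd b f)"
    and "alg_hull B f"
  shows "smooth f"
proof (rule smooth_coinduct[where P = "alg_hull B"])
  show c: "continuous_on UNIV f" if "alg_hull B f" for f
    using that by induction (auto intro: cont continuous_intros)
  show d: "(\<lambda>h. f (x + h *\<^sub>R b)) differentiable (at (0::real))"
    if "alg_hull B f" "b \<in> Basis" for f b x
    using that by induction (auto intro: diff)
  show "alg_hull B (pd b f)" if "alg_hull B f" "b \<in> Basis" for f b
    using that
  proof induction
    case (base f)
    then show ?case by (intro pd)
  next
    case (add f g)
    have "pd b (\<lambda>x. f x + g x) = (\<lambda>x. pd b f x + pd b g x)"
      using add by (intro ext pd_add d)
    then show ?case using add by (auto intro: alg_hull.intros)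
  next
    case (mult f g)
    have "pd b (\<lambda>x. f x * g x) = (\<lambda>x. pd b f x * g x + f x * pd b g x)"
      using mult by (intro ext pd_mult d)
    then show ?case using mult by (auto intro: alg_hull.intros)
  qed
qed fact

lemma
  assumes "smooth f" "smooth g"
  shows smooth_add: "smooth (\<lambda>x. f x + g x)"
    and smooth_mult: "smooth (\<lambda>x. f x * g x)"
proof -
  have "alg_hull smooth h \<Longrightarrow> smooth h" for h :: "'a \<Rightarrow> real"
    by (rule alg_hull_smooth[where B = smooth])
      (auto intro: smooth_continuous smooth_differentiable smooth_pd alg_hull.intros)
  then show "smooth (\<lambda>x. f x + g x)" "smooth (\<lambda>x. f x * g x)"
    using assms by (auto intro: alg_hull.intros)
qed

lemma smooth_const: "smooth (\<lambda>_. c)"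
proof (rule smooth_coinduct[where P = "\<lambda>f. \<exists>c. f = (\<lambda>_. c)"])
  fix f :: "'a \<Rightarrow> real" and b :: 'a
  assume "\<exists>c. f = (\<lambda>_. c)"
  then have "pd b f = (\<lambda>_. 0)" by (auto intro!: pd_eqI)
  then show "\<exists>c. pd b f = (\<lambda>_. c)" by blast
qed auto

lemma smooth_inner: "smooth (\<lambda>x. x \<bullet> a)"
\<comment> \<open>A disjunctive invariant: one differentiation turns the linear form into a
  constant, which is already known to be smooth.\<close>
proof (rule smooth_coinduct[where P = "\<lambda>f. f = (\<lambda>x. x \<bullet> a) \<or> smooth f"])
  fix f :: "'a \<Rightarrow> real" and b :: 'a
  have *: "((\<lambda>h. (x + h *\<^sub>R b) \<bullet> a) has_real_derivative (b \<bullet> a)) (at 0)" for x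
    by (auto intro!: derivative_eq_intros simp: inner_add_left)
  assume "f = (\<lambda>x. x \<bullet> a) \<or> smooth f" "b \<in> Basis"
  then show "(\<lambda>h. f (x + h *\<^sub>R b)) differentiable (at (0::real))" for x
    using * by (auto intro: smooth_differentiable real_differentiableI_DERIV)
  have "pd b (\<lambda>x. x \<bullet> a) = (\<lambda>_. b \<bullet> a)"
    using * by (auto intro!: pd_eqI)
  then show "pd b f = (\<lambda>x. x \<bullet> a) \<or> smooth (pd b f)"
    using \<open>f = _ \<or> _\<close> \<open>b \<in> Basis\<close> by (auto intro: smooth_pd smooth_const)
qed (auto intro: smooth_continuous continuous_intros)

lemma smooth_real_has_deriv:
  "smooth T \<Longrightarrow> (T has_real_derivative pd 1 T s) (at s)" for T :: "real \<Rightarrow> real"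
  using smooth_has_deriv_line[of T 1 0 s] by simp

lemma pd_compose:
  fixes T :: "real \<Rightarrow> real"
  assumes "smooth T" "smooth g" "b \<in> Basis"
  shows "((\<lambda>h. T (g (x + h *\<^sub>R b))) has_real_derivative pd 1 T (g x) * pd b g x) (at 0)"
    and "pd b (\<lambda>x. T (g x)) x = pd 1 T (g x) * pd b g x"
proof -
  show *: "((\<lambda>h. T (g (x + h *\<^sub>R b))) has_real_derivative pd 1 T (g x) * pd b g x) (at 0)"
    using DERIV_chain[of T "pd 1 T (g x)" "\<lambda>h. g (x + h *\<^sub>R b)" 0 "pd b g x" UNIV]
      smooth_real_has_deriv[OF assms(1)] smooth_has_deriv[OF assms(2,3)]
    by (simp add: o_def)
  then show "pd b (\<lambda>x. T (g x)) x = pd 1 T (g x) * pd b g x"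
    by (rule pd_eqI)
qed

text \<open>The chain rule produces T'(g) times a derivative of g, that is, another composition
  times a smooth function. Hence the hull generated by all compositions and all smooth functions is
  stable.\<close>

lemma smooth_compose:
  fixes T :: "real \<Rightarrow> real"
  assumes "smooth T" "smooth g" shows "smooth (\<lambda>x. T (g x))"
proof -
  define B where "B = (\<lambda>f :: 'a \<Rightarrow> real. smooth f \<or> (\<exists>T::real \<Rightarrow> real. \<exists>g. smooth T \<and> smooth g \<and> f = (\<lambda>x. T (g x))))"
  show ?thesis
  proof (rule alg_hull_smooth[where B = B])
    fix f :: "'a \<Rightarrow> real" assume f: "B f"
    show "continuous_on UNIV f"
      using f unfolding B_def
      by (auto intro: smooth_continuous continuous_on_compose2[OF smooth_continuous smooth_continuous])
    fix b :: 'a assume b: "b \<in> Basis"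
    show "(\<lambda>h. f (x + h *\<^sub>R b)) differentiable (at (0::real))" for x
      using f b unfolding B_def
      by (auto intro: smooth_differentiable real_differentiableI_DERIV[OF pd_compose(1)])
    show "alg_hull B (pd b f)"
      using f[unfolded B_def]
    proof (elim disjE exE conjE)
      assume "smooth f"
      then show "alg_hull B (pd b f)"
        using b by (auto intro!: alg_hull.base smooth_pd simp: B_def)
    next
      fix T :: "real \<Rightarrow> real" and g
      assume *: "smooth T" "smooth g" "f = (\<lambda>x. T (g x))"
      then have "pd b f = (\<lambda>x. pd 1 T (g x) * pd b g x)"
        using b by (auto intro!: pd_compose)
      moreover have "smooth (pd 1 T)" using * by (intro smooth_pd) auto
      moreover from this have "alg_hull B (\<lambda>x. pd 1 T (g x))"
        using * by (intro alg_hull.base) (auto simp: B_def)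
      moreover have "alg_hull B (pd b g)"
        using * b by (intro alg_hull.base) (auto simp: B_def intro: smooth_pd)
      ultimately show "alg_hull B (pd b f)"
        by (simp add: alg_hull.mult)
    qed
  next
    show "alg_hull B (\<lambda>x. T (g x))"
      using assms by (auto intro!: alg_hull.base simp: B_def)
  qed
qed

lemma smooth_cmult: "smooth f \<Longrightarrow> smooth (\<lambda>x. c * f x)"
  by (intro smooth_mult smooth_const)

lemma smooth_diff: "smooth f \<Longrightarrow> smooth g \<Longrightarrow> smooth (\<lambda>x. f x - g x)"
  using smooth_add[OF _ smooth_cmult[of g "-1"], of f] by simp

lemma smooth_prod: "(\<And>i. i \<in> A \<Longrightarrow> smooth (f i)) \<Longrightarrow> smooth (\<lambda>x. \<Prod>i\<in>A. f i x)"
  by (induction A rule: infinite_finite_induct) (auto intro: smooth_const smooth_mult)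

lemma smooth_ident: "smooth (\<lambda>x::real. x)"
  using smooth_inner[of "1::real"] by simp

lemma smooth_primitive:
  fixes F f :: "real \<Rightarrow> real"
  assumes "\<And>s. (F has_real_derivative f s) (at s)" "smooth f"
  shows "smooth F" "pd 1 F = f"
proof -
  have *: "((\<lambda>h. F (x + h *\<^sub>R 1)) has_real_derivative f x) (at 0)" for x
    using DERIV_at_within_shift[of F "f x" x 0 UNIV] assms(1)[of x] by (simp add: o_def)
  show pd: "pd 1 F = f"
    using * by (auto intro!: pd_eqI)
  show "smooth F"
  proof (rule smooth_coinduct[where P = "\<lambda>g. g = F \<or> smooth g"])
    fix g :: "real \<Rightarrow> real" assume g: "g = F \<or> smooth g"
    have "continuous_on UNIV F"
      using assms(1) by (meson DERIV_isCont continuous_at_imp_continuous_on)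
    then show "continuous_on UNIV g" using g smooth_continuous by auto
    fix b :: real assume "b \<in> Basis"
    then show "(\<lambda>h. g (x + h *\<^sub>R b)) differentiable (at (0::real))" for x
      using g * smooth_differentiable[of g b] by (metis Basis_real_def real_differentiableI_DERIV singletonD)
    show "pd b g = F \<or> smooth (pd b g)"
      using g \<open>b \<in> Basis\<close> pd assms(2) by (auto intro: smooth_pd)
  qed auto
qed

text \<open>The class of all g after \<open>snd\<close> is stable: a direction in the second factor
  differentiates g, one in the first gives 0. This serves the space-time test functions \<theta>(t)
  \<xi>(x).\<close>

lemma smooth_snd:
  fixes g :: "'b::euclidean_space \<Rightarrow> real"
  assumes "smooth g" shows "smooth (\<lambda>z :: 'a::euclidean_space \<times> 'b. g (snd z))"
proof (rule smooth_coinduct[where P = "\<lambda>f. \<exists>g. smooth g \<and> f = (\<lambda>z. g (snd z))"])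
  fix f :: "'a \<times> 'b \<Rightarrow> real" assume "\<exists>g. smooth g \<and> f = (\<lambda>z. g (snd z))"
  then obtain g where g: "smooth g" "f = (\<lambda>z. g (snd z))" by blast
  show "continuous_on UNIV f"
    unfolding g by (rule continuous_on_compose2[OF smooth_continuous[OF g(1)]])
      (auto intro: continuous_intros)
  fix b :: "'a \<times> 'b" assume "b \<in> Basis"
  then consider c where "c \<in> Basis" "b = (0, c)" | c where "b = (c, 0)"
    by (auto simp: Basis_prod_def)
  then have "(\<forall>x. (\<lambda>h. f (x + h *\<^sub>R b)) differentiable (at (0::real))) \<and>
      (\<exists>g. smooth g \<and> pd b f = (\<lambda>z. g (snd z)))"
  proof cases
    case 1
    then show ?thesis
      using g smooth_pd[OF g(1) 1(1)] smooth_differentiable[OF g(1) 1(1)]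
      by (auto simp: pd_def fun_eq_iff)
  next
    case 2
    then have "pd b f = (\<lambda>z. (\<lambda>_. 0) (snd z))"
      using g by (auto intro!: pd_eqI)
    with 2 g show ?thesis using smooth_const by auto
  qed
  then show "(\<lambda>h. f (x + h *\<^sub>R b)) differentiable (at (0::real))"
    and "\<exists>g. smooth g \<and> pd b f = (\<lambda>z. g (snd z))" for x
    by blast+
qed (use assms in auto)

lemma smooth_fst_real:
  assumes "smooth (g :: real \<Rightarrow> real)" shows "smooth (\<lambda>z :: real \<times> 'b::euclidean_space. g (fst z))"
proof -
  have "smooth (\<lambda>z :: real \<times> 'b. g (z \<bullet> (1, 0)))"
    by (intro smooth_compose[OF assms] smooth_inner)
  then show ?thesis by (simp add: inner_prod_def)
qed

subsection \<open>Test functions\<close>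

lemma pds_eq_0_outside:
  assumes "open S" "\<And>x. x \<in> S \<Longrightarrow> f x = 0" "x \<in> S"
  shows "pds bs f x = 0" "(\<lambda>h. pds bs f (x + h *\<^sub>R b)) differentiable (at (0::real))"
proof -
  have ev: "\<forall>\<^sub>F h in nhds (0::real). x + h *\<^sub>R b \<in> S" if "x \<in> S" for x b
  proof -
    have "((\<lambda>h. x + h *\<^sub>R b) \<longlongrightarrow> x + 0 *\<^sub>R b) (nhds (0::real))"
      by (intro tendsto_intros filterlim_ident)
    then show ?thesis using that assms(1) by (auto dest: topological_tendstoD)
  qed
  have der: "((\<lambda>h. g (x + h *\<^sub>R b)) has_real_derivative 0) (at 0)"
    if "\<And>x. x \<in> S \<Longrightarrow> g x = 0" "x \<in> S" for g :: "'a \<Rightarrow> real" and x b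
  proof -
    have "\<forall>\<^sub>F h in nhds (0::real). g (x + h *\<^sub>R b) = 0"
      using ev[OF \<open>x \<in> S\<close>] by eventually_elim (use that in auto)
    then show ?thesis using DERIV_cong_ev[of 0 0 "\<lambda>h. g (x + h *\<^sub>R b)" "\<lambda>_. 0" 0 0] by simp
  qed
  have *: "\<forall>x\<in>S. pds bs f x = 0"
    by (induction bs) (use assms(2) in \<open>auto intro!: pd_eqI der\<close>)
  then show "pds bs f x = 0" using assms(3) by blast
  show "(\<lambda>h. pds bs f (x + h *\<^sub>R b)) differentiable (at (0::real))"
    using * assms(3) by (blast intro: real_differentiableI_DERIV der)
qed

lemma not_in_tsupport: "x \<notin> tsupport f \<Longrightarrow> f x = 0"
  using closure_subset[of "{x. f x \<noteq> 0}"] unfolding tsupport_def by auto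

lemma tsupport_subset: "closed K \<Longrightarrow> (\<And>x. x \<notin> K \<Longrightarrow> f x = 0) \<Longrightarrow> tsupport f \<subseteq> K"
  unfolding tsupport_def by (rule closure_minimal) auto

text \<open>The definition of \<open>test_fun\<close> asks for smoothness on U alone. Off the
  support all derivatives vanish, and U together with the complement of the support is a cover of
  the space by two open sets.\<close>

lemma test_fun_smooth:
  assumes "open U" "test_fun U \<phi>" shows "smooth \<phi>"
  unfolding smooth_on_set_def
proof (intro allI impI conjI ballI)
  fix bs :: "'a list" assume bs: "set bs \<subseteq> Basis"
  let ?S = "- tsupport \<phi>"
  have S: "open ?S" unfolding tsupport_def by auto
  have z: "pds bs \<phi> x = 0" "(\<lambda>h. pds bs \<phi> (x + h *\<^sub>R b)) differentiable (at (0::real))"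
    if "x \<in> ?S" for x b
    using that by (auto intro!: pds_eq_0_outside[OF S] dest: not_in_tsupport)
  have UN: "U \<union> ?S = UNIV" using assms(2) unfolding test_fun_def by auto
  have sm: "smooth_on_set U \<phi>" using assms(2) unfolding test_fun_def by auto
  have "continuous_on ?S (pds bs \<phi>)"
    using continuous_on_const by (rule continuous_on_eq[of _ "\<lambda>_. 0"]) (use z in auto)
  then have "continuous_on (U \<union> ?S) (pds bs \<phi>)"
    using sm bs by (intro continuous_on_open_Un assms(1) S) (auto simp: smooth_on_set_def)
  then show "continuous_on UNIV (pds bs \<phi>)" using UN by simp
  fix b :: 'a and x assume "b \<in> Basis"
  have "x \<in> U \<or> x \<in> ?S" using UN by blast
  then show "(\<lambda>h. pds bs \<phi> (x + h *\<^sub>R b)) differentiable (at (0::real))"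
    using z sm bs \<open>b \<in> Basis\<close> unfolding smooth_on_set_def by blast
qed

lemma test_funI:
  assumes "smooth \<phi>" "compact K" "K \<subseteq> U" "\<And>x. x \<notin> K \<Longrightarrow> \<phi> x = 0"
  shows "test_fun U \<phi>"
proof -
  have "tsupport \<phi> \<subseteq> K" using assms by (intro tsupport_subset compact_imp_closed)
  moreover have "closed (tsupport \<phi>)" unfolding tsupport_def by simp
  ultimately have "compact (tsupport \<phi>)"
    using compact_Int_closed[OF assms(2), of "tsupport \<phi>"] by (simp add: Int_absorb1)
  moreover have "smooth_on_set U \<phi>"
    using assms(1) continuous_on_subset unfolding smooth_on_set_def by blast
  ultimately show ?thesis using \<open>tsupport \<phi> \<subseteq> K\<close> assms(3) unfolding test_fun_def by auto
qed

lemma test_funE: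
  assumes "open U" "test_fun U \<phi>"
  obtains K where "smooth \<phi>" "compact K" "K \<subseteq> U" "\<And>x bs. x \<notin> K \<Longrightarrow> pds bs \<phi> x = 0"
proof
  show "smooth \<phi>" by (rule test_fun_smooth[OF assms])
  show "compact (tsupport \<phi>)" "tsupport \<phi> \<subseteq> U" using assms(2) unfolding test_fun_def by auto
  show "pds bs \<phi> x = 0" if "x \<notin> tsupport \<phi>" for x bs
    using that by (intro pds_eq_0_outside(1)[of "- tsupport \<phi>"])
      (auto simp: not_in_tsupport, simp add: tsupport_def open_Compl)
qed

lemma test_fun_pds:
  assumes "open U" "test_fun U \<phi>" "set bs \<subseteq> Basis" shows "test_fun U (pds bs \<phi>)"
proof -
  obtain K where K: "smooth \<phi>" "compact K" "K \<subseteq> U" "\<And>x bs. x \<notin> K \<Longrightarrow> pds bs \<phi> x = 0"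
    using test_funE[OF assms(1,2)] by blast
  then show ?thesis by (intro test_funI[of _ K] smooth_pds assms)
qed

lemma test_fun_pd: "open U \<Longrightarrow> test_fun U \<phi> \<Longrightarrow> b \<in> Basis \<Longrightarrow> test_fun U (pd b \<phi>)"
  using test_fun_pds[of U \<phi> "[b]"] by simp

lemma test_fun_compose:
  fixes T :: "real \<Rightarrow> real"
  assumes "open U" "test_fun U \<phi>" "smooth T" "T 0 = 0"
  shows "test_fun U (\<lambda>x. T (\<phi> x))"
proof -
  obtain K where K: "smooth \<phi>" "compact K" "K \<subseteq> U" "\<And>x bs. x \<notin> K \<Longrightarrow> pds bs \<phi> x = 0"
    using test_funE[OF assms(1,2)] by blast
  have "\<And>x. x \<notin> K \<Longrightarrow> \<phi> x = 0" using K(4)[of _ "[]"] by simp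
  then show ?thesis
    by (intro test_funI[OF smooth_compose[OF assms(3) K(1)] K(2,3)]) (simp add: assms(4))
qed

lemma test_fun_bounded:
  fixes \<phi> :: "'a::euclidean_space \<Rightarrow> real"
  assumes "open U" "test_fun U \<phi>" obtains C where "\<And>x. \<bar>\<phi> x\<bar> \<le> C"
proof -
  obtain K where K: "smooth \<phi>" "compact K" "\<And>x bs. x \<notin> K \<Longrightarrow> pds bs \<phi> x = 0"
    using test_funE[OF assms(1,2)] by metis
  have z: "\<And>x. x \<notin> K \<Longrightarrow> \<phi> x = 0" using K(3)[of _ "[]"] by simp
  have "compact (\<phi> ` K)"
    using K by (meson compact_continuous_image continuous_on_subset smooth_continuous subset_UNIV)
  then obtain C where "\<forall>y\<in>\<phi> ` K. \<bar>y\<bar> \<le> C"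
    using compact_imp_bounded bounded_real by blast
  then have "\<bar>\<phi> x\<bar> \<le> max C 0" for x
    using z[of x] by (cases "x \<in> K") (auto simp: max_def intro: order_trans)
  then show ?thesis by (rule that)
qed

subsection \<open>Smooth bump functions\<close>

text \<open>The classical flat function exp(-1/x), extended by 0. The polynomial factor in 1/x makes
  the family closed under differentiation.\<close>

definition exp_inverse_poly :: "real poly \<Rightarrow> real \<Rightarrow> real" where
  "exp_inverse_poly P x = (if x > 0 then poly P (inverse x) * exp (- inverse x) else 0)"

lemma poly_exp_tendsto_0: "((\<lambda>y. poly Q y * exp (- y)) \<longlongrightarrow> 0) at_top" for Q :: "real poly"
proof -
  have "((\<lambda>y. \<Sum>i\<le>degree Q. coeff Q i * (y ^ i / exp y)) \<longlongrightarrow> (\<Sum>i\<le>degree Q. coeff Q i * 0)) at_top"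
    by (intro tendsto_intros tendsto_power_div_exp_0)
  then show ?thesis
    by (simp add: poly_altdef sum_distrib_right exp_minus divide_inverse mult.assoc)
qed

text \<open>With y = 1/x the operator d/dx is -y^2 d/dy, which sends P(y) exp(-y) to y^2 (P - P')(y)
  exp(-y); the polynomial y^2 is \<open>[:0,0,1:]\<close>.\<close>

lemma exp_inverse_poly_deriv:
  "(exp_inverse_poly P has_real_derivative exp_inverse_poly ([:0,0,1:] * (P - pderiv P)) x) (at x)"
proof -
  consider "x < 0" | "x = 0" | "x > 0" by linarith
  then show ?thesis
  proof cases
    case 1
    have "((\<lambda>_. 0) has_real_derivative exp_inverse_poly ([:0,0,1:] * (P - pderiv P)) x) (at x)"
      using 1 by (simp add: exp_inverse_poly_def)
    then show ?thesis
      by (rule has_field_derivative_transform_within_open[where S = "{..<0}"])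
        (use 1 in \<open>auto simp: exp_inverse_poly_def\<close>)
  next
    case 2
    \<comment> \<open>\<open>pCons 0 P\<close> carries the extra factor 1/h of the difference
      quotient at 0.\<close>
    have "((\<lambda>h. poly (pCons 0 P) (inverse h) * exp (- inverse h)) \<longlongrightarrow> 0) (at_right 0)"
      by (rule filterlim_compose[OF poly_exp_tendsto_0 filterlim_inverse_at_top_right])
    then have r: "((\<lambda>h. exp_inverse_poly P h / h) \<longlongrightarrow> 0) (at_right 0)"
      by (rule tendsto_cong[THEN iffD1, rotated])
        (auto simp: eventually_at_right_less exp_inverse_poly_def field_simps
          intro!: eventually_mono[OF eventually_at_right_less])
    have l: "((\<lambda>h. exp_inverse_poly P h / h) \<longlongrightarrow> 0) (at_left 0)"
      by (rule tendsto_eventually)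
        (auto simp: exp_inverse_poly_def eventually_at_left_field intro!: exI[of _ "-1"])
    from l r have "((\<lambda>h. exp_inverse_poly P h / h) \<longlongrightarrow> 0) (at 0)"
      by (rule filterlim_split_at)
    then show ?thesis
      using 2 by (simp add: DERIV_def exp_inverse_poly_def)
  next
    case 3
    have "((\<lambda>x. poly P (inverse x) * exp (- inverse x)) has_real_derivative
        (poly (pderiv P) (inverse x) * (- (inverse x ^ 2))) * exp (- inverse x) +
        poly P (inverse x) * (exp (- inverse x) * inverse x ^ 2)) (at x)"
      using 3 by (auto intro!: derivative_eq_intros DERIV_chain2[OF poly_DERIV] simp: power2_eq_square)
    then have "((\<lambda>x. poly P (inverse x) * exp (- inverse x)) has_real_derivative
        exp_inverse_poly ([:0,0,1:] * (P - pderiv P)) x) (at x)"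
      using 3 by (simp add: exp_inverse_poly_def algebra_simps power2_eq_square)
    then show ?thesis
      by (rule has_field_derivative_transform_within_open[where S = "{0<..}"])
        (use 3 in \<open>auto simp: exp_inverse_poly_def\<close>)
  qed
qed

lemma smooth_exp_inverse_poly: "smooth (exp_inverse_poly P)"
proof (rule smooth_coinduct[where P = "\<lambda>f. \<exists>P. f = exp_inverse_poly P"])
  fix f :: "real \<Rightarrow> real" and b :: real
  assume "\<exists>P. f = exp_inverse_poly P"
  then obtain P where P: "f = exp_inverse_poly P" by blast
  show "continuous_on UNIV f"
    unfolding P using exp_inverse_poly_deriv
    by (meson DERIV_isCont continuous_at_imp_continuous_on)
  assume "b \<in> Basis"
  then have b: "b = 1" by simp
  have d: "((\<lambda>h. f (x + h *\<^sub>R b)) has_real_derivative exp_inverse_poly ([:0,0,1:] * (P - pderiv P)) x) (at 0)" for x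
    using DERIV_at_within_shift[of "exp_inverse_poly P" "exp_inverse_poly ([:0,0,1:] * (P - pderiv P)) x" x 0 UNIV]
      exp_inverse_poly_deriv[of P x] unfolding P b by (simp add: o_def)
  show "(\<lambda>h. f (x + h *\<^sub>R b)) differentiable (at (0::real))" for x
    by (rule real_differentiableI_DERIV[OF d])
  show "\<exists>P. pd b f = exp_inverse_poly P"
    using pd_eqI[OF d] by blast
qed auto

lemma continuous_antiderivative:
  fixes f :: "real \<Rightarrow> real"
  assumes "continuous_on UNIV f"
  obtains F where "\<And>x. (F has_real_derivative f x) (at x)"
proof
  let ?F = "\<lambda>x. if 0 \<le> x then integral {0..x} f else - integral {x..0} f"
  fix x :: real
  \<comment> \<open>The radius puts x into the interior of \<open>{-R..R}\<close>, where the
    two-sided integral from 0 differs from the integral from -R by a constant.\<close>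
  define R where "R = \<bar>x\<bar> + 1"
  have int: "f integrable_on {a..b}" for a b
    using assms continuous_on_subset by (blast intro: integrable_continuous_real)
  have eq: "integral {-R..y} f - integral {-R..0} f = ?F y" if "y \<in> {-R<..<R}" for y
  proof (cases "0 \<le> y")
    case True
    then have "integral {-R..0} f + integral {0..y} f = integral {-R..y} f"
      by (intro Henstock_Kurzweil_Integration.integral_combine int) (auto simp: R_def)
    with True show ?thesis by simp
  next
    case False
    then have "integral {-R..y} f + integral {y..0} f = integral {-R..0} f"
      using that by (intro Henstock_Kurzweil_Integration.integral_combine int) auto
    with False show ?thesis by simp
  qed
  have "((\<lambda>y. integral {-R..y} f) has_real_derivative f x) (at x within {-R..R})"
    using assms continuous_on_subset by (intro integral_has_real_derivative) (auto simp: R_def)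
  then have "((\<lambda>y. integral {-R..y} f) has_real_derivative f x) (at x)"
    by (subst (asm) at_within_interior) (auto simp: R_def)
  then have "((\<lambda>y. integral {-R..y} f - integral {-R..0} f) has_real_derivative f x) (at x)"
    by (auto intro!: derivative_eq_intros)
  then show "(?F has_real_derivative f x) (at x)"
    by (rule has_field_derivative_transform_within_open[where S = "{-R<..<R}"])
      (use eq in \<open>auto simp: R_def\<close>)
qed

text \<open>The step is the normalised primitive of a nonnegative bump that is positive exactly on
  (0,1), built from two reflected flat functions.\<close>

lemma smooth_step_exists:
  "\<exists>H::real \<Rightarrow> real. smooth H \<and> mono H \<and> (\<forall>s\<le>0. H s = 0) \<and> (\<forall>s\<ge>1. H s = 1)"
proof -
  define e where "e = (\<lambda>x. exp_inverse_poly 1 x * exp_inverse_poly 1 (1 - x))"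
  have e: "smooth e"
    unfolding e_def
    by (rule smooth_mult[OF smooth_exp_inverse_poly
          smooth_compose[OF smooth_exp_inverse_poly smooth_diff[OF smooth_const smooth_ident]]])
  have e_nonneg: "e x \<ge> 0" for x by (auto simp: e_def exp_inverse_poly_def)
  have e0: "e x = 0" if "x \<le> 0 \<or> x \<ge> 1" for x using that by (auto simp: e_def exp_inverse_poly_def)
  have e_pos: "e x > 0" if "0 < x" "x < 1" for x using that by (auto simp: e_def exp_inverse_poly_def)
  obtain F where F: "\<And>x. (F has_real_derivative e x) (at x)"
    using continuous_antiderivative[OF smooth_continuous[OF e]] by blast
  have mono: "F x \<le> F y" if "x \<le> y" for x y
    by (rule DERIV_nonneg_imp_nondecreasing[OF that]) (use F e_nonneg in blast)
  have lt: "F 0 < F 1"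
    by (rule DERIV_pos_imp_increasing_open) (use F e_pos in \<open>auto intro!: DERIV_isCont continuous_at_imp_continuous_on\<close>)
  have le0: "F s = F 0" if "s \<le> 0" for s
  proof (cases "s = 0")
    case False
    with that have "s < 0" by simp
    then obtain z where "s < z" "z < 0" "F 0 - F s = (0 - s) * e z"
      using MVT2[OF \<open>s < 0\<close> F] by auto
    then show ?thesis using e0[of z] by simp
  qed simp
  have ge1: "F s = F 1" if "s \<ge> 1" for s
  proof (cases "s = 1")
    case False
    with that have "1 < s" by simp
    then obtain z where "1 < z" "z < s" "F s - F 1 = (s - 1) * e z"
      using MVT2[OF \<open>1 < s\<close> F] by auto
    then show ?thesis using e0[of z] by simp
  qed simp
  define H where "H = (\<lambda>s. inverse (F 1 - F 0) * (F s - F 0))"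
  have "smooth H"
    unfolding H_def by (rule smooth_cmult[OF smooth_diff[OF smooth_primitive(1)[OF F e] smooth_const]])
  moreover have "mono H"
    unfolding H_def by (intro monoI mult_left_mono) (use mono lt in auto)
  moreover have "H s = 0" if "s \<le> 0" for s
    using le0[OF that] by (simp add: H_def)
  moreover have "H s = 1" if "s \<ge> 1" for s
    using ge1[OF that] lt by (simp add: H_def)
  ultimately show ?thesis by blast
qed

section \<open>The smooth step and cut-offs of intervals and boxes\<close>

definition smooth_step :: "real \<Rightarrow> real" where
  "smooth_step = (SOME H. smooth H \<and> mono H \<and> (\<forall>s\<le>0. H s = 0) \<and> (\<forall>s\<ge>1. H s = 1))"

lemma smooth_step: "smooth smooth_step" "mono smooth_step"
  "s \<le> 0 \<Longrightarrow> smooth_step s = 0" "s \<ge> 1 \<Longrightarrow> smooth_step s = 1"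
  using someI_ex[OF smooth_step_exists] unfolding smooth_step_def by blast+

lemma smooth_step_range: "0 \<le> smooth_step s" "smooth_step s \<le> 1"
proof -
  have "smooth_step (min s 0) \<le> smooth_step s" "smooth_step s \<le> smooth_step (max s 1)"
    using smooth_step(2) by (auto simp: mono_def)
  then show "0 \<le> smooth_step s" "smooth_step s \<le> 1"
    using smooth_step(3)[of "min s 0"] smooth_step(4)[of "max s 1"] by auto
qed

lemma smooth_affine: "smooth g \<Longrightarrow> smooth (\<lambda>s. g (c * s + d))" for g :: "real \<Rightarrow> real"
  by (rule smooth_compose[OF _ smooth_add[OF smooth_cmult[OF smooth_ident] smooth_const]])

text \<open>A cut-off for the interval (a,b) with steepness k. The transition layers have width 1/k
  and lie inside the interval, so the support never exceeds it, while the limit for large k is the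
  indicator of the open interval.\<close>

definition plateau :: "real \<Rightarrow> real \<Rightarrow> real \<Rightarrow> real \<Rightarrow> real" where
  "plateau k a b s = smooth_step (k * (s - a)) * smooth_step (k * (b - s))"

lemma smooth_plateau: "smooth (plateau k a b)"
proof -
  have "smooth (\<lambda>s. smooth_step (k * s + (- k * a)) * smooth_step (- k * s + k * b))"
    by (intro smooth_mult smooth_affine smooth_step)
  moreover have "(\<lambda>s. smooth_step (k * s + (- k * a)) * smooth_step (- k * s + k * b)) = plateau k a b"
    by (auto simp: plateau_def algebra_simps)
  ultimately show ?thesis by simp
qed

lemma plateau_range: "0 \<le> plateau k a b s" "plateau k a b s \<le> 1"
  using smooth_step_range[of "k * (s - a)"] smooth_step_range[of "k * (b - s)"]
  by (auto simp: plateau_def intro: mult_le_one)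

lemma plateau_outside: "k \<ge> 0 \<Longrightarrow> s \<notin> {a<..<b} \<Longrightarrow> plateau k a b s = 0"
  by (auto simp: plateau_def not_less mult_nonneg_nonpos smooth_step)

lemma plateau_tendsto: "(\<lambda>k. plateau (real k) a b s) \<longlonglongrightarrow> indicator {a<..<b} s"
proof (cases "s \<in> {a<..<b}")
  case True
  have ev: "\<forall>\<^sub>F k in sequentially. real k * d \<ge> 1" if "d > 0" for d :: real
  proof -
    obtain m :: nat where "1 / d < real m" using reals_Archimedean2 by blast
    then have "1 < real m * d" using \<open>d > 0\<close> by (simp add: pos_divide_less_eq)
    moreover have "real m * d \<le> real k * d" if "k \<ge> m" for k
      using that \<open>d > 0\<close> by (intro mult_right_mono) auto
    ultimately have "real k * d \<ge> 1" if "k \<ge> m" for k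
      using that by (meson less_imp_le less_le_trans)
    then show ?thesis by (rule eventually_sequentiallyI)
  qed
  have "\<forall>\<^sub>F k in sequentially. real k * (s - a) \<ge> 1" "\<forall>\<^sub>F k in sequentially. real k * (b - s) \<ge> 1"
    using True by (auto intro: ev)
  then have "\<forall>\<^sub>F k in sequentially. plateau (real k) a b s = 1"
    by eventually_elim (simp add: plateau_def smooth_step)
  then show ?thesis using True by (simp add: tendsto_eventually)
next
  case False
  then show ?thesis by (simp add: plateau_outside)
qed

definition box_plateau :: "real \<Rightarrow> 'a::euclidean_space \<Rightarrow> 'a \<Rightarrow> 'a \<Rightarrow> real" where
  "box_plateau k a b x = (\<Prod>i\<in>Basis. plateau k (a \<bullet> i) (b \<bullet> i) (x \<bullet> i))"

lemma box_plateau_range: "0 \<le> box_plateau k a b x" "box_plateau k a b x \<le> 1"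
  unfolding box_plateau_def by (auto intro!: prod_nonneg prod_le_1 plateau_range)

lemma box_plateau_outside: "k \<ge> 0 \<Longrightarrow> x \<notin> box a b \<Longrightarrow> box_plateau k a b x = 0"
  unfolding box_plateau_def by (auto simp: mem_box intro!: prod_zero plateau_outside bexI)

lemma smooth_coordinate_prod:
  assumes "\<And>i. i \<in> Basis \<Longrightarrow> smooth (h i)"
  shows "smooth (\<lambda>x::'a::euclidean_space. \<Prod>i\<in>Basis. h i (x \<bullet> i))"
  by (rule smooth_prod) (rule smooth_compose[OF assms smooth_inner])

lemma smooth_box_plateau: "smooth (box_plateau k a b)"
  unfolding box_plateau_def[abs_def] by (rule smooth_coordinate_prod) (rule smooth_plateau)

lemma test_fun_box_plateau: "cbox a b \<subseteq> U \<Longrightarrow> k \<ge> 0 \<Longrightarrow> test_fun U (box_plateau k a b)"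
  by (rule test_funI[OF smooth_box_plateau, of "cbox a b"])
    (use box_subset_cbox in \<open>auto intro!: box_plateau_outside\<close>)

lemma box_plateau_tendsto: "(\<lambda>k. box_plateau (real k) a b x) \<longlonglongrightarrow> indicator (box a b) x"
proof -
  have "(\<lambda>k. box_plateau (real k) a b x) \<longlonglongrightarrow> (\<Prod>i\<in>Basis. indicator {a \<bullet> i<..<b \<bullet> i} (x \<bullet> i))"
    unfolding box_plateau_def by (intro tendsto_prod plateau_tendsto)
  also have "(\<Prod>i\<in>Basis. indicator {a \<bullet> i<..<b \<bullet> i} (x \<bullet> i)) = (indicator (box a b) x :: real)"
    by (auto simp: indicator_def mem_box intro!: prod.neutral)
  finally show ?thesis .
qed

lemma smooth_measurable: "smooth f \<Longrightarrow> f \<in> borel_measurable lebesgue"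
  using borel_measurable_continuous_onI[OF smooth_continuous]
  by (intro measurable_completion) simp

subsection \<open>Recovering a locally integrable function from test functions\<close>

text \<open>Through this limit statements about test functions become statements about integrals
  over boxes. Dominated convergence yields the open box, whose boundary is a null set.\<close>

lemma integral_box_plateau_tendsto:
  assumes "loc_int U g" "cbox a b \<subseteq> U"
  shows "(\<lambda>k. LINT x:U|lebesgue. g x * box_plateau (real k) a b x) \<longlonglongrightarrow> (LINT x:cbox a b|lebesgue. g x)"
proof -
  have int: "set_integrable lebesgue (cbox a b) g"
    using assms unfolding loc_int_def by auto
  have int_box: "set_integrable lebesgue (box a b) g"
    by (rule set_integrable_subset[OF int]) (auto intro: box_subset_cbox[THEN subsetD])
  have eq: "indicator U x *\<^sub>R (g x * box_plateau (real k) a b x) =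
      (indicator (cbox a b) x *\<^sub>R g x) * box_plateau (real k) a b x" for k x
    using assms(2) box_plateau_outside[of "real k" x a b] box_subset_cbox[of a b]
    by (auto simp: indicator_def)
  have meas: "box_plateau k a b \<in> borel_measurable lebesgue" for k
    by (rule smooth_measurable[OF smooth_box_plateau])
  have "(\<lambda>k. LINT x|lebesgue. (indicator (cbox a b) x *\<^sub>R g x) * box_plateau (real k) a b x) \<longlonglongrightarrow>
      (LINT x|lebesgue. indicator (box a b) x *\<^sub>R g x)"
  proof (rule integral_dominated_convergence[where w = "\<lambda>x. norm (indicator (cbox a b) x *\<^sub>R g x)"])
    show "(\<lambda>x. indicator (box a b) x *\<^sub>R g x) \<in> borel_measurable lebesgue"
      using int_box unfolding set_integrable_def by auto
    show "integrable lebesgue (\<lambda>x. norm (indicator (cbox a b) x *\<^sub>R g x))"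
      using int unfolding set_integrable_def by (rule integrable_norm)
    then show "(\<lambda>x. (indicator (cbox a b) x *\<^sub>R g x) * box_plateau (real k) a b x) \<in> borel_measurable lebesgue" for k
      using int unfolding set_integrable_def by (intro borel_measurable_times meas) auto
    show "AE x in lebesgue. (\<lambda>k. (indicator (cbox a b) x *\<^sub>R g x) * box_plateau (real k) a b x) \<longlonglongrightarrow>
        indicator (box a b) x *\<^sub>R g x"
    proof (rule AE_I2)
      fix x
      have "(\<lambda>k. (indicator (cbox a b) x *\<^sub>R g x) * box_plateau (real k) a b x) \<longlonglongrightarrow>
          (indicator (cbox a b) x *\<^sub>R g x) * indicator (box a b) x"
        by (intro tendsto_intros box_plateau_tendsto)
      then show "(\<lambda>k. (indicator (cbox a b) x *\<^sub>R g x) * box_plateau (real k) a b x) \<longlonglongrightarrow>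
          indicator (box a b) x *\<^sub>R g x"
        using box_subset_cbox[of a b] by (auto simp: indicator_def split: if_splits)
    qed
    show "AE x in lebesgue. norm ((indicator (cbox a b) x *\<^sub>R g x) * box_plateau (real k) a b x)
        \<le> norm (indicator (cbox a b) x *\<^sub>R g x)" for k
      using box_plateau_range[of "real k" a b]
      by (intro AE_I2) (auto simp: abs_mult intro!: mult_left_le)
  qed
  moreover have "(LINT x:box a b|lebesgue. g x) = (LINT x:cbox a b|lebesgue. g x)"
    using int int_box by (simp add: set_lebesgue_integral_eq_integral integral_open_interval)
  ultimately show ?thesis
    unfolding set_lebesgue_integral_def eq by simp
qed

text \<open>Lebesgue differentiation along the one-sided cubes with lower corner x.\<close>

lemma AE_abs_le_of_averages:
  fixes g :: "'a::euclidean_space \<Rightarrow> real"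
  assumes "open U" "loc_int U g"
    and avg: "\<And>x. x \<in> U \<Longrightarrow> \<exists>d>0. \<forall>h. 0 < h \<and> h < d \<longrightarrow>
        \<bar>LINT y:cbox x (x + h *\<^sub>R One)|lebesgue. g y\<bar> \<le> C * h ^ DIM('a)"
  shows "AE x in lebesgue. x \<in> U \<longrightarrow> \<bar>g x\<bar> \<le> C"
proof -
  have box: "AE x in lebesgue. x \<in> cbox a b \<longrightarrow> \<bar>g x\<bar> \<le> C" if ab: "cbox a b \<subseteq> U" for a b
  proof -
    \<comment> \<open>Extension by zero makes the function integrable on every box, as the
      differentiation theorem demands.\<close>
    define f where "f = (\<lambda>x. if x \<in> cbox a b then g x else 0)"
    have int: "set_integrable lebesgue (cbox a b) g"
      using assms(2) ab unfolding loc_int_def by auto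
    then have gint: "g integrable_on cbox a b" 
      using set_lebesgue_integral_eq_integral(1) by blast
    have f: "f integrable_on cbox c d" for c d
    proof (rule integrable_on_subcbox[of _ UNIV])
      show "f integrable_on UNIV"
        using gint unfolding f_def by (simp add: integrable_restrict_UNIV)
    qed auto
    obtain N where N: "negligible N"
      "\<And>x e. x \<notin> N \<Longrightarrow> 0 < e \<Longrightarrow> \<exists>d>0. \<forall>h. 0 < h \<and> h < d \<longrightarrow>
          norm (integral (cbox x (x + h *\<^sub>R One)) f /\<^sub>R h ^ DIM('a) - f x) < e"
      using integrable_ccontinuous_explicit[of f] f by metis
    have "\<bar>g x\<bar> \<le> C" if x: "x \<in> box a b" "x \<notin> N" for x
    proof (rule field_le_epsilon)
      fix e :: real assume "e > 0"
      obtain d1 where d1: "d1 > 0" "\<And>h. 0 < h \<Longrightarrow> h < d1 \<Longrightarrow>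
          norm (integral (cbox x (x + h *\<^sub>R One)) f /\<^sub>R h ^ DIM('a) - f x) < e"
        using N(2)[OF x(2) \<open>e > 0\<close>] by blast
      have xU: "x \<in> U" using x ab box_subset_cbox by blast
      obtain d2 where d2: "d2 > 0" "\<And>h. 0 < h \<Longrightarrow> h < d2 \<Longrightarrow>
          \<bar>LINT y:cbox x (x + h *\<^sub>R One)|lebesgue. g y\<bar> \<le> C * h ^ DIM('a)"
        using avg[OF xU] by blast
      define d3 where "d3 = Min ((\<lambda>i. b \<bullet> i - x \<bullet> i) ` Basis)"
      have "d3 > 0" using x by (auto simp: d3_def mem_box)
      \<comment> \<open>The side obeys three limits: the average is close to the value at x, the
        hypothesis on averages applies, and the cube stays in the box where f and g agree.\<close>
      define h where "h = min d1 (min d2 d3) / 2"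
      have h: "0 < h" "h < d1" "h < d2" "h < d3"
        using d1(1) d2(1) \<open>d3 > 0\<close> by (auto simp: h_def min_def)
      have sub: "cbox x (x + h *\<^sub>R One) \<subseteq> cbox a b"
      proof -
        have "x \<bullet> i + h \<le> b \<bullet> i" if "i \<in> Basis" for i
        proof -
          have "d3 \<le> b \<bullet> i - x \<bullet> i" using that by (auto simp: d3_def intro!: Min_le)
          with h show ?thesis by simp
        qed
        then show ?thesis
          using x h(1) unfolding subset_box mem_box
          by (auto simp: inner_add_left less_imp_le)
      qed
      have int': "set_integrable lebesgue (cbox x (x + h *\<^sub>R One)) g"
        by (rule set_integrable_subset[OF int _ sub]) auto
      have "integral (cbox x (x + h *\<^sub>R One)) f = integral (cbox x (x + h *\<^sub>R One)) g"
        by (rule integral_cong) (use sub in \<open>auto simp: f_def\<close>)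
      also have "\<dots> = (LINT y:cbox x (x + h *\<^sub>R One)|lebesgue. g y)"
        using set_lebesgue_integral_eq_integral(2)[OF int'] by simp
      finally have "\<bar>integral (cbox x (x + h *\<^sub>R One)) f\<bar> \<le> C * h ^ DIM('a)"
        using d2(2)[OF h(1,3)] by simp
      then have 1: "\<bar>integral (cbox x (x + h *\<^sub>R One)) f /\<^sub>R h ^ DIM('a)\<bar> \<le> C"
        using h(1) by (simp add: abs_mult divide_simps)
      have "\<bar>integral (cbox x (x + h *\<^sub>R One)) f /\<^sub>R h ^ DIM('a) - g x\<bar> < e"
        using d1(2)[OF h(1,2)] x(1) box_subset_cbox[of a b] by (auto simp: f_def)
      with 1 show "\<bar>g x\<bar> \<le> C + e" by linarith
    qed
    then have "{x \<in> cbox a b. \<not> \<bar>g x\<bar> \<le> C} \<subseteq> N \<union> (cbox a b - box a b)" by auto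
    moreover have "negligible (N \<union> (cbox a b - box a b))"
      using N(1) negligible_frontier_interval by (rule negligible_Un)
    ultimately have "negligible {x \<in> cbox a b. \<not> \<bar>g x\<bar> \<le> C}"
      using negligible_subset by blast
    then show ?thesis
      unfolding negligible_iff_null_sets by (rule AE_I') auto
  qed
  \<comment> \<open>An open set is a countable union of closed boxes, so the exceptional null sets
    add up to a null set.\<close>
  obtain D where D: "countable D" "D \<subseteq> Pow U" "\<And>X. X \<in> D \<Longrightarrow> \<exists>a b. X = cbox a b" "\<Union>D = U"
    using open_countable_Union_open_cbox[OF assms(1)] by metis
  have "AE x in lebesgue. \<forall>X\<in>D. x \<in> X \<longrightarrow> \<bar>g x\<bar> \<le> C"
    using D box by (subst AE_ball_countable[OF D(1)]) (metis Pow_iff subsetD)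
  then show ?thesis
    by eventually_elim (use D(4) in blast)
qed

text \<open>The fundamental lemma of the calculus of variations. Plateaus show that g has integral 0
  over every closed box in U, so \<open>AE_abs_le_of_averages\<close> applies with bound 0.\<close>

theorem test_fun_determines:
  assumes "open U" "loc_int U g"
    and "\<And>\<phi>. test_fun U \<phi> \<Longrightarrow> (LINT x:U|lebesgue. g x * \<phi> x) = 0"
  shows "AE x in lebesgue. x \<in> U \<longrightarrow> g x = 0"
proof -
  have z: "(LINT y:cbox a b|lebesgue. g y) = 0" if "cbox a b \<subseteq> U" for a b
    using integral_box_plateau_tendsto[OF assms(2) that] assms(3)[OF test_fun_box_plateau[OF that]]
    by (simp add: LIMSEQ_const_iff)
  have "AE x in lebesgue. x \<in> U \<longrightarrow> \<bar>g x\<bar> \<le> 0"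
  proof (rule AE_abs_le_of_averages[OF assms(1,2)])
    fix x assume "x \<in> U"
    then obtain e where e: "e > 0" "ball x e \<subseteq> U"
      using assms(1) open_contains_ball by blast
    have "cbox x (x + h *\<^sub>R One) \<subseteq> U" if "0 < h" "h < e / real DIM('a)" for h
    proof
      fix y assume "y \<in> cbox x (x + h *\<^sub>R One)"
      then have *: "\<bar>(y - x) \<bullet> i\<bar> \<le> h" if "i \<in> Basis" for i
        using that by (auto simp: mem_box inner_diff_left inner_add_left inner_sum_left_Basis)
      have "norm (y - x) \<le> (\<Sum>i\<in>Basis. \<bar>(y - x) \<bullet> i\<bar>)" by (rule norm_le_l1)
      also have "\<dots> \<le> (\<Sum>i\<in>(Basis::'a set). h)" by (intro sum_mono *)
      also have "\<dots> < e" using that by (simp add: field_simps)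
      finally show "y \<in> U" using e(2) by (auto simp: dist_norm norm_minus_commute)
    qed
    then show "\<exists>d>0. \<forall>h. 0 < h \<and> h < d \<longrightarrow>
        \<bar>LINT y:cbox x (x + h *\<^sub>R One)|lebesgue. g y\<bar> \<le> 0 * h ^ DIM('a)"
      using e(1) z by (intro exI[of _ "e / real DIM('a)"]) auto
  qed
  then show ?thesis by simp
qed

subsection \<open>Square-integrable functions\<close>

definition sq_int :: "'a measure \<Rightarrow> ('a \<Rightarrow> real) \<Rightarrow> bool" where
  "sq_int M f \<longleftrightarrow> f \<in> borel_measurable M \<and> integrable M (\<lambda>x. (f x)\<^sup>2)"

definition ip :: "'a measure \<Rightarrow> ('a \<Rightarrow> real) \<Rightarrow> ('a \<Rightarrow> real) \<Rightarrow> real" where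
  "ip M f g = (LINT x|M. f x * g x)"

lemma sq_int_measurable: "sq_int M f \<Longrightarrow> f \<in> borel_measurable M"
  by (simp add: sq_int_def)

lemma sq_int_mult:
  assumes "sq_int M f" "sq_int M g" shows "integrable M (\<lambda>x. f x * g x)"
proof (rule Bochner_Integration.integrable_bound)
  show "integrable M (\<lambda>x. (f x)\<^sup>2 + (g x)\<^sup>2)"
    using assms by (simp add: sq_int_def)
  show "(\<lambda>x. f x * g x) \<in> borel_measurable M"
    using assms by (auto simp: sq_int_def)
  have "\<bar>a * b\<bar> \<le> a\<^sup>2 + b\<^sup>2" for a b :: real
    using sum_squares_bound[of "\<bar>a\<bar>" "\<bar>b\<bar>"] mult_nonneg_nonneg[of "\<bar>a\<bar>" "\<bar>b\<bar>"]
    unfolding abs_mult power2_abs by linarith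
  then show "AE x in M. norm (f x * g x) \<le> norm ((f x)\<^sup>2 + (g x)\<^sup>2)"
    by simp
qed

lemma sq_int_cmult: "sq_int M f \<Longrightarrow> sq_int M (\<lambda>x. c * f x)"
  by (auto simp: sq_int_def power_mult_distrib)

lemma sq_int_add: "sq_int M f \<Longrightarrow> sq_int M g \<Longrightarrow> sq_int M (\<lambda>x. f x + g x)"
  using sq_int_mult[of M f g] by (auto simp: sq_int_def power2_sum mult.assoc)

lemma sq_int_diff: "sq_int M f \<Longrightarrow> sq_int M g \<Longrightarrow> sq_int M (\<lambda>x. f x - g x)"
  using sq_int_add[OF _ sq_int_cmult[of M g "-1"], of f] by simp

lemma sq_int_zero: "sq_int M (\<lambda>_. 0)"
  by (simp add: sq_int_def)

lemma sq_int_sum: "(\<And>i. i \<in> A \<Longrightarrow> sq_int M (f i)) \<Longrightarrow> sq_int M (\<lambda>x. \<Sum>i\<in>A. f i x)"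
  by (induction A rule: infinite_finite_induct) (auto intro: sq_int_zero sq_int_add)

lemma sq_int_bounded_mult:
  assumes "sq_int M f" "g \<in> borel_measurable M" "AE x in M. \<bar>g x\<bar> \<le> C * \<bar>f x\<bar>"
  shows "sq_int M g"
  unfolding sq_int_def
proof
  show "integrable M (\<lambda>x. (g x)\<^sup>2)"
  proof (rule Bochner_Integration.integrable_bound)
    show "integrable M (\<lambda>x. (C * f x)\<^sup>2)"
      using sq_int_cmult[OF assms(1)] by (simp add: sq_int_def)
    show "AE x in M. norm ((g x)\<^sup>2) \<le> norm ((C * f x)\<^sup>2)"
      using assms(3)
    proof eventually_elim
      case (elim x)
      then have "\<bar>g x\<bar> \<le> \<bar>C * f x\<bar>"
        by (simp add: abs_mult) (metis abs_ge_self abs_ge_zero mult_right_mono order_trans)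
      then have "(g x)\<^sup>2 \<le> (C * f x)\<^sup>2"
        by (rule abs_le_square_iff[THEN iffD1])
      then show ?case by simp
    qed
  qed (use assms in measurable)
qed fact

lemma ip_commute: "ip M f g = ip M g f"
  by (simp add: ip_def mult.commute)

lemma ip_self: "ip M f f = (LINT x|M. (f x)\<^sup>2)"
  by (simp add: ip_def power2_eq_square)

lemma ip_self_nonneg: "0 \<le> ip M f f"
  by (simp add: ip_self)

lemma ip_diff_left: "sq_int M f \<Longrightarrow> sq_int M g \<Longrightarrow> sq_int M h \<Longrightarrow> ip M (\<lambda>x. f x - g x) h = ip M f h - ip M g h"
  by (simp add: ip_def left_diff_distrib sq_int_mult)

lemma ip_cmult_left: "ip M (\<lambda>x. c * f x) h = c * ip M f h"
  by (simp add: ip_def mult.assoc)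

lemma ip_diff_right: "sq_int M f \<Longrightarrow> sq_int M g \<Longrightarrow> sq_int M h \<Longrightarrow> ip M h (\<lambda>x. f x - g x) = ip M h f - ip M h g"
  using ip_diff_left[of M f g h] by (simp add: ip_commute)

lemma ip_cmult_right: "ip M h (\<lambda>x. c * f x) = c * ip M h f"
  using ip_cmult_left[of M c f h] by (simp add: ip_commute)

lemma ip_sum_right:
  "(\<And>i. i \<in> A \<Longrightarrow> sq_int M (f i)) \<Longrightarrow> sq_int M h \<Longrightarrow>
    ip M h (\<lambda>x. \<Sum>i\<in>A. f i x) = (\<Sum>i\<in>A. ip M h (f i))"
  by (simp add: ip_def sum_distrib_left sq_int_mult)

lemma ip_cong_AE:
  assumes "AE x in M. f x = f' x" "AE x in M. g x = g' x"
    "f \<in> borel_measurable M" "f' \<in> borel_measurable M" "g \<in> borel_measurable M" "g' \<in> borel_measurable M"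
  shows "ip M f g = ip M f' g'"
  unfolding ip_def using assms by (intro integral_cong_AE) auto

theorem L2_Cauchy_Schwarz:
  assumes f: "sq_int M f" and g: "sq_int M g"
  shows "(ip M f g)\<^sup>2 \<le> ip M f f * ip M g g"
proof -
  define A B C where "A = ip M f f" and "B = ip M f g" and "C = ip M g g"
  \<comment> \<open>The usual minimising combination f - (B/C) g is multiplied by C to avoid the
    division; this costs a factor C in the result, and C = 0 is treated apart, where g vanishes
    almost everywhere.\<close>
  have "0 \<le> ip M (\<lambda>x. C * f x - B * g x) (\<lambda>x. C * f x - B * g x)"
    by (rule ip_self_nonneg)
  also have "\<dots> = C * C * A - 2 * C * B * B + B * B * C"
    using f g by (simp add: ip_diff_left ip_diff_right sq_int_cmult sq_int_diff ip_cmult_left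
        ip_cmult_right ip_commute[of M g f] flip: A_def B_def C_def) (simp add: algebra_simps)
  finally have *: "0 \<le> C * (A * C - B\<^sup>2)"
    by (simp add: algebra_simps power2_eq_square)
  have "C \<ge> 0" unfolding C_def by (rule ip_self_nonneg)
  show ?thesis
  proof (cases "C = 0")
    case True
    then have "AE x in M. (g x)\<^sup>2 = 0"
      using integral_nonneg_eq_0_iff_AE[of M "\<lambda>x. (g x)\<^sup>2"] g by (auto simp: C_def ip_self sq_int_def)
    then have "B = (LINT x|M. 0)"
      unfolding B_def ip_def using f g by (intro integral_cong_AE) (auto simp: sq_int_def)
    then show ?thesis using True by (simp add: B_def C_def)
  next
    case False
    with \<open>C \<ge> 0\<close> * show ?thesis
      by (simp add: A_def B_def C_def zero_le_mult_iff)
  qed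
qed

lemma L2_Cauchy_Schwarz_sqrt:
  "sq_int M f \<Longrightarrow> sq_int M g \<Longrightarrow> \<bar>ip M f g\<bar> \<le> sqrt (ip M f f) * sqrt (ip M g g)"
  using L2_Cauchy_Schwarz[of M f g] by (metis real_sqrt_abs real_sqrt_le_iff real_sqrt_mult)

text \<open>Square integrability is demanded explicitly, because the integral of a non-integrable
  function is 0 and the limit alone could hold for a meaningless reason. It is demanded only
  eventually, as curves need not be defined sensibly outside their time set.\<close>

definition L2_lim :: "'a measure \<Rightarrow> ('b \<Rightarrow> 'a \<Rightarrow> real) \<Rightarrow> ('a \<Rightarrow> real) \<Rightarrow> 'b filter \<Rightarrow> bool" where
  "L2_lim M V v F \<longleftrightarrow> sq_int M v \<and> (\<forall>\<^sub>F \<tau> in F. sq_int M (V \<tau>)) \<and>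
     ((\<lambda>\<tau>. LINT x|M. (V \<tau> x - v x)\<^sup>2) \<longlongrightarrow> 0) F"

lemma L2_limD: "L2_lim M V v F \<Longrightarrow> sq_int M v" "L2_lim M V v F \<Longrightarrow> \<forall>\<^sub>F \<tau> in F. sq_int M (V \<tau>)"
  by (auto simp: L2_lim_def)

lemma L2_lim_const: "sq_int M v \<Longrightarrow> L2_lim M (\<lambda>_. v) v F"
  by (simp add: L2_lim_def)

lemma L2_lim_squeeze:
  assumes "sq_int M v" "\<forall>\<^sub>F \<tau> in F. sq_int M (V \<tau>)"
    and "\<forall>\<^sub>F \<tau> in F. (LINT x|M. (V \<tau> x - v x)\<^sup>2) \<le> B \<tau>" "(B \<longlongrightarrow> 0) F"
  shows "L2_lim M V v F"
  unfolding L2_lim_def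
proof (intro conjI assms(1,2))
  show "((\<lambda>\<tau>. LINT x|M. (V \<tau> x - v x)\<^sup>2) \<longlongrightarrow> 0) F"
    by (rule tendsto_sandwich[OF _ assms(3) tendsto_const assms(4)]) auto
qed

lemma L2_lim_cmult:
  assumes "L2_lim M V v F" shows "L2_lim M (\<lambda>\<tau> x. c * V \<tau> x) (\<lambda>x. c * v x) F"
proof -
  have "(\<lambda>\<tau>. LINT x|M. (c * V \<tau> x - c * v x)\<^sup>2) = (\<lambda>\<tau>. c\<^sup>2 * (LINT x|M. (V \<tau> x - v x)\<^sup>2))"
    by (simp add: power_mult_distrib flip: right_diff_distrib)
  moreover have "((\<lambda>\<tau>. c\<^sup>2 * (LINT x|M. (V \<tau> x - v x)\<^sup>2)) \<longlongrightarrow> c\<^sup>2 * 0) F"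
    using assms by (intro tendsto_intros) (auto simp: L2_lim_def)
  ultimately show ?thesis
    using assms by (auto simp: L2_lim_def intro: sq_int_cmult elim!: eventually_mono)
qed

lemma L2_lim_add:
  assumes "L2_lim M V v F" "L2_lim M W w F"
  shows "L2_lim M (\<lambda>\<tau> x. V \<tau> x + W \<tau> x) (\<lambda>x. v x + w x) F"
proof (rule L2_lim_squeeze)
  let ?B = "\<lambda>\<tau>. 2 * (LINT x|M. (V \<tau> x - v x)\<^sup>2) + 2 * (LINT x|M. (W \<tau> x - w x)\<^sup>2)"
  have "(?B \<longlongrightarrow> 2 * 0 + 2 * 0) F"
    using assms by (intro tendsto_intros) (auto simp: L2_lim_def)
  then show "(?B \<longlongrightarrow> 0) F" by simp
  show "sq_int M (\<lambda>x. v x + w x)"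
    using assms by (auto simp: L2_lim_def intro: sq_int_add)
  have ev: "\<forall>\<^sub>F \<tau> in F. sq_int M (V \<tau>)" "\<forall>\<^sub>F \<tau> in F. sq_int M (W \<tau>)"
    using assms by (auto simp: L2_lim_def)
  show "\<forall>\<^sub>F \<tau> in F. sq_int M (\<lambda>x. V \<tau> x + W \<tau> x)"
    using ev by eventually_elim (rule sq_int_add)
  show "\<forall>\<^sub>F \<tau> in F. (LINT x|M. (V \<tau> x + W \<tau> x - (v x + w x))\<^sup>2) \<le> ?B \<tau>"
    using ev
  proof eventually_elim
    case (elim \<tau>)
    have 1: "sq_int M (\<lambda>x. V \<tau> x - v x)" "sq_int M (\<lambda>x. W \<tau> x - w x)"
      using assms elim by (auto simp: L2_lim_def intro: sq_int_diff)
    have "(LINT x|M. (V \<tau> x + W \<tau> x - (v x + w x))\<^sup>2) \<le>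
        (LINT x|M. 2 * (V \<tau> x - v x)\<^sup>2 + 2 * (W \<tau> x - w x)\<^sup>2)"
    proof (rule integral_mono)
      have "sq_int M (\<lambda>x. (V \<tau> x - v x) + (W \<tau> x - w x))" using 1 by (rule sq_int_add)
      then show "integrable M (\<lambda>x. (V \<tau> x + W \<tau> x - (v x + w x))\<^sup>2)"
        by (simp add: sq_int_def algebra_simps)
      show "integrable M (\<lambda>x. 2 * (V \<tau> x - v x)\<^sup>2 + 2 * (W \<tau> x - w x)\<^sup>2)"
        using 1 by (simp add: sq_int_def)
      show "(V \<tau> x + W \<tau> x - (v x + w x))\<^sup>2 \<le> 2 * (V \<tau> x - v x)\<^sup>2 + 2 * (W \<tau> x - w x)\<^sup>2" for x
        using sum_squares_bound[of "V \<tau> x - v x" "W \<tau> x - w x"]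
        by (simp add: power2_eq_square algebra_simps)
    qed
    also have "\<dots> = ?B \<tau>" using 1 by (simp add: sq_int_def)
    finally show ?case .
  qed
qed

lemma L2_lim_diff:
  "L2_lim M V v F \<Longrightarrow> L2_lim M W w F \<Longrightarrow> L2_lim M (\<lambda>\<tau> x. V \<tau> x - W \<tau> x) (\<lambda>x. v x - w x) F"
  using L2_lim_add[OF _ L2_lim_cmult[of M W w F "-1"], of V v] by simp

lemma L2_lim_sum:
  "(\<And>i. i \<in> A \<Longrightarrow> L2_lim M (V i) (v i) F) \<Longrightarrow>
    L2_lim M (\<lambda>\<tau> x. \<Sum>i\<in>A. V i \<tau> x) (\<lambda>x. \<Sum>i\<in>A. v i x) F"
  by (induction A rule: infinite_finite_induct) (auto intro: L2_lim_const sq_int_zero L2_lim_add)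

lemma L2_lim_cong_AE:
  assumes "L2_lim M V v F" "AE x in M. v' x = v x" "v' \<in> borel_measurable M"
    and "\<forall>\<^sub>F \<tau> in F. V' \<tau> \<in> borel_measurable M \<and> (AE x in M. V' \<tau> x = V \<tau> x)"
  shows "L2_lim M V' v' F"
proof (rule L2_lim_squeeze)
  have sq: "sq_int M g" if "sq_int M f" "AE x in M. g x = f x" "g \<in> borel_measurable M" for f g
  proof (rule sq_int_bounded_mult[OF that(1,3), of 1])
    show "AE x in M. \<bar>g x\<bar> \<le> 1 * \<bar>f x\<bar>" using that(2) by eventually_elim simp
  qed
  show "sq_int M v'"
    by (rule sq[OF L2_limD(1)[OF assms(1)] assms(2,3)])
  have ev: "\<forall>\<^sub>F \<tau> in F. sq_int M (V \<tau>)" using assms by (auto simp: L2_lim_def)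
  show "\<forall>\<^sub>F \<tau> in F. sq_int M (V' \<tau>)"
    using ev assms(4) by eventually_elim (auto intro: sq)
  show "((\<lambda>\<tau>. LINT x|M. (V \<tau> x - v x)\<^sup>2) \<longlongrightarrow> 0) F" using assms(1) by (auto simp: L2_lim_def)
  show "\<forall>\<^sub>F \<tau> in F. (LINT x|M. (V' \<tau> x - v' x)\<^sup>2) \<le> (LINT x|M. (V \<tau> x - v x)\<^sup>2)"
    using ev assms(4)
  proof eventually_elim
    case (elim \<tau>)
    have "sq_int M v" using assms(1) by (auto simp: L2_lim_def)
    have "(LINT x|M. (V' \<tau> x - v' x)\<^sup>2) = (LINT x|M. (V \<tau> x - v x)\<^sup>2)"
    proof (rule integral_cong_AE)
      have "AE x in M. V' \<tau> x = V \<tau> x" using elim by blast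
      then show "AE x in M. (V' \<tau> x - v' x)\<^sup>2 = (V \<tau> x - v x)\<^sup>2"
        using assms(2) by eventually_elim simp
    qed (use elim assms \<open>sq_int M v\<close> in \<open>auto simp: sq_int_def intro!: borel_measurable_power borel_measurable_diff\<close>)
    then show ?case by simp
  qed
qed

lemma L2_lim_ip:
  assumes "L2_lim M V v F" "L2_lim M W w F"
  shows "((\<lambda>\<tau>. ip M (V \<tau>) (W \<tau>)) \<longlongrightarrow> ip M v w) F"
proof -
  define a b where "a = (\<lambda>\<tau>. LINT x|M. (V \<tau> x - v x)\<^sup>2)" and "b = (\<lambda>\<tau>. LINT x|M. (W \<tau> x - w x)\<^sup>2)"
  have v: "sq_int M v" "sq_int M w" using assms by (auto simp: L2_lim_def)
  have ev: "\<forall>\<^sub>F \<tau> in F. sq_int M (V \<tau>)" "\<forall>\<^sub>F \<tau> in F. sq_int M (W \<tau>)"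
    using assms by (auto simp: L2_lim_def)
  let ?B = "\<lambda>\<tau>. sqrt (a \<tau>) * sqrt (b \<tau>) + sqrt (a \<tau>) * sqrt (ip M w w) + sqrt (ip M v v) * sqrt (b \<tau>)"
  have "(?B \<longlongrightarrow> sqrt 0 * sqrt 0 + sqrt 0 * sqrt (ip M w w) + sqrt (ip M v v) * sqrt 0) F"
    using assms unfolding a_def b_def by (intro tendsto_intros) (auto simp: L2_lim_def)
  then have B: "(?B \<longlongrightarrow> 0) F" by simp
  have "\<forall>\<^sub>F \<tau> in F. norm (ip M (V \<tau>) (W \<tau>) - ip M v w) \<le> ?B \<tau>"
    using ev
  proof eventually_elim
    case (elim \<tau>)
    let ?x = "\<lambda>x. V \<tau> x - v x" and ?y = "\<lambda>x. W \<tau> x - w x"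
    have xy: "sq_int M ?x" "sq_int M ?y" using v elim by (auto intro: sq_int_diff)
    have "ip M (V \<tau>) (W \<tau>) - ip M v w = ip M ?x ?y + ip M ?x w + ip M v ?y"
      using v elim xy by (simp add: ip_diff_left ip_diff_right)
    moreover have "\<bar>ip M ?x ?y\<bar> \<le> sqrt (a \<tau>) * sqrt (b \<tau>)"
      using L2_Cauchy_Schwarz_sqrt[OF xy] by (simp add: a_def b_def ip_self)
    moreover have "\<bar>ip M ?x w\<bar> \<le> sqrt (a \<tau>) * sqrt (ip M w w)"
      using L2_Cauchy_Schwarz_sqrt[OF xy(1) v(2)] by (simp add: a_def ip_self)
    moreover have "\<bar>ip M v ?y\<bar> \<le> sqrt (ip M v v) * sqrt (b \<tau>)"
      using L2_Cauchy_Schwarz_sqrt[OF v(1) xy(2)] by (simp add: b_def ip_self)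
    ultimately show ?case by (simp add: abs_le_iff)
  qed
  then show ?thesis
    by (intro LIM_zero_cancel[OF Lim_null_comparison[OF _ B]])
qed

lemma L2_lim_AE_subseq:
  assumes "L2_lim M V v sequentially"
  obtains r :: "nat \<Rightarrow> nat" where "strict_mono r" "AE x in M. (\<lambda>k. V (r k) x) \<longlonglongrightarrow> v x"
proof -
  \<comment> \<open>Square integrability holds only from some index on, hence the shift by
    \<open>m\<close>, which is added back to the subsequence at the end.\<close>
  obtain m where m: "\<And>k. k \<ge> m \<Longrightarrow> sq_int M (V k)"
    using assms unfolding L2_lim_def eventually_sequentially by blast
  let ?u = "\<lambda>k x. (V (k + m) x - v x)\<^sup>2"
  have sq: "sq_int M (\<lambda>x. V (k + m) x - v x)" for k
    using assms m by (intro sq_int_diff) (auto simp: L2_lim_def)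
  have "(\<lambda>k. LINT x|M. ?u k x) \<longlonglongrightarrow> 0"
    using LIMSEQ_ignore_initial_segment[of "\<lambda>k. LINT x|M. (V k x - v x)\<^sup>2" 0 m] assms
    by (simp add: L2_lim_def)
  then obtain r :: "nat \<Rightarrow> nat" where r: "strict_mono r" "AE x in M. (\<lambda>k. ?u (r k) x) \<longlonglongrightarrow> 0"
    using tendsto_L1_AE_subseq[of M ?u] sq by (auto simp: sq_int_def)
  show thesis
  proof
    show "strict_mono (\<lambda>k. r k + m)" using r(1) by (auto simp: strict_mono_def)
    show "AE x in M. (\<lambda>k. V (r k + m) x) \<longlonglongrightarrow> v x"
      using r(2)
    proof eventually_elim
      case (elim x)
      then have "(\<lambda>k. V (r k + m) x - v x) \<longlonglongrightarrow> 0"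
        using tendsto_real_sqrt[OF elim] by (simp add: tendsto_rabs_zero_iff)
      then show ?case by (simp add: LIM_zero_iff)
    qed
  qed
qed

lemma L2_lim_compose:
  assumes "L2_lim M V v F" "filterlim g F G" shows "L2_lim M (\<lambda>k. V (g k)) v G"
  using assms unfolding L2_lim_def
  by (auto intro: eventually_compose_filterlim filterlim_compose)

subsection \<open>Differentiable curves of square-integrable functions\<close>

abbreviation L2_cont :: "'a measure \<Rightarrow> (real \<Rightarrow> 'a \<Rightarrow> real) \<Rightarrow> real \<Rightarrow> real set \<Rightarrow> bool" where
  "L2_cont M V t J \<equiv> L2_lim M V (V t) (at t within J)"

definition L2_deriv :: "'a measure \<Rightarrow> (real \<Rightarrow> 'a \<Rightarrow> real) \<Rightarrow> ('a \<Rightarrow> real) \<Rightarrow> real \<Rightarrow> real set \<Rightarrow> bool" where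
  "L2_deriv M V W t J \<longleftrightarrow> sq_int M (V t) \<and> (\<forall>\<^sub>F \<tau> in at t within J. sq_int M (V \<tau>)) \<and>
     L2_lim M (\<lambda>\<tau> x. (V \<tau> x - V t x) / (\<tau> - t)) W (at t within J)"

text \<open>The squared norm of the increment is (\<tau> - t)^2 times that of the difference
  quotient, and the latter converges.\<close>

lemma L2_deriv_imp_cont:
  assumes "L2_deriv M V W t J" shows "L2_cont M V t J"
proof -
  let ?Q = "\<lambda>\<tau> x. (V \<tau> x - V t x) / (\<tau> - t)"
  have Q: "L2_lim M ?Q W (at t within J)" and vt: "sq_int M (V t)"
    and ev: "\<forall>\<^sub>F \<tau> in at t within J. sq_int M (V \<tau>)"
    using assms by (auto simp: L2_deriv_def)
  have "((\<lambda>\<tau>. (\<tau> - t)\<^sup>2 * ip M (?Q \<tau>) (?Q \<tau>)) \<longlongrightarrow> (t - t)\<^sup>2 * ip M W W) (at t within J)"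
    by (intro tendsto_intros L2_lim_ip Q)
  then have "((\<lambda>\<tau>. (\<tau> - t)\<^sup>2 * ip M (?Q \<tau>) (?Q \<tau>)) \<longlongrightarrow> 0) (at t within J)" by simp
  moreover have "\<forall>\<^sub>F \<tau> in at t within J. (\<tau> - t)\<^sup>2 * ip M (?Q \<tau>) (?Q \<tau>) = (LINT x|M. (V \<tau> x - V t x)\<^sup>2)"
    unfolding eventually_at_filter by (intro always_eventually) (simp add: ip_self power_divide)
  ultimately have "((\<lambda>\<tau>. LINT x|M. (V \<tau> x - V t x)\<^sup>2) \<longlongrightarrow> 0) (at t within J)"
    by (rule Lim_transform_eventually)
  then show ?thesis using vt ev by (auto simp: L2_lim_def)
qed

text \<open>The product rule asks of the first factor only that its pairing with the second factor at a fixed time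
  be differentiable: the time derivative of a weak solution exists only in this sense.\<close>

lemma ip_product_rule:
  assumes A: "L2_cont M A t J" and B: "L2_deriv M B B' t J"
    and d: "((\<lambda>\<tau>. ip M (A \<tau>) (B t)) has_real_derivative d) (at t within J)"
  shows "((\<lambda>\<tau>. ip M (A \<tau>) (B \<tau>)) has_real_derivative d + ip M (A t) B') (at t within J)"
proof -
  let ?Q = "\<lambda>\<tau> x. (B \<tau> x - B t x) / (\<tau> - t)"
  have Q: "L2_lim M ?Q B' (at t within J)" and Bt: "sq_int M (B t)"
    and evB: "\<forall>\<^sub>F \<tau> in at t within J. sq_int M (B \<tau>)"
    using B by (auto simp: L2_deriv_def)
  have evA: "\<forall>\<^sub>F \<tau> in at t within J. sq_int M (A \<tau>)" using A by (auto simp: L2_lim_def)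
  have lim: "((\<lambda>\<tau>. (ip M (A \<tau>) (B t) - ip M (A t) (B t)) / (\<tau> - t) + ip M (A \<tau>) (?Q \<tau>)) \<longlongrightarrow>
      d + ip M (A t) B') (at t within J)"
    using d unfolding has_field_derivative_iff by (intro tendsto_add L2_lim_ip A Q) auto
  have eq: "\<forall>\<^sub>F \<tau> in at t within J. (ip M (A \<tau>) (B t) - ip M (A t) (B t)) / (\<tau> - t) + ip M (A \<tau>) (?Q \<tau>) =
      (ip M (A \<tau>) (B \<tau>) - ip M (A t) (B t)) / (\<tau> - t)"
    using evA evB
  proof eventually_elim
    case (elim \<tau>)
    have "ip M (A \<tau>) (?Q \<tau>) = (ip M (A \<tau>) (B \<tau>) - ip M (A \<tau>) (B t)) / (\<tau> - t)"
      using elim Bt ip_cmult_right[of M "A \<tau>" "inverse (\<tau> - t)" "\<lambda>x. B \<tau> x - B t x"]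
      by (simp add: ip_diff_right divide_inverse mult.commute)
    then show ?case by (simp add: diff_divide_distrib)
  qed
  show ?thesis
    unfolding has_field_derivative_iff using Lim_transform_eventually[OF lim eq] .
qed

lemma L2_deriv_ip_const:
  assumes A: "L2_deriv M A A' t J" and c: "sq_int M c"
  shows "((\<lambda>\<tau>. ip M (A \<tau>) c) has_real_derivative ip M A' c) (at t within J)"
proof -
  have "((\<lambda>\<tau>. ip M c (A \<tau>)) has_real_derivative 0 + ip M c A') (at t within J)"
    by (rule ip_product_rule[OF L2_lim_const[OF c] A]) simp
  then show ?thesis by (simp add: ip_commute)
qed

lemma L2_deriv_ip:
  assumes "L2_deriv M A A' t J" "L2_deriv M B B' t J"
  shows "((\<lambda>\<tau>. ip M (A \<tau>) (B \<tau>)) has_real_derivative ip M A' (B t) + ip M (A t) B') (at t within J)"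
  using assms by (intro ip_product_rule L2_deriv_imp_cont L2_deriv_ip_const) (auto simp: L2_deriv_def)

lemma L2_deriv_diff:
  assumes "L2_deriv M A A' t J" "L2_deriv M B B' t J"
  shows "L2_deriv M (\<lambda>\<tau> x. A \<tau> x - B \<tau> x) (\<lambda>x. A' x - B' x) t J"
proof -
  have "L2_lim M (\<lambda>\<tau> x. (A \<tau> x - A t x) / (\<tau> - t) - (B \<tau> x - B t x) / (\<tau> - t)) (\<lambda>x. A' x - B' x) (at t within J)"
    using assms by (intro L2_lim_diff) (auto simp: L2_deriv_def)
  moreover have "(A \<tau> x - A t x) / (\<tau> - t) - (B \<tau> x - B t x) / (\<tau> - t) =
      ((A \<tau> x - B \<tau> x) - (A t x - B t x)) / (\<tau> - t)" for \<tau> x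
    by (simp add: diff_divide_distrib)
  ultimately show ?thesis
    using assms unfolding L2_deriv_def by (auto intro: sq_int_diff elim: eventually_elim2)
qed

lemma L2_deriv_sum:
  assumes "finite S" "\<And>i. i \<in> S \<Longrightarrow> L2_deriv M (A i) (A' i) t J"
  shows "L2_deriv M (\<lambda>\<tau> x. \<Sum>i\<in>S. A i \<tau> x) (\<lambda>x. \<Sum>i\<in>S. A' i x) t J"
proof -
  have "L2_lim M (\<lambda>\<tau> x. \<Sum>i\<in>S. (A i \<tau> x - A i t x) / (\<tau> - t)) (\<lambda>x. \<Sum>i\<in>S. A' i x) (at t within J)"
    using assms by (intro L2_lim_sum) (auto simp: L2_deriv_def)
  moreover have "\<forall>\<^sub>F \<tau> in at t within J. \<forall>i\<in>S. sq_int M (A i \<tau>)"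
    using assms by (intro eventually_ball_finite) (auto simp: L2_deriv_def)
  ultimately show ?thesis
    using assms(2) unfolding L2_deriv_def sum_subtractf[symmetric] sum_divide_distrib
    by (auto intro!: sq_int_sum elim: eventually_mono)
qed

subsection \<open>Weak derivatives\<close>

lemma open_lebesgue: "open U \<Longrightarrow> U \<in> sets lebesgue"
  by (simp add: borel_open)

lemma LINT_lebesgue_on:
  fixes f :: "'a::euclidean_space \<Rightarrow> real"
  shows "U \<in> sets lebesgue \<Longrightarrow> (LINT x:U|lebesgue. f x) = integral\<^sup>L (lebesgue_on U) f"
  by (simp add: set_lebesgue_integral_def integral_restrict_space)

lemma set_integrable_lebesgue_on:
  fixes f :: "'a::euclidean_space \<Rightarrow> real"
  shows "U \<in> sets lebesgue \<Longrightarrow> set_integrable lebesgue U f \<longleftrightarrow> integrable (lebesgue_on U) f"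
  by (simp add: set_integrable_def integrable_restrict_space)

lemma AE_lebesgue_on:
  "U \<in> sets lebesgue \<Longrightarrow> (AE x in lebesgue_on U. P x) \<longleftrightarrow> (AE x in lebesgue. x \<in> U \<longrightarrow> P x)"
  by (simp add: AE_restrict_space_iff)

lemma measurable_lebesgue_on:
  fixes f :: "'a::euclidean_space \<Rightarrow> real"
  shows "U \<in> sets lebesgue \<Longrightarrow>
    f \<in> borel_measurable (lebesgue_on U) \<longleftrightarrow> (\<lambda>x. indicator U x * f x) \<in> borel_measurable lebesgue"
  by (simp add: borel_measurable_restrict_space_iff)

lemma L2_iff_sq_int: "U \<in> sets lebesgue \<Longrightarrow> L2 U f \<longleftrightarrow> sq_int (lebesgue_on U) f"
  by (simp add: L2_def sq_int_def measurable_lebesgue_on set_integrable_lebesgue_on)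

text \<open>Completeness of Lebesgue measure. Weak derivatives chosen by \<open>SOME\<close> are
  determined almost everywhere only, and their measurability is inherited in this way from a known
  representative.\<close>

lemma measurable_lebesgue_on_AE:
  fixes f g :: "'a::euclidean_space \<Rightarrow> real"
  assumes "U \<in> sets lebesgue" "f \<in> borel_measurable (lebesgue_on U)" "AE x in lebesgue_on U. f x = g x"
  shows "g \<in> borel_measurable (lebesgue_on U)"
proof -
  have "(\<lambda>x. indicator U x * f x) \<in> borel_measurable lebesgue"
    using assms by (simp add: measurable_lebesgue_on)
  moreover have "AE x in lebesgue. indicator U x * f x = indicator U x * g x"
    using assms(3) unfolding AE_lebesgue_on[OF assms(1)] by eventually_elim (auto simp: indicator_def)
  ultimately have "(\<lambda>x. indicator U x * g x) \<in> borel_measurable lebesgue"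
    by (rule borel_measurable_AE)
  then show ?thesis using assms by (simp add: measurable_lebesgue_on)
qed

lemma sq_int_cong_AE:
  fixes f g :: "'a::euclidean_space \<Rightarrow> real"
  assumes "U \<in> sets lebesgue" "sq_int (lebesgue_on U) f" "AE x in lebesgue_on U. f x = g x"
  shows "sq_int (lebesgue_on U) g"
proof (rule sq_int_bounded_mult[OF assms(2), of _ 1])
  show "g \<in> borel_measurable (lebesgue_on U)"
    using assms by (blast intro: measurable_lebesgue_on_AE sq_int_measurable)
  show "AE x in lebesgue_on U. \<bar>g x\<bar> \<le> 1 * \<bar>f x\<bar>"
    using assms(3) by eventually_elim simp
qed

lemma integrable_on_subset:
  fixes f :: "'a::euclidean_space \<Rightarrow> real"
  assumes "integrable (lebesgue_on U) f" "U \<in> sets lebesgue" "K \<in> sets lebesgue" "K \<subseteq> U"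
  shows "integrable (lebesgue_on K) f"
  using assms set_integrable_subset[of lebesgue U f K] by (simp add: set_integrable_lebesgue_on)

lemma sq_int_loc_int:
  fixes f :: "'a::euclidean_space \<Rightarrow> real"
  assumes "U \<in> sets lebesgue" "sq_int (lebesgue_on U) f" shows "loc_int U f"
  unfolding loc_int_def
proof (intro allI impI, elim conjE)
  fix K assume K: "compact K" "K \<subseteq> U"
  have Ks: "K \<in> sets lebesgue" "K \<in> lmeasurable"
    using lmeasurable_compact[OF K(1)] by (auto dest: fmeasurableD)
  have "integrable (lebesgue_on K) f"
  proof (rule Bochner_Integration.integrable_bound)
    have "integrable (lebesgue_on K) (\<lambda>x. (f x)\<^sup>2)"
      using assms K Ks by (auto simp: sq_int_def intro: integrable_on_subset)
    moreover have "integrable (lebesgue_on K) (\<lambda>x. 1::real)"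
      using Ks by (subst integrable_restrict_space)
        (auto intro!: integrable_real_indicator simp: fmeasurable_def)
    ultimately show "integrable (lebesgue_on K) (\<lambda>x. (f x)\<^sup>2 + 1)" by auto
    show "f \<in> borel_measurable (lebesgue_on K)"
      by (rule measurable_restrict_mono[OF sq_int_measurable[OF assms(2)] K(2)])
    have "\<bar>a\<bar> \<le> a\<^sup>2 + 1" for a :: real
      using sum_squares_bound[of "\<bar>a\<bar>" 1] by simp
    then show "AE x in lebesgue_on K. norm (f x) \<le> norm ((f x)\<^sup>2 + 1)" by simp
  qed
  then show "set_integrable lebesgue K f" using Ks(1) by (simp add: set_integrable_lebesgue_on)
qed

lemma loc_int_test_integrable:
  fixes f :: "'a::euclidean_space \<Rightarrow> real"
  assumes "open U" "loc_int U f" "test_fun U \<phi>"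
  shows "integrable (lebesgue_on U) (\<lambda>x. f x * \<phi> x)"
proof -
  obtain K where K: "smooth \<phi>" "compact K" "K \<subseteq> U" "\<And>x bs. x \<notin> K \<Longrightarrow> pds bs \<phi> x = 0"
    using test_funE[OF assms(1,3)] by blast
  obtain C where C: "\<And>x. \<bar>\<phi> x\<bar> \<le> C" using test_fun_bounded[OF assms(1,3)] by blast
  have int: "integrable lebesgue (\<lambda>x. indicator K x *\<^sub>R f x)"
    using assms(2) K unfolding loc_int_def set_integrable_def by blast
  have "integrable lebesgue (\<lambda>x. (indicator K x *\<^sub>R f x) * \<phi> x)"
  proof (rule Bochner_Integration.integrable_bound)
    show "integrable lebesgue (\<lambda>x. C * (indicator K x *\<^sub>R f x))" using int by simp
    show "(\<lambda>x. (indicator K x *\<^sub>R f x) * \<phi> x) \<in> borel_measurable lebesgue"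
      using int by (intro borel_measurable_times smooth_measurable[OF K(1)]) auto
    have "C \<ge> 0" using C[of undefined] by linarith
    then show "AE x in lebesgue. norm ((indicator K x *\<^sub>R f x) * \<phi> x) \<le> norm (C * (indicator K x *\<^sub>R f x))"
      using C by (intro AE_I2) (auto simp: abs_mult indicator_def mult.commute intro!: mult_right_mono)
  qed
  moreover have "(\<lambda>x. (indicator K x *\<^sub>R f x) * \<phi> x) = (\<lambda>x. indicator U x *\<^sub>R (f x * \<phi> x))"
    using K(3) K(4)[of _ "[]"] by (auto simp: indicator_def fun_eq_iff)
  ultimately have "set_integrable lebesgue U (\<lambda>x. f x * \<phi> x)"
    by (simp only: set_integrable_def)
  then show ?thesis
    using assms(1) by (simp add: set_integrable_lebesgue_on open_lebesgue)
qed

lemma continuous_loc_int: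
  fixes f :: "'a::euclidean_space \<Rightarrow> real"
  assumes "continuous_on UNIV f" shows "loc_int U f"
  unfolding loc_int_def set_integrable_def
proof (intro allI impI, elim conjE)
  fix K assume "compact K" "K \<subseteq> U"
  then have "integrable lborel (\<lambda>x. indicator K x *\<^sub>R f x)"
    using continuous_on_subset[OF assms subset_UNIV] by (intro borel_integrable_compact) auto
  then show "integrable lebesgue (\<lambda>x. indicator K x *\<^sub>R f x)"
    by (subst integrable_completion) auto
qed

lemma test_fun_sq_int:
  fixes \<phi> :: "'a::euclidean_space \<Rightarrow> real"
  assumes "open U" "test_fun U \<phi>" shows "sq_int (lebesgue_on U) \<phi>"
proof -
  have sm: "smooth \<phi>" using test_fun_smooth[OF assms] .
  have "loc_int U \<phi>" using smooth_continuous[OF sm] by (rule continuous_loc_int)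
  from loc_int_test_integrable[OF assms(1) this assms(2)] show ?thesis
    using smooth_measurable[OF sm] by (simp add: sq_int_def power2_eq_square measurable_restrict_space1)
qed

lemma loc_int_diff: "loc_int U f \<Longrightarrow> loc_int U g \<Longrightarrow> loc_int U (\<lambda>x. f x - g x)"
  by (simp add: loc_int_def set_integral_diff)

lemma loc_int_cmult: "loc_int U f \<Longrightarrow> loc_int U (\<lambda>x. c * f x)"
  by (simp add: loc_int_def)

lemma weak_deriv_iff:
  assumes "open U"
  shows "weak_deriv U \<alpha> f g \<longleftrightarrow> loc_int U f \<and> loc_int U g \<and>
     (\<forall>\<phi>. test_fun U \<phi> \<longrightarrow> ip (lebesgue_on U) f (pds \<alpha> \<phi>) = (-1) ^ length \<alpha> * ip (lebesgue_on U) g \<phi>)"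
  by (simp add: weak_deriv_def ip_def LINT_lebesgue_on[OF open_lebesgue[OF assms]])

lemma weak_deriv_unique:
  assumes "open U" "weak_deriv U \<alpha> f g" "weak_deriv U \<alpha> f h"
  shows "AE x in lebesgue_on U. g x = h x"
proof -
  have gh: "loc_int U g" "loc_int U h" using assms by (auto simp: weak_deriv_def)
  have "AE x in lebesgue. x \<in> U \<longrightarrow> g x - h x = 0"
  proof (rule test_fun_determines[OF assms(1) loc_int_diff[OF gh]])
    fix \<phi> assume \<phi>: "test_fun U \<phi>"
    have "(-1) ^ length \<alpha> * ip (lebesgue_on U) g \<phi> = (-1) ^ length \<alpha> * ip (lebesgue_on U) h \<phi>"
      using assms \<phi> by (metis weak_deriv_iff)
    then have "ip (lebesgue_on U) g \<phi> = ip (lebesgue_on U) h \<phi>" by simp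
    then show "(LINT x:U|lebesgue. (g x - h x) * \<phi> x) = 0"
      using loc_int_test_integrable[OF assms(1) gh(1) \<phi>] loc_int_test_integrable[OF assms(1) gh(2) \<phi>]
      by (simp add: LINT_lebesgue_on open_lebesgue assms(1) ip_def left_diff_distrib)
  qed
  then show ?thesis by (simp add: AE_lebesgue_on open_lebesgue assms(1))
qed

lemma weak_deriv_wd: "weak_deriv U \<alpha> f g \<Longrightarrow> weak_deriv U \<alpha> f (wd U \<alpha> f)"
  unfolding wd_def by (rule someI[of "weak_deriv U \<alpha> f"])

lemma wd_AE_eq: "open U \<Longrightarrow> weak_deriv U \<alpha> f g \<Longrightarrow> AE x in lebesgue_on U. g x = wd U \<alpha> f x"
  using weak_deriv_unique weak_deriv_wd by blast

lemma weak_deriv_diff: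
  fixes U :: "'a::euclidean_space set"
  assumes U: "open U" and \<alpha>: "set \<alpha> \<subseteq> Basis" and f: "weak_deriv U \<alpha> f f'" and g: "weak_deriv U \<alpha> g g'"
  shows "weak_deriv U \<alpha> (\<lambda>x. f x - g x) (\<lambda>x. f' x - g' x)"
proof -
  have li: "loc_int U f" "loc_int U f'" "loc_int U g" "loc_int U g'"
    using f g by (auto simp: weak_deriv_def)
  have "ip (lebesgue_on U) (\<lambda>x. f x - g x) (pds \<alpha> \<phi>) = (-1) ^ length \<alpha> * ip (lebesgue_on U) (\<lambda>x. f' x - g' x) \<phi>"
    if \<phi>: "test_fun U \<phi>" for \<phi>
  proof -
    have d: "ip (lebesgue_on U) (\<lambda>x. a x - b x) \<psi> = ip (lebesgue_on U) a \<psi> - ip (lebesgue_on U) b \<psi>"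
      if "loc_int U a" "loc_int U b" "test_fun U \<psi>" for a b \<psi>
      using loc_int_test_integrable[OF U that(1,3)] loc_int_test_integrable[OF U that(2,3)]
      by (simp add: ip_def left_diff_distrib)
    have "ip (lebesgue_on U) f (pds \<alpha> \<phi>) = (-1) ^ length \<alpha> * ip (lebesgue_on U) f' \<phi>"
      "ip (lebesgue_on U) g (pds \<alpha> \<phi>) = (-1) ^ length \<alpha> * ip (lebesgue_on U) g' \<phi>"
      using f g \<phi> by (auto simp: weak_deriv_iff[OF U])
    then show ?thesis
      using li \<phi> test_fun_pds[OF U \<phi> \<alpha>] by (simp add: d right_diff_distrib)
  qed
  then show ?thesis using li by (simp add: weak_deriv_iff[OF U] loc_int_diff)
qed

lemma weak_deriv_cmult:
  assumes U: "open U" and f: "weak_deriv U \<alpha> f f'"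
  shows "weak_deriv U \<alpha> (\<lambda>x. c * f x) (\<lambda>x. c * f' x)"
  using f by (simp add: weak_deriv_iff[OF U] loc_int_cmult ip_cmult_left)

lemma weak_deriv_Nil: "loc_int U f \<Longrightarrow> weak_deriv U [] f f"
  by (simp add: weak_deriv_def)

lemma weak_deriv_cong_AE:
  assumes U: "open U" and eq: "AE x in lebesgue_on U. f x = g x" and f: "weak_deriv U \<alpha> f f'" and g: "loc_int U g"
    and \<alpha>: "set \<alpha> \<subseteq> Basis"
  shows "weak_deriv U \<alpha> g f'"
proof -
  have "ip (lebesgue_on U) f (pds \<alpha> \<phi>) = ip (lebesgue_on U) g (pds \<alpha> \<phi>)" if \<phi>: "test_fun U \<phi>" for \<phi>
    unfolding ip_def
  proof (rule integral_cong_AE)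
    show "AE x in lebesgue_on U. f x * pds \<alpha> \<phi> x = g x * pds \<alpha> \<phi> x"
      using eq by eventually_elim simp
    show "(\<lambda>x. f x * pds \<alpha> \<phi> x) \<in> borel_measurable (lebesgue_on U)"
      "(\<lambda>x. g x * pds \<alpha> \<phi> x) \<in> borel_measurable (lebesgue_on U)"
      using loc_int_test_integrable[OF U _ test_fun_pds[OF U \<phi> \<alpha>]] f g
      by (auto simp: weak_deriv_def)
  qed
  then show ?thesis using f g by (simp add: weak_deriv_iff[OF U])
qed

subsection \<open>Sobolev spaces\<close>

lemma multi_idxD: "\<alpha> \<in> multi_idx k \<Longrightarrow> set \<alpha> \<subseteq> Basis"
  by (simp add: multi_idx_def)

lemma finite_multi_idx: "finite (multi_idx k :: 'a::euclidean_space list set)"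
  unfolding multi_idx_def by (rule finite_lists_length_le) simp

lemma Hk_wd:
  assumes "open U" "Hk s U f" "\<alpha> \<in> multi_idx s"
  shows "weak_deriv U \<alpha> f (wd U \<alpha> f)" "sq_int (lebesgue_on U) (wd U \<alpha> f)"
proof -
  obtain g where g: "L2 U g" "weak_deriv U \<alpha> f g" using assms unfolding Hk_def by blast
  then show "weak_deriv U \<alpha> f (wd U \<alpha> f)" using weak_deriv_wd by blast
  show "sq_int (lebesgue_on U) (wd U \<alpha> f)"
    using g assms(1) wd_AE_eq[OF assms(1) g(2)]
    by (auto simp: L2_iff_sq_int open_lebesgue intro: sq_int_cong_AE)
qed

lemma Hk_sq_int: "open U \<Longrightarrow> Hk s U f \<Longrightarrow> sq_int (lebesgue_on U) f"
  by (simp add: Hk_def L2_iff_sq_int open_lebesgue)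

lemma wd_Nil:
  assumes "open U" "Hk s U f" shows "AE x in lebesgue_on U. f x = wd U [] f x"
  using assms Hk_sq_int sq_int_loc_int open_lebesgue by (blast intro: wd_AE_eq weak_deriv_Nil)

lemma wd_cong_AE:
  assumes U: "open U" and "Hk s U f" "Hk s U g" "AE x in lebesgue_on U. f x = g x" "\<alpha> \<in> multi_idx s"
  shows "AE x in lebesgue_on U. wd U \<alpha> f x = wd U \<alpha> g x"
  using assms
  by (intro wd_AE_eq weak_deriv_cong_AE[of U f g] Hk_wd sq_int_loc_int open_lebesgue Hk_sq_int multi_idxD) auto

lemma Hnorm_ge:
  assumes "\<alpha> \<in> multi_idx s"
  shows "(LINT x:U|lebesgue. (wd U \<alpha> f x)\<^sup>2) \<le> (Hnorm s U f)\<^sup>2"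
proof -
  have nn: "0 \<le> (LINT x:U|lebesgue. (wd U \<alpha> f x)\<^sup>2)" for \<alpha>
    unfolding set_lebesgue_integral_def by (rule integral_nonneg_AE) auto
  have "(LINT x:U|lebesgue. (wd U \<alpha> f x)\<^sup>2) \<le> (\<Sum>\<alpha>\<in>multi_idx s. LINT x:U|lebesgue. (wd U \<alpha> f x)\<^sup>2)"
    using assms by (intro member_le_sum nn finite_multi_idx)
  then show ?thesis
    unfolding Hnorm_def by (simp add: sum_nonneg nn)
qed

text \<open>The bridge from Sobolev norms to L2 limits. \<open>Hnorm\<close> measures the chosen
  representative \<open>wd U \<alpha> (G \<tau>)\<close> of a difference, which uniqueness of weak
  derivatives identifies almost everywhere with the difference of known derivatives.\<close>

lemma Hnorm_tendsto_imp_L2_lim: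
  assumes U: "open U" and \<alpha>: "\<alpha> \<in> multi_idx s"
    and lim: "((\<lambda>\<tau>. Hnorm s U (G \<tau>)) \<longlongrightarrow> 0) F"
    and v: "sq_int (lebesgue_on U) v"
    and ev: "\<forall>\<^sub>F \<tau> in F. sq_int (lebesgue_on U) (V \<tau>) \<and> weak_deriv U \<alpha> (G \<tau>) (\<lambda>x. V \<tau> x - v x)"
  shows "L2_lim (lebesgue_on U) V v F"
proof (rule L2_lim_squeeze[OF v])
  show "\<forall>\<^sub>F \<tau> in F. sq_int (lebesgue_on U) (V \<tau>)" using ev by eventually_elim simp
  have "((\<lambda>\<tau>. (Hnorm s U (G \<tau>))\<^sup>2) \<longlongrightarrow> 0\<^sup>2) F" by (intro tendsto_intros lim)
  then show "((\<lambda>\<tau>. (Hnorm s U (G \<tau>))\<^sup>2) \<longlongrightarrow> 0) F" by simp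
  show "\<forall>\<^sub>F \<tau> in F. (LINT x|lebesgue_on U. (V \<tau> x - v x)\<^sup>2) \<le> (Hnorm s U (G \<tau>))\<^sup>2"
    using ev
  proof eventually_elim
    case (elim \<tau>)
    then have sq: "sq_int (lebesgue_on U) (\<lambda>x. V \<tau> x - v x)" using v by (auto intro: sq_int_diff)
    have AE: "AE x in lebesgue_on U. V \<tau> x - v x = wd U \<alpha> (G \<tau>) x"
      using elim U by (auto intro: wd_AE_eq)
    have sq': "sq_int (lebesgue_on U) (wd U \<alpha> (G \<tau>))"
      using sq_int_cong_AE[OF open_lebesgue[OF U] sq AE] .
    have "(LINT x|lebesgue_on U. (V \<tau> x - v x)\<^sup>2) = (LINT x|lebesgue_on U. (wd U \<alpha> (G \<tau>) x)\<^sup>2)"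
      unfolding ip_self[symmetric]
      by (rule ip_cong_AE[OF AE AE]) (use sq sq' in \<open>auto dest: sq_int_measurable\<close>)
    also have "\<dots> \<le> (Hnorm s U (G \<tau>))\<^sup>2"
      using Hnorm_ge[OF \<alpha>, of U "G \<tau>"] by (simp add: LINT_lebesgue_on open_lebesgue U)
    finally show ?case .
  qed
qed

lemma cont_H_wd:
  assumes U: "open U" and V: "cont_H s U J V" and t: "t \<in> J" and \<alpha>: "\<alpha> \<in> multi_idx s"
  shows "L2_cont (lebesgue_on U) (\<lambda>\<tau>. wd U \<alpha> (V \<tau>)) t J"
proof (rule Hnorm_tendsto_imp_L2_lim[OF U \<alpha>])
  show "((\<lambda>\<tau>. Hnorm s U (\<lambda>x. V \<tau> x - V t x)) \<longlongrightarrow> 0) (at t within J)"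
    using V t by (auto simp: cont_H_def)
  have H: "Hk s U (V \<tau>)" if "\<tau> \<in> J" for \<tau> using V that by (auto simp: cont_H_def)
  show "sq_int (lebesgue_on U) (wd U \<alpha> (V t))" by (rule Hk_wd[OF U H[OF t] \<alpha>])
  show "\<forall>\<^sub>F \<tau> in at t within J. sq_int (lebesgue_on U) (wd U \<alpha> (V \<tau>)) \<and>
      weak_deriv U \<alpha> (\<lambda>x. V \<tau> x - V t x) (\<lambda>x. wd U \<alpha> (V \<tau>) x - wd U \<alpha> (V t) x)"
    unfolding eventually_at_filter
    by (intro always_eventually allI impI conjI weak_deriv_diff U multi_idxD[OF \<alpha>] Hk_wd[OF U _ \<alpha>] H t)
qed

lemma deriv_H_wd:
  assumes U: "open U" and V: "cont_H s U J V" and W: "cont_H s U J W" and d: "deriv_H s U J V W"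
    and t: "t \<in> J" and \<alpha>: "\<alpha> \<in> multi_idx s"
  shows "L2_deriv (lebesgue_on U) (\<lambda>\<tau>. wd U \<alpha> (V \<tau>)) (wd U \<alpha> (W t)) t J"
proof -
  have H: "Hk s U (V \<tau>)" "Hk s U (W \<tau>)" if "\<tau> \<in> J" for \<tau>
    using V W that by (auto simp: cont_H_def)
  have sq: "sq_int (lebesgue_on U) (wd U \<alpha> (V \<tau>))" if "\<tau> \<in> J" for \<tau>
    by (rule Hk_wd[OF U H(1)[OF that] \<alpha>])
  have "L2_lim (lebesgue_on U) (\<lambda>\<tau> x. (wd U \<alpha> (V \<tau>) x - wd U \<alpha> (V t) x) / (\<tau> - t)) (wd U \<alpha> (W t)) (at t within J)"
  proof (rule Hnorm_tendsto_imp_L2_lim[OF U \<alpha>])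
    show "((\<lambda>\<tau>. Hnorm s U (\<lambda>x. (V \<tau> x - V t x) / (\<tau> - t) - W t x)) \<longlongrightarrow> 0) (at t within J)"
      using d t by (auto simp: deriv_H_def)
    show "sq_int (lebesgue_on U) (wd U \<alpha> (W t))" by (rule Hk_wd[OF U H(2)[OF t] \<alpha>])
    have "sq_int (lebesgue_on U) (\<lambda>x. (wd U \<alpha> (V \<tau>) x - wd U \<alpha> (V t) x) / (\<tau> - t)) \<and>
       weak_deriv U \<alpha> (\<lambda>x. (V \<tau> x - V t x) / (\<tau> - t) - W t x)
        (\<lambda>x. (wd U \<alpha> (V \<tau>) x - wd U \<alpha> (V t) x) / (\<tau> - t) - wd U \<alpha> (W t) x)" if \<tau>: "\<tau> \<in> J" for \<tau>
    proof
      have "weak_deriv U \<alpha> (\<lambda>x. inverse (\<tau> - t) * (V \<tau> x - V t x) - W t x)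
          (\<lambda>x. inverse (\<tau> - t) * (wd U \<alpha> (V \<tau>) x - wd U \<alpha> (V t) x) - wd U \<alpha> (W t) x)"
        by (intro weak_deriv_diff weak_deriv_cmult U multi_idxD[OF \<alpha>] Hk_wd[OF U _ \<alpha>] H t \<tau>)
      then show "weak_deriv U \<alpha> (\<lambda>x. (V \<tau> x - V t x) / (\<tau> - t) - W t x)
        (\<lambda>x. (wd U \<alpha> (V \<tau>) x - wd U \<alpha> (V t) x) / (\<tau> - t) - wd U \<alpha> (W t) x)"
        by (simp add: divide_inverse mult.commute)
      have "sq_int (lebesgue_on U) (\<lambda>x. inverse (\<tau> - t) * (wd U \<alpha> (V \<tau>) x - wd U \<alpha> (V t) x))"
        by (intro sq_int_cmult sq_int_diff sq t \<tau>)
      then show "sq_int (lebesgue_on U) (\<lambda>x. (wd U \<alpha> (V \<tau>) x - wd U \<alpha> (V t) x) / (\<tau> - t))"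
        by (simp add: divide_inverse mult.commute)
    qed
    then show "\<forall>\<^sub>F \<tau> in at t within J. sq_int (lebesgue_on U) (\<lambda>x. (wd U \<alpha> (V \<tau>) x - wd U \<alpha> (V t) x) / (\<tau> - t)) \<and>
       weak_deriv U \<alpha> (\<lambda>x. (V \<tau> x - V t x) / (\<tau> - t) - W t x)
        (\<lambda>x. (wd U \<alpha> (V \<tau>) x - wd U \<alpha> (V t) x) / (\<tau> - t) - wd U \<alpha> (W t) x)"
      unfolding eventually_at_filter by (intro always_eventually) simp
  qed
  then show ?thesis
    unfolding L2_deriv_def eventually_at_filter using sq t by (auto intro: always_eventually)
qed

text \<open>Even the derivative of order zero, \<open>wd U [] f\<close>, is a chosen representative
  that equals f almost everywhere only; hence the detour through
  \<open>L2_lim_cong_AE\<close>.\<close>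

lemma cont_H_L2:
  assumes U: "open U" and V: "cont_H s U J V" and t: "t \<in> J"
  shows "L2_cont (lebesgue_on U) V t J"
proof (rule L2_lim_cong_AE[OF cont_H_wd[OF U V t, of "[]"]])
  have H: "Hk s U (V \<tau>)" if "\<tau> \<in> J" for \<tau> using V that by (auto simp: cont_H_def)
  show "[] \<in> multi_idx s" by (simp add: multi_idx_def)
  show "AE x in lebesgue_on U. V t x = wd U [] (V t) x" by (rule wd_Nil[OF U H[OF t]])
  show "V t \<in> borel_measurable (lebesgue_on U)" using Hk_sq_int[OF U H[OF t]] by (rule sq_int_measurable)
  show "\<forall>\<^sub>F \<tau> in at t within J. V \<tau> \<in> borel_measurable (lebesgue_on U) \<and> (AE x in lebesgue_on U. V \<tau> x = wd U [] (V \<tau>) x)"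
    unfolding eventually_at_filter
    by (intro always_eventually allI impI conjI wd_Nil[OF U H] sq_int_measurable[OF Hk_sq_int[OF U H]])
qed

lemma deriv_H_L2:
  assumes U: "open U" and V: "cont_H s U J V" and W: "cont_H s U J W" and d: "deriv_H s U J V W"
    and t: "t \<in> J"
  shows "L2_deriv (lebesgue_on U) V (W t) t J"
proof -
  have H: "Hk s U (V \<tau>)" "Hk s U (W \<tau>)" if "\<tau> \<in> J" for \<tau>
    using V W that by (auto simp: cont_H_def)
  have sq: "sq_int (lebesgue_on U) (V \<tau>)" if "\<tau> \<in> J" for \<tau>
    using Hk_sq_int[OF U H(1)[OF that]] .
  have "L2_deriv (lebesgue_on U) (\<lambda>\<tau>. wd U [] (V \<tau>)) (wd U [] (W t)) t J"
    by (rule deriv_H_wd[OF assms]) (simp add: multi_idx_def)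
  then have *: "L2_lim (lebesgue_on U) (\<lambda>\<tau> x. (wd U [] (V \<tau>) x - wd U [] (V t) x) / (\<tau> - t)) (wd U [] (W t)) (at t within J)"
    by (simp add: L2_deriv_def)
  have "L2_lim (lebesgue_on U) (\<lambda>\<tau> x. (V \<tau> x - V t x) / (\<tau> - t)) (W t) (at t within J)"
  proof (rule L2_lim_cong_AE[OF *])
    show "AE x in lebesgue_on U. W t x = wd U [] (W t) x" by (rule wd_Nil[OF U H(2)[OF t]])
    show "W t \<in> borel_measurable (lebesgue_on U)" using Hk_sq_int[OF U H(2)[OF t]] by (rule sq_int_measurable)
    have ev: "(\<lambda>x. (V \<tau> x - V t x) / (\<tau> - t)) \<in> borel_measurable (lebesgue_on U) \<and>
      (AE x in lebesgue_on U. (V \<tau> x - V t x) / (\<tau> - t) = (wd U [] (V \<tau>) x - wd U [] (V t) x) / (\<tau> - t))"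
      if \<tau>: "\<tau> \<in> J" for \<tau>
    proof
      show "(\<lambda>x. (V \<tau> x - V t x) / (\<tau> - t)) \<in> borel_measurable (lebesgue_on U)"
        using sq[OF \<tau>] sq[OF t] by (intro borel_measurable_divide borel_measurable_diff) (auto dest: sq_int_measurable)
      show "AE x in lebesgue_on U. (V \<tau> x - V t x) / (\<tau> - t) = (wd U [] (V \<tau>) x - wd U [] (V t) x) / (\<tau> - t)"
        using wd_Nil[OF U H(1)[OF \<tau>]] wd_Nil[OF U H(1)[OF t]] by eventually_elim simp
    qed
    then show "\<forall>\<^sub>F \<tau> in at t within J. (\<lambda>x. (V \<tau> x - V t x) / (\<tau> - t)) \<in> borel_measurable (lebesgue_on U) \<and>
      (AE x in lebesgue_on U. (V \<tau> x - V t x) / (\<tau> - t) = (wd U [] (V \<tau>) x - wd U [] (V t) x) / (\<tau> - t))"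
      unfolding eventually_at_filter by (intro always_eventually allI impI ev)
  qed
  then show ?thesis
    unfolding L2_deriv_def eventually_at_filter using sq t by (auto intro: always_eventually)
qed

lemma cont_H_mono:
  assumes U: "open U" and "cont_H s U J V" "r \<le> s" shows "cont_H r U J V"
proof -
  have sub: "multi_idx r \<subseteq> (multi_idx s :: 'a list set)" using assms(3) by (auto simp: multi_idx_def)
  have nn: "0 \<le> (LINT x:U|lebesgue. (wd U \<alpha> f x)\<^sup>2)" for \<alpha> f
    unfolding set_lebesgue_integral_def by (rule integral_nonneg_AE) auto
  have le: "Hnorm r U f \<le> Hnorm s U f" for f
    unfolding Hnorm_def by (intro real_sqrt_le_mono sum_mono2 finite_multi_idx sub nn)
  have nonneg: "0 \<le> Hnorm r U f" for f
    unfolding Hnorm_def by (intro real_sqrt_ge_zero sum_nonneg nn)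
  show ?thesis
    unfolding cont_H_def
  proof (intro ballI conjI)
    fix t assume t: "t \<in> J"
    show "Hk r U (V t)" using assms(2) t sub unfolding cont_H_def Hk_def by blast
    show "((\<lambda>\<tau>. Hnorm r U (\<lambda>x. V \<tau> x - V t x)) \<longlongrightarrow> 0) (at t within J)"
      by (rule tendsto_sandwich[of "\<lambda>_. 0" _ _ "\<lambda>\<tau>. Hnorm s U (\<lambda>x. V \<tau> x - V t x)"])
        (use assms(2) t le nonneg in \<open>auto simp: cont_H_def\<close>)
  qed
qed

subsection \<open>Integration by parts\<close>

text \<open>By translation invariance every difference quotient has integral 0, and dominated
  convergence passes this on to the derivative.\<close>

lemma integral_pd_eq_0:
  fixes g :: "'a::euclidean_space \<Rightarrow> real"
  assumes g: "test_fun UNIV g" and b: "b \<in> Basis"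
  shows "(LINT x|lebesgue. pd b g x) = 0"
proof -
  obtain K where K: "smooth g" "compact K" "\<And>x bs. x \<notin> K \<Longrightarrow> pds bs g x = 0"
    using test_funE[OF open_UNIV g] by metis
  obtain R where R: "\<And>x. x \<in> K \<Longrightarrow> norm x \<le> R" using compact_imp_bounded[OF K(2)] bounded_iff by metis
  obtain C where C: "\<And>x. \<bar>pd b g x\<bar> \<le> C"
    using test_fun_bounded[OF open_UNIV test_fun_pd[OF open_UNIV g b]] by blast
  have zero: "g x = 0" if "norm x > R" for x using K(3)[of x "[]"] R that by force
  have gm: "g \<in> borel_measurable borel" "pd b g \<in> borel_measurable borel"
    using K(1) b by (auto intro!: borel_measurable_continuous_onI smooth_continuous smooth_pd)
  define h where "h k = inverse (real (Suc k))" for k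
  have h: "0 < h k" "h k \<le> 1" for k by (auto simp: h_def divide_simps)
  let ?q = "\<lambda>k x. (g (x + h k *\<^sub>R b) - g x) / h k"
  have gint: "integrable lborel g"
  proof -
    have "set_integrable lborel K g"
      unfolding set_integrable_def using K(2) continuous_on_subset[OF smooth_continuous[OF K(1)]]
      by (intro borel_integrable_compact) auto
    moreover have "(\<lambda>x. indicator K x *\<^sub>R g x) = g"
      using K(3)[of _ "[]"] by (auto simp: indicator_def fun_eq_iff)
    ultimately show ?thesis by (simp only: set_integrable_def)
  qed
  have q0: "(LINT x|lborel. ?q k x) = 0" for k
  proof -
    have eq: "integrable lborel (\<lambda>x. g (x + h k *\<^sub>R b))" "(LINT x|lborel. g (x + h k *\<^sub>R b)) = (LINT x|lborel. g x)"
      using integrable_distr_eq[of "(+) (h k *\<^sub>R b)" lborel borel g] integral_distr[of "(+) (h k *\<^sub>R b)" lborel borel g]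
        gm gint lborel_distr_plus[of "h k *\<^sub>R b"] by (simp_all add: add.commute)
    then show ?thesis using gint by simp
  qed
  have "(\<lambda>k. LINT x|lborel. ?q k x) \<longlonglongrightarrow> (LINT x|lborel. pd b g x)"
  \<comment> \<open>The mean value theorem bounds the quotients by \<open>C\<close>; since the steps
    are at most 1, they vanish outside the ball of radius \<open>R + 1\<close>.\<close>
  proof (rule integral_dominated_convergence[where w = "\<lambda>x. C * indicator (cball 0 (R + 1)) x"])
    show "pd b g \<in> borel_measurable lborel" "\<And>k. ?q k \<in> borel_measurable lborel"
      using gm by simp_all
    show "integrable lborel (\<lambda>x::'a. C * indicator (cball 0 (R + 1)) x)"
      using emeasure_bounded_finite[OF bounded_cball[of "0::'a" "R + 1"]]
      by (intro integrable_mult_right integrable_real_indicator) auto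
    have hlim: "filterlim h (at 0) sequentially"
      unfolding h_def filterlim_at using LIMSEQ_inverse_real_of_nat by auto
    show "AE x in lborel. (\<lambda>k. ?q k x) \<longlonglongrightarrow> pd b g x"
    proof (rule AE_I2)
      fix x
      have "((\<lambda>h. (g (x + h *\<^sub>R b) - g x) / h) \<longlongrightarrow> pd b g x) (at 0)"
        using smooth_has_deriv[OF K(1) b, of x] by (simp add: DERIV_def)
      then show "(\<lambda>k. ?q k x) \<longlonglongrightarrow> pd b g x"
        using filterlim_compose[OF _ hlim] by blast
    qed
    show "AE x in lborel. norm (?q k x) \<le> C * indicator (cball 0 (R + 1)) x" for k
    proof (rule AE_I2)
      fix x
      show "norm (?q k x) \<le> C * indicator (cball 0 (R + 1)) x"
      proof (cases "norm x \<le> R + 1")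
        case True
        obtain z where "g (x + h k *\<^sub>R b) - g (x + 0 *\<^sub>R b) = (h k - 0) * pd b g (x + z *\<^sub>R b)"
          using MVT2[OF h(1)[of k] smooth_has_deriv_line[OF K(1) b]] by blast
        then have "?q k x = pd b g (x + z *\<^sub>R b)" using h(1)[of k] by simp
        then show ?thesis using True C by simp
      next
        case False
        have "norm (x + h k *\<^sub>R b) \<ge> norm x - norm (h k *\<^sub>R b)" by (metis norm_diff_ineq)
        then have "norm (x + h k *\<^sub>R b) > R"
          using False b h[of k] by simp
        then show ?thesis using False zero[of x] zero[of "x + h k *\<^sub>R b"] by simp
      qed
    qed
  qed
  then have "(LINT x|lborel. pd b g x) = 0" unfolding q0 LIMSEQ_const_iff by simp
  then show ?thesis using gm by (simp add: integral_completion)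
qed

lemma test_fun_mono: "U \<subseteq> V \<Longrightarrow> open U \<Longrightarrow> test_fun U \<phi> \<Longrightarrow> test_fun V \<phi>"
  by (meson order_trans smooth_on_set_def test_funI test_fun_def test_fun_smooth not_in_tsupport)

lemma test_fun_mult:
  assumes U: "open U" and \<phi>: "test_fun U \<phi>" and \<psi>: "test_fun U \<psi>"
  shows "test_fun U (\<lambda>x. \<phi> x * \<psi> x)"
proof -
  obtain K where K: "smooth \<phi>" "compact K" "K \<subseteq> U" "\<And>x bs. x \<notin> K \<Longrightarrow> pds bs \<phi> x = 0"
    using test_funE[OF U \<phi>] by blast
  show ?thesis
    using K(4)[of _ "[]"] by (intro test_funI[OF smooth_mult[OF K(1) test_fun_smooth[OF U \<psi>]] K(2,3)]) simp
qed

text \<open>The product of the two test functions is a test function on the whole space, so the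
  integral of its derivative is 0.\<close>

lemma test_fun_weak_deriv:
  fixes U :: "'a::euclidean_space set"
  assumes U: "open U" and \<phi>: "test_fun U \<phi>" and b: "b \<in> Basis"
  shows "weak_deriv U [b] \<phi> (pd b \<phi>)"
proof -
  have li: "loc_int U \<phi>" "loc_int U (pd b \<phi>)"
    using U \<phi> b by (auto intro!: sq_int_loc_int open_lebesgue test_fun_sq_int test_fun_pd)
  have "ip (lebesgue_on U) \<phi> (pd b \<psi>) = - ip (lebesgue_on U) (pd b \<phi>) \<psi>" if \<psi>: "test_fun U \<psi>" for \<psi>
  proof -
    have sm: "smooth \<phi>" "smooth \<psi>" using test_fun_smooth U \<phi> \<psi> by auto
    have "test_fun UNIV (\<lambda>x. \<phi> x * \<psi> x)"
      using test_fun_mono[OF _ U test_fun_mult[OF U \<phi> \<psi>]] by simp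
    from integral_pd_eq_0[OF this b] have "(LINT x|lebesgue. pd b \<phi> x * \<psi> x + \<phi> x * pd b \<psi> x) = 0"
      by (simp add: pd_mult smooth_differentiable sm b)
    moreover have "(LINT x|lebesgue. pd b \<phi> x * \<psi> x + \<phi> x * pd b \<psi> x) =
        (LINT x|lebesgue_on U. pd b \<phi> x * \<psi> x + \<phi> x * pd b \<psi> x)"
    proof -
      obtain K where K: "K \<subseteq> U" "\<And>x bs. x \<notin> K \<Longrightarrow> pds bs \<phi> x = 0"
        using test_funE[OF U \<phi>] by metis
      have "indicator U x *\<^sub>R (pd b \<phi> x * \<psi> x + \<phi> x * pd b \<psi> x) = pd b \<phi> x * \<psi> x + \<phi> x * pd b \<psi> x" for x
        using K(1) K(2)[of x "[]"] K(2)[of x "[b]"] by (cases "x \<in> K") (auto simp: indicator_def)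
      then show ?thesis
        unfolding LINT_lebesgue_on[OF open_lebesgue[OF U], symmetric] set_lebesgue_integral_def by presburger
    qed
    moreover have "integrable (lebesgue_on U) (\<lambda>x. pd b \<phi> x * \<psi> x)" "integrable (lebesgue_on U) (\<lambda>x. \<phi> x * pd b \<psi> x)"
      using U \<phi> \<psi> b li by (auto intro!: loc_int_test_integrable test_fun_pd)
    ultimately show ?thesis by (simp add: ip_def)
  qed
  then show ?thesis using li by (simp add: weak_deriv_iff[OF U])
qed

lemma H10_approx:
  fixes U :: "'a::euclidean_space set"
  assumes U: "open U" and f: "H10 U f"
  obtains \<phi>s where "\<And>k. test_fun U (\<phi>s k)" "L2_lim (lebesgue_on U) \<phi>s f sequentially"
    "\<And>b. b \<in> Basis \<Longrightarrow> L2_lim (lebesgue_on U) (\<lambda>k. pd b (\<phi>s k)) (wd U [b] f) sequentially"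
proof -
  obtain \<phi>s where \<phi>s: "\<And>k. test_fun U (\<phi>s k)" "(\<lambda>k. Hnorm 1 U (\<lambda>x. \<phi>s k x - f x)) \<longlonglongrightarrow> 0"
    and H: "Hk 1 U f"
    using f unfolding H10_def by blast
  show thesis
  proof
    show "test_fun U (\<phi>s k)" for k by fact
    show "L2_lim (lebesgue_on U) \<phi>s f sequentially"
    proof (rule Hnorm_tendsto_imp_L2_lim[OF U _ \<phi>s(2), of "[]"])
      show sq: "sq_int (lebesgue_on U) f" using H U by (rule Hk_sq_int[rotated])
      show "\<forall>\<^sub>F k in sequentially. sq_int (lebesgue_on U) (\<phi>s k) \<and>
          weak_deriv U [] (\<lambda>x. \<phi>s k x - f x) (\<lambda>x. \<phi>s k x - f x)"
        by (intro always_eventually allI conjI weak_deriv_Nil sq_int_loc_int[OF open_lebesgue[OF U]]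
            sq_int_diff sq test_fun_sq_int[OF U \<phi>s(1)])
    qed (simp add: multi_idx_def)
    fix b :: 'a assume b: "b \<in> Basis"
    show "L2_lim (lebesgue_on U) (\<lambda>k. pd b (\<phi>s k)) (wd U [b] f) sequentially"
    proof (rule Hnorm_tendsto_imp_L2_lim[OF U _ \<phi>s(2), of "[b]"])
      show "[b] \<in> multi_idx 1" using b by (simp add: multi_idx_def)
      then show "sq_int (lebesgue_on U) (wd U [b] f)" using Hk_wd[OF U H] by blast
      show "\<forall>\<^sub>F k in sequentially. sq_int (lebesgue_on U) (pd b (\<phi>s k)) \<and>
          weak_deriv U [b] (\<lambda>x. \<phi>s k x - f x) (\<lambda>x. pd b (\<phi>s k) x - wd U [b] f x)"
        using b by (intro always_eventually allI conjI test_fun_sq_int test_fun_pd U \<phi>s(1) weak_deriv_diff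
            test_fun_weak_deriv Hk_wd[OF U H]) (auto simp: multi_idx_def)
    qed
  qed
qed

text \<open>For a test function in place of u this is the definition of the weak derivatives of v;
  density carries it to u. The boundary term vanishes on account of u, while v is free at the
  boundary.\<close>

lemma Green_H10:
  fixes U :: "'a::euclidean_space set"
  assumes U: "open U" and u: "H10 U u" and v: "Hk 2 U v"
  shows "(\<Sum>b\<in>Basis. ip (lebesgue_on U) (wd U [b] u) (wd U [b] v)) = - ip (lebesgue_on U) u (lap U v)"
proof -
  let ?M = "lebesgue_on U"
  have v1: "weak_deriv U [b] v (wd U [b] v)" "sq_int ?M (wd U [b] v)"
    and v2: "weak_deriv U [b, b] v (wd U [b, b] v)" "sq_int ?M (wd U [b, b] v)" if "b \<in> Basis" for b
    using Hk_wd[OF U v] that by (auto simp: multi_idx_def)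
  obtain \<phi>s where \<phi>s: "\<And>k. test_fun U (\<phi>s k)" "L2_lim ?M \<phi>s u sequentially"
    "\<And>b. b \<in> Basis \<Longrightarrow> L2_lim ?M (\<lambda>k. pd b (\<phi>s k)) (wd U [b] u) sequentially"
    using H10_approx[OF U u] by blast
  have "ip ?M (wd U [b] u) (wd U [b] v) = - ip ?M u (wd U [b, b] v)" if b: "b \<in> Basis" for b
  proof (rule LIMSEQ_unique)
    show "(\<lambda>k. ip ?M (pd b (\<phi>s k)) (wd U [b] v)) \<longlonglongrightarrow> ip ?M (wd U [b] u) (wd U [b] v)"
      by (intro L2_lim_ip \<phi>s b L2_lim_const v1)
    have "ip ?M (pd b (\<phi>s k)) (wd U [b] v) = - ip ?M (\<phi>s k) (wd U [b, b] v)" for k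
    proof -
      \<comment> \<open>The pairing of v with the second derivative of \<phi> is read in two ways:
        as one derivative tested against \<open>pd b \<phi>\<close>, and as two derivatives tested
        against \<phi>.\<close>
      have "ip ?M v (pds [b] (pd b (\<phi>s k))) = - ip ?M (wd U [b] v) (pd b (\<phi>s k))"
        using v1(1)[OF b] test_fun_pd[OF U \<phi>s(1) b] by (simp add: weak_deriv_iff[OF U])
      moreover have "ip ?M v (pds [b, b] (\<phi>s k)) = ip ?M (wd U [b, b] v) (\<phi>s k)"
        using v2(1)[OF b] \<phi>s(1) by (simp add: weak_deriv_iff[OF U])
      ultimately show ?thesis by (simp add: ip_commute)
    qed
    moreover have "(\<lambda>k. - ip ?M (\<phi>s k) (wd U [b, b] v)) \<longlonglongrightarrow> - ip ?M u (wd U [b, b] v)"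
      by (intro tendsto_minus L2_lim_ip \<phi>s L2_lim_const v2 b)
    ultimately show "(\<lambda>k. ip ?M (pd b (\<phi>s k)) (wd U [b] v)) \<longlonglongrightarrow> - ip ?M u (wd U [b, b] v)" by simp
  qed
  then show ?thesis
    using v2 L2_limD(1)[OF \<phi>s(2)] unfolding lap_def by (simp add: ip_sum_right sum_negf)
qed

subsection \<open>Sobolev embedding into bounded functions\<close>

lemma smooth_step_deriv_bounded:
  obtains B where "B \<ge> 1" "\<And>s. \<bar>pd 1 smooth_step s\<bar> \<le> B"
proof -
  have z: "pd 1 smooth_step s = 0" if "s \<notin> {0..1}" for s
  proof (rule DERIV_unique[OF smooth_real_has_deriv[OF smooth_step(1)]])
    let ?c = "if s < 0 then 0 else 1 :: real"
    have "((\<lambda>_. ?c) has_real_derivative 0) (at s)" by simp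
    then show "(smooth_step has_real_derivative 0) (at s)"
      by (rule has_field_derivative_transform_within_open[where S = "if s < 0 then {..<0} else {1<..}"])
        (use that in \<open>auto simp: smooth_step split: if_splits\<close>)
  qed
  have "smooth (pd 1 smooth_step)" by (rule smooth_pd[OF smooth_step(1)]) simp
  then have "compact (pd 1 smooth_step ` {0..1})"
    by (intro compact_continuous_image continuous_on_subset[OF smooth_continuous]) auto
  then obtain C where C: "\<forall>y\<in>pd 1 smooth_step ` {0..1}. \<bar>y\<bar> \<le> C"
    using compact_imp_bounded bounded_real by blast
  show thesis
  proof
    show "max C 1 \<ge> 1" by simp
    show "\<bar>pd 1 smooth_step s\<bar> \<le> max C 1" for s
      using C z[of s] by (cases "s \<in> {0..1}") force+
  qed
qed

text \<open>A bump of small width is a derivative plus a spread-out bump of the same mass placed at a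
  prescribed position \<open>e\<close>.\<close>

lemma plateau_decomposition:
  assumes B: "B \<ge> 1" "\<And>s. \<bar>pd 1 smooth_step s\<bar> \<le> B" and ab: "a < b" and k: "k \<ge> 0"
  obtains \<Psi> \<rho> where "smooth \<Psi>" "smooth \<rho>" "\<And>s. plateau k a b s = pd 1 \<Psi> s + \<rho> s"
    "\<And>s. \<bar>\<Psi> s\<bar> \<le> B * (b - a)" "\<And>s. \<bar>\<rho> s\<bar> \<le> B * (b - a)"
    "\<And>s. s \<notin> {min a e..max b (e + 1)} \<Longrightarrow> \<Psi> s = 0 \<and> \<rho> s = 0"
proof -
  obtain F where F: "\<And>x. (F has_real_derivative plateau k a b x) (at x)"
    using continuous_antiderivative[OF smooth_continuous[OF smooth_plateau]] by blast
  define m where "m = F b - F a"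
  have mono: "F x \<le> F y" if "x \<le> y" for x y
    by (rule DERIV_nonneg_imp_nondecreasing[OF that]) (use F plateau_range in blast)
  have const: "F s = F t" if st: "s < t" "\<And>z. s < z \<Longrightarrow> z < t \<Longrightarrow> z \<notin> {a<..<b}" for s t
  proof -
    obtain z where "s < z" "z < t" "F t - F s = (t - s) * plateau k a b z"
      using MVT2[OF st(1) F] by blast
    then show ?thesis using plateau_outside[OF k st(2)] by simp
  qed
  have le: "F s = F a" if "s \<le> a" for s
    using that const[of s a] by (cases "s = a") auto
  have ge: "F s = F b" if "b \<le> s" for s
    using that const[of b s] by (cases "s = b") auto
  obtain z where "F b - F a = (b - a) * plateau k a b z"
    using MVT2[OF ab F] by blast
  then have m: "0 \<le> m" "m \<le> b - a"
    using plateau_range[of k a b z] ab by (auto simp: m_def mult_left_le)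
  have Fr: "0 \<le> F s - F a" "F s - F a \<le> m" for s
  proof -
    show "0 \<le> F s - F a" using mono[of a s] le[of s] by (cases "a \<le> s") auto
    show "F s - F a \<le> m" using mono[of s b] ge[of s] by (cases "s \<le> b") (auto simp: m_def)
  qed
  \<comment> \<open>The primitive of the plateau rises from 0 to its mass m and stays there.
    Subtracting a step of height m on [e, e+1] brings it back to 0, so \<Psi> has compact support,
    and \<rho> is the derivative of the subtracted step. As m is at most b - a, both are of that
    order.\<close>
  define \<Psi> where "\<Psi> = (\<lambda>s. F s - F a - m * smooth_step (1 * s + (-e)))"
  define \<rho> where "\<rho> = (\<lambda>s. m * pd 1 smooth_step (1 * s + (-e)))"
  have sm\<rho>: "smooth \<rho>"
    unfolding \<rho>_def by (rule smooth_cmult[OF smooth_affine[OF smooth_pd[OF smooth_step(1)]]]) simp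
  have der: "(\<Psi> has_real_derivative plateau k a b s - \<rho> s) (at s)" for s
    unfolding \<Psi>_def \<rho>_def
    by (auto intro!: derivative_eq_intros F DERIV_chain2[OF smooth_real_has_deriv[OF smooth_step(1)]])
  have "smooth \<Psi>" "pd 1 \<Psi> = (\<lambda>s. plateau k a b s - \<rho> s)"
    by (rule smooth_primitive[OF der smooth_diff[OF smooth_plateau sm\<rho>]])+
  moreover have "\<bar>\<Psi> s\<bar> \<le> B * (b - a)" for s
  proof -
    have "0 \<le> m * smooth_step (1 * s + (-e))" "m * smooth_step (1 * s + (-e)) \<le> m"
      using m smooth_step_range[of "1 * s + (-e)"] by (auto simp: mult_left_le)
    then have "\<bar>\<Psi> s\<bar> \<le> m" unfolding \<Psi>_def using Fr[of s] by linarith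
    also have "\<dots> \<le> 1 * (b - a)" using m by simp
    also have "\<dots> \<le> B * (b - a)" using B ab by (intro mult_right_mono) auto
    finally show ?thesis .
  qed
  moreover have "\<bar>\<rho> s\<bar> \<le> B * (b - a)" for s
  proof -
    have "\<bar>\<rho> s\<bar> = m * \<bar>pd 1 smooth_step (1 * s + (-e))\<bar>" using m by (simp add: \<rho>_def abs_mult)
    also have "\<dots> \<le> (b - a) * B" using m B by (intro mult_mono) auto
    finally show ?thesis by (simp add: mult.commute)
  qed
  moreover have "\<Psi> s = 0 \<and> \<rho> s = 0" if s: "s \<notin> {min a e..max b (e + 1)}" for s
  proof
    have out: "\<Psi> s = 0" if "s \<notin> {min a e..max b (e + 1)}" for s
      using that le[of s] ge[of s] by (auto simp: \<Psi>_def m_def smooth_step not_le min_def max_def split: if_splits)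
    then show "\<Psi> s = 0" using s by blast
    \<comment> \<open>Beyond the enclosing interval \<Psi> is locally zero, so its derivative, the
      plateau minus \<rho>, is zero as well; and there the plateau vanishes by itself.\<close>
    have "((\<lambda>_. 0) has_real_derivative 0) (at s)" by simp
    then have "(\<Psi> has_real_derivative 0) (at s)"
      by (rule has_field_derivative_transform_within_open[where S = "- {min a e..max b (e + 1)}"])
        (use s out in auto)
    then have "plateau k a b s - \<rho> s = 0" using DERIV_unique[OF der] by blast
    moreover have "plateau k a b s = 0" using s by (intro plateau_outside k) auto
    ultimately show "\<rho> s = 0" by simp
  qed
  ultimately show thesis using that[of \<Psi> \<rho>] sm\<rho> by simp
qed

lemma pd_coordinate_prod:
  fixes h :: "'a::euclidean_space \<Rightarrow> real \<Rightarrow> real"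
  assumes h: "\<And>i. i \<in> Basis \<Longrightarrow> smooth (h i)" and b: "b \<in> Basis"
  shows "pd b (\<lambda>x. \<Prod>i\<in>Basis. h i (x \<bullet> i)) x = (\<Prod>i\<in>Basis. (if i = b then pd 1 (h i) else h i) (x \<bullet> i))"
proof (rule pd_eqI)
  define c where "c = (\<Prod>i\<in>Basis - {b}. h i (x \<bullet> i))"
  have "(\<Prod>i\<in>Basis. h i ((x + s *\<^sub>R b) \<bullet> i)) = h b (x \<bullet> b + s) * c" for s
  proof -
    have "(\<Prod>i\<in>Basis. h i ((x + s *\<^sub>R b) \<bullet> i)) =
        h b ((x + s *\<^sub>R b) \<bullet> b) * (\<Prod>i\<in>Basis - {b}. h i ((x + s *\<^sub>R b) \<bullet> i))"
      using b by (intro prod.remove) auto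
    also have "(\<Prod>i\<in>Basis - {b}. h i ((x + s *\<^sub>R b) \<bullet> i)) = c"
      unfolding c_def using b by (intro prod.cong) (auto simp: inner_add_left inner_Basis)
    finally show ?thesis using b by (simp add: inner_add_left)
  qed
  moreover have "((\<lambda>s. h b (x \<bullet> b + s)) has_real_derivative pd 1 (h b) (x \<bullet> b)) (at 0)"
    using smooth_has_deriv[OF h[OF b], of 1 "x \<bullet> b"] by simp
  then have "((\<lambda>s. h b (x \<bullet> b + s) * c) has_real_derivative pd 1 (h b) (x \<bullet> b) * c) (at 0)"
    by (rule DERIV_cmult_right)
  moreover have "pd 1 (h b) (x \<bullet> b) * c = (\<Prod>i\<in>Basis. (if i = b then pd 1 (h i) else h i) (x \<bullet> i))"
    unfolding c_def using b by (subst prod.remove[of Basis b]) (auto intro!: prod.cong)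
  ultimately show "((\<lambda>s. \<Prod>i\<in>Basis. h i ((x + s *\<^sub>R b) \<bullet> i)) has_real_derivative
      (\<Prod>i\<in>Basis. (if i = b then pd 1 (h i) else h i) (x \<bullet> i))) (at 0)"
    by simp
qed

text \<open>Distinct directions mean that every factor is differentiated at most once. Mixed
  derivatives of this kind have order at most n, which is why the embedding asks for n
  derivatives.\<close>

lemma pds_coordinate_prod:
  fixes h :: "'a::euclidean_space \<Rightarrow> real \<Rightarrow> real"
  assumes h: "\<And>i. i \<in> Basis \<Longrightarrow> smooth (h i)" and "distinct bs" "set bs \<subseteq> Basis"
  shows "pds bs (\<lambda>x. \<Prod>i\<in>Basis. h i (x \<bullet> i)) =
    (\<lambda>x. \<Prod>i\<in>Basis. (if i \<in> set bs then pd 1 (h i) else h i) (x \<bullet> i))"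
  using assms(2,3)
proof (induction bs)
  case (Cons b bs)
  have sm: "smooth (if i \<in> set bs then pd 1 (h i) else h i)" if "i \<in> Basis" for i
    using h[OF that] smooth_pd[OF h[OF that], of 1] by simp
  show ?case
  proof
    fix x
    have "pds (b # bs) (\<lambda>x. \<Prod>i\<in>Basis. h i (x \<bullet> i)) x =
      (\<Prod>i\<in>Basis. (if i = b then pd 1 (if i \<in> set bs then pd 1 (h i) else h i)
         else (if i \<in> set bs then pd 1 (h i) else h i)) (x \<bullet> i))"
    using Cons pd_coordinate_prod[where h = "\<lambda>i. if i \<in> set bs then pd 1 (h i) else h i" and b = b and x = x, OF sm] by simp
    also have "\<dots> = (\<Prod>i\<in>Basis. (if i \<in> set (b # bs) then pd 1 (h i) else h i) (x \<bullet> i))"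
      using Cons.prems by (intro prod.cong) auto
    finally show "pds (b # bs) (\<lambda>x. \<Prod>i\<in>Basis. h i (x \<bullet> i)) x =
        (\<Prod>i\<in>Basis. (if i \<in> set (b # bs) then pd 1 (h i) else h i) (x \<bullet> i))" .
  qed
qed simp

text \<open>The spread-out bumps are moved away from the origin in each coordinate. The point
  \<open>c\<close> is the corner of the small cube nearest to the origin; it lies outside the unit
  ball, and no coordinate of y is smaller in modulus than that of \<open>c\<close>. Hypothesis
  \<open>neg\<close> prevents the cube from crossing a coordinate hyperplane from the negative
  side.\<close>

lemma exterior_box_avoids_ball:
  fixes x y :: "'a::euclidean_space"
  assumes ext: "cbox x (x + h *\<^sub>R One) \<subseteq> {z. 1 < norm z}" and h: "0 < h"
    and neg: "\<And>i. i \<in> Basis \<Longrightarrow> x \<bullet> i < 0 \<Longrightarrow> x \<bullet> i + h < 0"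
    and e: "\<And>i. i \<in> Basis \<Longrightarrow> e i = (if 0 \<le> x \<bullet> i then x \<bullet> i + h else x \<bullet> i - 1)"
    and y: "\<And>i. i \<in> Basis \<Longrightarrow> y \<bullet> i \<in> {min (x \<bullet> i) (e i)..max (x \<bullet> i + h) (e i + 1)}"
  shows "1 < norm y"
proof -
  define c where "c = (\<Sum>i\<in>Basis. (if 0 \<le> x \<bullet> i then x \<bullet> i else x \<bullet> i + h) *\<^sub>R i)"
  have ci: "c \<bullet> i = (if 0 \<le> x \<bullet> i then x \<bullet> i else x \<bullet> i + h)" if "i \<in> Basis" for i
    using that by (simp add: c_def)
  have "c \<in> cbox x (x + h *\<^sub>R One)"
    using h by (auto simp: mem_box ci inner_add_left)
  then have "1 < norm c" using ext by blast
  also have "norm c \<le> norm y"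
  proof (rule norm_le_componentwise)
    fix i :: 'a assume i: "i \<in> Basis"
    show "\<bar>c \<bullet> i\<bar> \<le> \<bar>y \<bullet> i\<bar>"
      using y[OF i] neg[OF i] h unfolding ci[OF i] e[OF i] by (auto split: if_splits)
  qed
  finally show ?thesis .
qed

text \<open>Each coordinate factor of the bump splits into a derivative and a spread-out part, so
  the product has 2^n terms, each a mixed derivative of a test function of height (B h)^n supported
  in a box of side at most 2. Moving the derivatives onto g and Cauchy-Schwarz give a bound
  proportional to h^n, the volume of the cube, uniformly in its position.\<close>

lemma exterior_bump_pairing_bound:
  fixes x :: "'a::euclidean_space" and U :: "'a set"
  defines "U \<equiv> {z. 1 < norm z}"
  assumes B: "B \<ge> 1" "\<And>s. \<bar>pd 1 smooth_step s\<bar> \<le> B" and k: "k \<ge> 0"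
    and ext: "cbox x (x + h *\<^sub>R One) \<subseteq> U" and h: "0 < h" "h \<le> 1"
    and neg: "\<And>i. i \<in> Basis \<Longrightarrow> x \<bullet> i < 0 \<Longrightarrow> x \<bullet> i + h < 0"
    and g: "Hk DIM('a) U g"
  shows "\<bar>ip (lebesgue_on U) g (box_plateau k x (x + h *\<^sub>R One))\<bar> \<le>
    2 ^ DIM('a) * (sqrt (2 ^ DIM('a)) * B ^ DIM('a) * Hnorm DIM('a) U g) * h ^ DIM('a)"
proof -
  have U: "open U" unfolding U_def by (intro open_Collect_less continuous_intros)
  define e where "e i = (if 0 \<le> x \<bullet> i then x \<bullet> i + h else x \<bullet> i - 1)" for i
  have "\<forall>i. \<exists>\<Psi> \<rho>. smooth \<Psi> \<and> smooth \<rho> \<and> (\<forall>s. plateau k (x \<bullet> i) (x \<bullet> i + h) s = pd 1 \<Psi> s + \<rho> s) \<and>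
    (\<forall>s. \<bar>\<Psi> s\<bar> \<le> B * h) \<and> (\<forall>s. \<bar>\<rho> s\<bar> \<le> B * h) \<and>
    (\<forall>s. s \<notin> {min (x \<bullet> i) (e i)..max (x \<bullet> i + h) (e i + 1)} \<longrightarrow> \<Psi> s = 0 \<and> \<rho> s = 0)"
  proof
    fix i
    show "\<exists>\<Psi> \<rho>. smooth \<Psi> \<and> smooth \<rho> \<and> (\<forall>s. plateau k (x \<bullet> i) (x \<bullet> i + h) s = pd 1 \<Psi> s + \<rho> s) \<and>
    (\<forall>s. \<bar>\<Psi> s\<bar> \<le> B * h) \<and> (\<forall>s. \<bar>\<rho> s\<bar> \<le> B * h) \<and>
    (\<forall>s. s \<notin> {min (x \<bullet> i) (e i)..max (x \<bullet> i + h) (e i + 1)} \<longrightarrow> \<Psi> s = 0 \<and> \<rho> s = 0)"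
      by (rule plateau_decomposition[OF B, of "x \<bullet> i" "x \<bullet> i + h" k "e i"]) (use h k in auto)
  qed
  then obtain \<Psi> \<rho> where P: "\<And>i. smooth (\<Psi> i)" "\<And>i. smooth (\<rho> i)"
    "\<And>i s. plateau k (x \<bullet> i) (x \<bullet> i + h) s = pd 1 (\<Psi> i) s + \<rho> i s"
    "\<And>i s. \<bar>\<Psi> i s\<bar> \<le> B * h" "\<And>i s. \<bar>\<rho> i s\<bar> \<le> B * h"
    "\<And>i s. s \<notin> {min (x \<bullet> i) (e i)..max (x \<bullet> i + h) (e i + 1)} \<Longrightarrow> \<Psi> i s = 0 \<and> \<rho> i s = 0"
    by metis
  \<comment> \<open>S collects the coordinates in which the derivative part is taken; there the
    undifferentiated \<Psi> is stored.\<close>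
  define \<Phi> where "\<Phi> S y = (\<Prod>i\<in>Basis. (if i \<in> S then \<Psi> i else \<rho> i) (y \<bullet> i))" for S y
  define l r where "l = (\<Sum>i\<in>Basis. min (x \<bullet> i) (e i) *\<^sub>R i)"
    and "r = (\<Sum>i\<in>Basis. max (x \<bullet> i + h) (e i + 1) *\<^sub>R i)"
  have lr: "l \<bullet> i = min (x \<bullet> i) (e i)" "r \<bullet> i = max (x \<bullet> i + h) (e i + 1)" if "i \<in> Basis" for i
    using that by (auto simp: l_def r_def)
  \<comment> \<open>Every side has length h + 1 in both sign cases, and h is at most 1.\<close>
  have side: "l \<bullet> i \<le> r \<bullet> i" "r \<bullet> i - l \<bullet> i \<le> 2" if "i \<in> Basis" for i
    using that h by (auto simp: lr e_def)
  have sub: "cbox l r \<subseteq> U"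
  proof
    fix y assume "y \<in> cbox l r"
    then have "1 < norm y"
      using ext h(1) neg by (intro exterior_box_avoids_ball[where x = x and h = h and e = e])
        (auto simp: U_def e_def mem_box lr)
    then show "y \<in> U" by (simp add: U_def)
  qed
  have out: "\<Phi> S y = 0" if "y \<notin> cbox l r" for S y
  proof -
    obtain i where i: "i \<in> Basis" "y \<bullet> i \<notin> {min (x \<bullet> i) (e i)..max (x \<bullet> i + h) (e i + 1)}"
      using \<open>y \<notin> cbox l r\<close> lr by (force simp: mem_box)
    then have "(if i \<in> S then \<Psi> i else \<rho> i) (y \<bullet> i) = 0" using P(6) by auto
    then show ?thesis unfolding \<Phi>_def using i(1) by (intro prod_zero bexI[of _ i]) auto
  qed
  have sm: "smooth (if i \<in> S then \<Psi> i else \<rho> i)" for i S using P by auto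
  have test: "test_fun U (\<Phi> S)" for S
  proof (rule test_funI[OF _ compact_cbox sub out])
    show "smooth (\<Phi> S)" unfolding \<Phi>_def[abs_def] by (rule smooth_coordinate_prod[OF sm])
  qed
  have bound: "\<bar>\<Phi> S y\<bar> \<le> (B * h) ^ DIM('a)" for S y
  proof -
    have "\<bar>\<Phi> S y\<bar> = (\<Prod>i\<in>Basis. \<bar>(if i \<in> S then \<Psi> i else \<rho> i) (y \<bullet> i)\<bar>)" by (simp add: \<Phi>_def abs_prod)
    also have "\<dots> \<le> (\<Prod>i\<in>(Basis :: 'a set). B * h)" using P by (intro prod_mono) auto
    finally show ?thesis by simp
  qed
  have Bh: "B * h \<ge> 0" using B h by simp
  have norm: "sqrt (ip (lebesgue_on U) (\<Phi> S) (\<Phi> S)) \<le> sqrt (2 ^ DIM('a)) * (B * h) ^ DIM('a)" for S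
  proof -
    have content: "measure lebesgue (cbox l r) \<le> 2 ^ DIM('a)"
    proof -
      have "measure lebesgue (cbox l r) = (\<Prod>i\<in>Basis. r \<bullet> i - l \<bullet> i)"
        using side by (simp add: content_cbox inner_diff_left)
      also have "\<dots> \<le> (\<Prod>i\<in>(Basis :: 'a set). 2)" using side by (intro prod_mono) auto
      finally show ?thesis by simp
    qed
    have Ufin: "integrable (lebesgue_on U) (\<lambda>y. ((B * h) ^ DIM('a))\<^sup>2 * indicator (cbox l r) y)"
      and Uint: "(LINT y|lebesgue_on U. ((B * h) ^ DIM('a))\<^sup>2 * indicator (cbox l r) y) =
        ((B * h) ^ DIM('a))\<^sup>2 * measure lebesgue (cbox l r)"
    proof -
      have eq: "indicator U y *\<^sub>R (c * indicator (cbox l r) y) = c * indicator (cbox l r) y" for y and c :: real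
        using sub by (auto simp: indicator_def)
      have "integrable lebesgue (\<lambda>y. ((B * h) ^ DIM('a))\<^sup>2 * indicator (cbox l r) y :: real)"
        by (intro integrable_mult_right integrable_real_indicator) (auto simp: emeasure_lborel_cbox_eq)
      then show "integrable (lebesgue_on U) (\<lambda>y. ((B * h) ^ DIM('a))\<^sup>2 * indicator (cbox l r) y)"
        by (subst integrable_restrict_space) (simp_all only: eq, simp_all add: open_lebesgue U)
      show "(LINT y|lebesgue_on U. ((B * h) ^ DIM('a))\<^sup>2 * indicator (cbox l r) y) =
        ((B * h) ^ DIM('a))\<^sup>2 * measure lebesgue (cbox l r)"
        by (subst integral_restrict_space) (simp_all only: eq, simp_all add: open_lebesgue U)
    qed
    have "ip (lebesgue_on U) (\<Phi> S) (\<Phi> S) \<le> (LINT y|lebesgue_on U. ((B * h) ^ DIM('a))\<^sup>2 * indicator (cbox l r) y)"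
      unfolding ip_self
    proof (rule integral_mono[OF _ Ufin])
      show "integrable (lebesgue_on U) (\<lambda>y. (\<Phi> S y)\<^sup>2)"
        using test_fun_sq_int[OF U test] by (simp add: sq_int_def)
      show "(\<Phi> S y)\<^sup>2 \<le> ((B * h) ^ DIM('a))\<^sup>2 * indicator (cbox l r) y" for y
        using out[of y S] bound[of S y] by (cases "y \<in> cbox l r") (auto simp: abs_le_square_iff[symmetric] Bh)
    qed
    also have "\<dots> \<le> ((B * h) ^ DIM('a))\<^sup>2 * 2 ^ DIM('a)"
      unfolding Uint using content by (intro mult_left_mono) auto
    finally have "sqrt (ip (lebesgue_on U) (\<Phi> S) (\<Phi> S)) \<le> sqrt (((B * h) ^ DIM('a))\<^sup>2 * 2 ^ DIM('a))"
      by (rule real_sqrt_le_mono)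
    also have "\<dots> = sqrt (2 ^ DIM('a)) * (B * h) ^ DIM('a)"
      using Bh by (simp add: real_sqrt_mult)
    finally show ?thesis .
  qed
  \<comment> \<open>Multi-indices are ordered lists, so each set of directions is listed once,
    without repetition; its length is then at most n.\<close>
  define bs where "bs S = (SOME xs. set xs = S \<and> distinct xs)" for S :: "'a set"
  have bs: "set (bs S) = S" "distinct (bs S)" if "S \<subseteq> Basis" for S
    using someI_ex[OF finite_distinct_list[OF finite_subset[OF that finite_Basis]]] by (auto simp: bs_def)
  have pair: "\<bar>ip (lebesgue_on U) g (pds (bs S) (\<Phi> S))\<bar> \<le> Hnorm DIM('a) U g * (sqrt (2 ^ DIM('a)) * (B * h) ^ DIM('a))"
    if S: "S \<subseteq> Basis" for S
  proof -
    have mi: "bs S \<in> multi_idx DIM('a)"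
      using S bs[OF S] card_mono[OF finite_Basis S] by (simp add: multi_idx_def distinct_card[symmetric])
    have "ip (lebesgue_on U) g (pds (bs S) (\<Phi> S)) = (-1) ^ length (bs S) * ip (lebesgue_on U) (wd U (bs S) g) (\<Phi> S)"
      using Hk_wd(1)[OF U g mi] test by (simp add: weak_deriv_iff[OF U])
    then have "\<bar>ip (lebesgue_on U) g (pds (bs S) (\<Phi> S))\<bar> = \<bar>ip (lebesgue_on U) (wd U (bs S) g) (\<Phi> S)\<bar>"
      by (simp add: abs_mult)
    also have "\<dots> \<le> sqrt (ip (lebesgue_on U) (wd U (bs S) g) (wd U (bs S) g)) * sqrt (ip (lebesgue_on U) (\<Phi> S) (\<Phi> S))"
      by (intro L2_Cauchy_Schwarz_sqrt Hk_wd[OF U g mi] test_fun_sq_int[OF U test])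
    also have "\<dots> \<le> Hnorm DIM('a) U g * (sqrt (2 ^ DIM('a)) * (B * h) ^ DIM('a))"
    proof (intro mult_mono norm)
      have "Hnorm DIM('a) U g \<ge> 0"
        unfolding Hnorm_def set_lebesgue_integral_def by (intro real_sqrt_ge_zero sum_nonneg integral_nonneg_AE) auto
      then show "sqrt (ip (lebesgue_on U) (wd U (bs S) g) (wd U (bs S) g)) \<le> Hnorm DIM('a) U g" "0 \<le> Hnorm DIM('a) U g"
        using Hnorm_ge[OF mi, of U g] by (simp_all add: real_le_lsqrt ip_self LINT_lebesgue_on open_lebesgue U)
    qed (simp add: ip_self_nonneg)
    finally show ?thesis .
  qed
  have expand: "box_plateau k x (x + h *\<^sub>R One) y = (\<Sum>S\<in>Pow Basis. pds (bs S) (\<Phi> S) y)" for y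
  proof -
    have "box_plateau k x (x + h *\<^sub>R One) y = (\<Prod>i\<in>Basis. pd 1 (\<Psi> i) (y \<bullet> i) + \<rho> i (y \<bullet> i))"
      unfolding box_plateau_def by (intro prod.cong) (auto simp: P(3)[symmetric] inner_add_left)
    also have "\<dots> = (\<Sum>S\<in>Pow Basis. (\<Prod>i\<in>S. pd 1 (\<Psi> i) (y \<bullet> i)) * (\<Prod>i\<in>Basis - S. \<rho> i (y \<bullet> i)))"
      by (rule prod_add) simp
    also have "\<dots> = (\<Sum>S\<in>Pow Basis. pds (bs S) (\<Phi> S) y)"
    proof (rule sum.cong[OF refl])
      fix S :: "'a set" assume "S \<in> Pow Basis"
      then have S: "S \<subseteq> Basis" by simp
      have "pds (bs S) (\<Phi> S) y = (\<Prod>i\<in>Basis. (if i \<in> S then pd 1 (if i \<in> S then \<Psi> i else \<rho> i) else (if i \<in> S then \<Psi> i else \<rho> i)) (y \<bullet> i))"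
        unfolding \<Phi>_def[abs_def] using pds_coordinate_prod[where h = "\<lambda>i. if i \<in> S then \<Psi> i else \<rho> i", OF sm bs(2)[OF S]] bs[OF S] S by simp
      also have "\<dots> = (\<Prod>i\<in>S \<union> (Basis - S). (if i \<in> S then pd 1 (\<Psi> i) (y \<bullet> i) else \<rho> i (y \<bullet> i)))"
        using S by (intro prod.cong) auto
      also have "\<dots> = (\<Prod>i\<in>S. pd 1 (\<Psi> i) (y \<bullet> i)) * (\<Prod>i\<in>Basis - S. \<rho> i (y \<bullet> i))"
        using finite_subset[OF S] by (subst prod.union_disjoint) auto
      finally show "(\<Prod>i\<in>S. pd 1 (\<Psi> i) (y \<bullet> i)) * (\<Prod>i\<in>Basis - S. \<rho> i (y \<bullet> i)) = pds (bs S) (\<Phi> S) y" by simp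
    qed
    finally show ?thesis .
  qed
  have "ip (lebesgue_on U) g (box_plateau k x (x + h *\<^sub>R One)) = ip (lebesgue_on U) g (\<lambda>y. \<Sum>S\<in>Pow Basis. pds (bs S) (\<Phi> S) y)"
    by (simp add: expand ip_def)
  also have "\<dots> = (\<Sum>S\<in>Pow Basis. ip (lebesgue_on U) g (pds (bs S) (\<Phi> S)))"
    by (intro ip_sum_right Hk_sq_int[OF U g] test_fun_sq_int[OF U] test_fun_pds[OF U test]) (auto simp: bs)
  finally have "\<bar>ip (lebesgue_on U) g (box_plateau k x (x + h *\<^sub>R One))\<bar> \<le>
      (\<Sum>S\<in>Pow Basis. \<bar>ip (lebesgue_on U) g (pds (bs S) (\<Phi> S))\<bar>)"
    by (simp add: sum_abs)
  also have "\<dots> \<le> (\<Sum>S\<in>Pow (Basis :: 'a set). Hnorm DIM('a) U g * (sqrt (2 ^ DIM('a)) * (B * h) ^ DIM('a)))"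
    by (intro sum_mono pair) auto
  also have "\<dots> = 2 ^ DIM('a) * (sqrt (2 ^ DIM('a)) * B ^ DIM('a) * Hnorm DIM('a) U g) * h ^ DIM('a)"
    by (simp add: card_Pow power_mult_distrib)
  finally show ?thesis .
qed

text \<open>The pairing bound, passed to the limit of steep plateaus, bounds the averages of g over
  small cubes by one constant times the norm; Lebesgue differentiation turns this into a pointwise
  bound.\<close>

theorem Sobolev_exterior_sup:
  fixes U :: "'a::euclidean_space set"
  defines "U \<equiv> {z. 1 < norm z}"
  obtains C where "C \<ge> 0" "\<And>g. Hk DIM('a) U g \<Longrightarrow> AE x in lebesgue_on U. \<bar>g x\<bar> \<le> C * Hnorm DIM('a) U g"
proof -
  obtain B where B: "B \<ge> 1" "\<And>s. \<bar>pd 1 smooth_step s\<bar> \<le> B" using smooth_step_deriv_bounded by blast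
  have U: "open U" unfolding U_def by (intro open_Collect_less continuous_intros)
  define C where "C = 2 ^ DIM('a) * (sqrt (2 ^ DIM('a)) * B ^ DIM('a))"
  have "C \<ge> 0" using B by (simp add: C_def)
  moreover have "AE x in lebesgue_on U. \<bar>g x\<bar> \<le> C * Hnorm DIM('a) U g" if g: "Hk DIM('a) U g" for g
    unfolding AE_lebesgue_on[OF open_lebesgue[OF U]]
  proof (rule AE_abs_le_of_averages[OF U])
    show li: "loc_int U g" using sq_int_loc_int[OF open_lebesgue[OF U] Hk_sq_int[OF U g]] .
    fix x assume x: "x \<in> U"
    obtain d0 where d0: "d0 > 0" "ball x d0 \<subseteq> U" using U x open_contains_ball by blast
    \<comment> \<open>Keeps the cube on the negative side in every coordinate where x is negative,
      and its side at most 1.\<close>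
    define d1 where "d1 = Min (insert 1 ((\<lambda>i. if x \<bullet> i < 0 then - (x \<bullet> i) else 1) ` Basis))"
    have d1: "d1 > 0" "d1 \<le> 1" "\<And>i. i \<in> Basis \<Longrightarrow> x \<bullet> i < 0 \<Longrightarrow> d1 \<le> - (x \<bullet> i)"
    proof -
      show "d1 > 0" "d1 \<le> 1" unfolding d1_def by auto
      fix i :: 'a assume "i \<in> Basis" "x \<bullet> i < 0"
      then show "d1 \<le> - (x \<bullet> i)" unfolding d1_def by (intro Min_le) (auto intro!: image_eqI[of _ _ i])
    qed
    \<comment> \<open>A cube of side h lies within distance n h of its corner, measured by the sum
      of the coordinates; hence the division by the dimension.\<close>
    define d where "d = min d1 (d0 / real DIM('a))"
    have "d > 0" using d0 d1 by (simp add: d_def)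
    moreover have "\<bar>LINT y:cbox x (x + h *\<^sub>R One)|lebesgue. g y\<bar> \<le> C * Hnorm DIM('a) U g * h ^ DIM('a)"
      if h: "0 < h" "h < d" for h
    proof -
      have ext: "cbox x (x + h *\<^sub>R One) \<subseteq> U"
      proof
        fix y assume "y \<in> cbox x (x + h *\<^sub>R One)"
        then have *: "\<bar>(y - x) \<bullet> i\<bar> \<le> h" if "i \<in> Basis" for i
          using that by (auto simp: mem_box inner_diff_left inner_add_left inner_sum_left_Basis)
        have "norm (y - x) \<le> (\<Sum>i\<in>Basis. \<bar>(y - x) \<bullet> i\<bar>)" by (rule norm_le_l1)
        also have "\<dots> \<le> (\<Sum>i\<in>(Basis::'a set). h)" by (intro sum_mono *)
        also have "\<dots> < d0" using h by (simp add: d_def field_simps)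
        finally show "y \<in> U" using d0(2) by (auto simp: dist_norm norm_minus_commute)
      qed
      have neg: "x \<bullet> i + h < 0" if "i \<in> Basis" "x \<bullet> i < 0" for i
        using d1(3)[OF that] h by (simp add: d_def)
      have h1: "h \<le> 1" using h d1(2) by (simp add: d_def)
      have "\<bar>LINT y:U|lebesgue. g y * box_plateau (real k) x (x + h *\<^sub>R One) y\<bar> \<le> C * Hnorm DIM('a) U g * h ^ DIM('a)" for k
        using exterior_bump_pairing_bound[OF B, of "real k" x h g] ext h(1) h1 neg g
        by (simp add: LINT_lebesgue_on open_lebesgue U ip_def C_def U_def[symmetric] mult.assoc)
      then show ?thesis
        by (intro LIMSEQ_le_const2[OF tendsto_rabs[OF integral_box_plateau_tendsto[OF li ext]]]) auto
    qed
    ultimately show "\<exists>d>0. \<forall>h. 0 < h \<and> h < d \<longrightarrow>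
        \<bar>LINT y:cbox x (x + h *\<^sub>R One)|lebesgue. g y\<bar> \<le> C * Hnorm DIM('a) U g * h ^ DIM('a)"
      by blast
  qed
  ultimately show thesis by (rule that)
qed

subsection \<open>The power nonlinearity\<close>

definition Fp :: "real \<Rightarrow> real \<Rightarrow> real" where
  "Fp p u = \<bar>u\<bar> powr (p + 1) / (p + 1)"

definition fp' :: "real \<Rightarrow> real \<Rightarrow> real" where
  "fp' p u = p * \<bar>u\<bar> powr (p - 1)"

section \<open>Derivatives of the power functions\<close>

lemma abs_powr_tendsto_0: "r > 0 \<Longrightarrow> ((\<lambda>h::real. \<bar>h\<bar> powr r) \<longlongrightarrow> 0) (at 0)"
  using tendsto_powr'[of "\<lambda>h::real. \<bar>h\<bar>" 0 "at 0" "\<lambda>_. r" r] by (simp add: tendsto_rabs_zero)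

lemma abs_powr_has_derivative_nonzero:
  assumes "s \<noteq> 0"
  shows "((\<lambda>s::real. \<bar>s\<bar> powr r) has_real_derivative r * \<bar>s\<bar> powr (r - 2) * s) (at s)"
proof (cases "s > 0")
  case True
  have "((\<lambda>s. s powr r) has_real_derivative r * \<bar>s\<bar> powr (r - 2) * s) (at s)"
    using True DERIV_powr[of "\<lambda>s. s" 1 s "\<lambda>_. r" 0]
    by (simp add: powr_diff power2_eq_square powr_numeral[of s, symmetric] powr_one field_simps)
  then show ?thesis
    by (rule has_field_derivative_transform_within_open[where S = "{0<..}"]) (use True in auto)
next
  case False
  with assms have s: "s < 0" by simp
  have "((\<lambda>s. (- s) powr r) has_real_derivative r * \<bar>s\<bar> powr (r - 2) * s) (at s)"
    using s DERIV_powr[of "\<lambda>s. - s" "-1" s "\<lambda>_. r" 0]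
    by (simp add: powr_diff power2_eq_square powr_numeral[of "-s", symmetric] powr_one field_simps DERIV_minus)
  then show ?thesis
    by (rule has_field_derivative_transform_within_open[where S = "{..<0}"]) (use s in auto)
qed

lemma abs_powr_has_derivative:
  assumes "r > 1"
  shows "((\<lambda>s::real. \<bar>s\<bar> powr r) has_real_derivative r * \<bar>s\<bar> powr (r - 2) * s) (at s)"
proof (cases "s = 0")
  case True
  \<comment> \<open>At 0 the difference quotient has modulus |h|^(r-1), which tends to 0 because r >
    1.\<close>
  have "((\<lambda>h::real. \<bar>\<bar>h\<bar> powr r / h\<bar>) \<longlongrightarrow> 0) (at 0)"
  proof (rule Lim_transform_eventually[OF abs_powr_tendsto_0[of "r - 1"]])
    show "\<forall>\<^sub>F h::real in at 0. \<bar>h\<bar> powr (r - 1) = \<bar>\<bar>h\<bar> powr r / h\<bar>"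
      by (auto simp: eventually_at_filter powr_diff)
  qed (use assms in simp)
  then have "((\<lambda>h::real. \<bar>h\<bar> powr r / h) \<longlongrightarrow> 0) (at 0)" by (rule tendsto_rabs_zero_cancel)
  then show ?thesis using True by (simp add: DERIV_def)
qed (rule abs_powr_has_derivative_nonzero)

lemma fp_has_derivative:
  assumes "p > 1" shows "(fp p has_real_derivative fp' p s) (at s)"
proof (cases "s = 0")
  case True
  have "((\<lambda>h. fp p h / h) \<longlongrightarrow> 0) (at 0)"
  proof (rule Lim_transform_eventually[OF abs_powr_tendsto_0[of "p - 1"]])
    show "\<forall>\<^sub>F h::real in at 0. \<bar>h\<bar> powr (p - 1) = fp p h / h"
      by (auto simp: eventually_at_filter fp_def)
  qed (use assms in simp)
  then show ?thesis using True by (simp add: DERIV_def fp_def fp'_def)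
next
  case False
  from DERIV_mult'[OF abs_powr_has_derivative_nonzero[OF this, of "p - 1"] DERIV_ident]
  have "(fp p has_real_derivative \<bar>s\<bar> powr (p - 1) * 1 + (p - 1) * \<bar>s\<bar> powr (p - 1 - 2) * s * s) (at s)"
    unfolding fp_def[abs_def] .
  moreover have "\<bar>s\<bar> powr (p - 1 - 2) * (s * s) = \<bar>s\<bar> powr (p - 1)"
  proof -
    have eq: "s * s = \<bar>s\<bar> powr 2" using False by (simp add: powr_numeral power2_eq_square)
    show ?thesis unfolding eq powr_add[symmetric] by simp
  qed
  ultimately show ?thesis by (simp add: fp'_def algebra_simps)
qed

lemma Fp_has_derivative:
  assumes "p > 1" shows "(Fp p has_real_derivative fp p s) (at s)"
proof -
  have "((\<lambda>s. \<bar>s\<bar> powr (p + 1) / (p + 1)) has_real_derivative ((p + 1) * \<bar>s\<bar> powr (p + 1 - 2) * s) / (p + 1)) (at s)"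
    by (intro DERIV_cdivide abs_powr_has_derivative) (use assms in simp)
  then show ?thesis using assms by (simp add: Fp_def[abs_def] fp_def)
qed

lemma fp'_has_derivative:
  assumes "p > 2" shows "(fp' p has_real_derivative p * ((p - 1) * \<bar>s\<bar> powr (p - 3) * s)) (at s)"
proof -
  have "((\<lambda>s. p * \<bar>s\<bar> powr (p - 1)) has_real_derivative p * ((p - 1) * \<bar>s\<bar> powr (p - 1 - 2) * s)) (at s)"
    by (intro DERIV_cmult abs_powr_has_derivative) (use assms in simp)
  then show ?thesis by (simp add: fp'_def[abs_def])
qed

text \<open>The mean value theorem writes the remainder as (g'(z) - g'(b)) (a - b) with z between a
  and b, so a Lipschitz bound on g' replaces a second derivative. It is applied both to F with
  derivative f and to f with derivative f'.\<close>

lemma Taylor1_bound: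
  fixes g g' :: "real \<Rightarrow> real"
  assumes der: "\<And>s. (g has_real_derivative g' s) (at s)"
    and lip: "\<And>z. \<bar>z\<bar> \<le> L \<Longrightarrow> \<bar>g' z - g' b\<bar> \<le> C * \<bar>z - b\<bar>"
    and ab: "\<bar>a\<bar> \<le> L" "\<bar>b\<bar> \<le> L" and C: "C \<ge> 0"
  shows "\<bar>g a - g b - g' b * (a - b)\<bar> \<le> C * (a - b)\<^sup>2"
proof -
  obtain z where z: "\<bar>z\<bar> \<le> L" "\<bar>z - b\<bar> \<le> \<bar>a - b\<bar>" "g a - g b = (a - b) * g' z"
  proof (cases a b rule: linorder_cases)
    case less
    obtain z where "a < z" "z < b" "g b - g a = (b - a) * g' z" using MVT2[OF less der] by blast
    then show thesis using ab by (intro that[of z]) (auto simp: algebra_simps)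
  next
    case equal
    then show thesis using ab by (intro that[of b]) auto
  next
    case greater
    obtain z where "b < z" "z < a" "g a - g b = (a - b) * g' z" using MVT2[OF greater der] by blast
    then show thesis using ab by (intro that[of z]) auto
  qed
  have "\<bar>g a - g b - g' b * (a - b)\<bar> = \<bar>g' z - g' b\<bar> * \<bar>a - b\<bar>"
    unfolding z(3) abs_mult[symmetric] by (simp add: algebra_simps)
  also have "\<dots> \<le> (C * \<bar>a - b\<bar>) * \<bar>a - b\<bar>"
    using lip[OF z(1)] z(2) C by (intro mult_right_mono) (auto intro: order_trans mult_left_mono)
  finally show ?thesis by (simp add: power2_eq_square mult.assoc flip: abs_mult)
qed

lemma Lipschitz_bound:
  fixes g g' :: "real \<Rightarrow> real"
  assumes der: "\<And>s. (g has_real_derivative g' s) (at s)"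
    and bd: "\<And>z. \<bar>z\<bar> \<le> L \<Longrightarrow> \<bar>g' z\<bar> \<le> C" and ab: "\<bar>a\<bar> \<le> L" "\<bar>b\<bar> \<le> L"
  shows "\<bar>g a - g b\<bar> \<le> C * \<bar>a - b\<bar>"
proof -
  have "norm (g a - g b) \<le> C * norm (a - b)"
    by (rule field_differentiable_bound[where S = "{-L..L}" and f' = g'])
      (use ab bd der in \<open>auto intro: has_field_derivative_at_within\<close>)
  then show ?thesis by simp
qed

lemma fp'_bound: "p > 1 \<Longrightarrow> \<bar>s\<bar> \<le> L \<Longrightarrow> \<bar>fp' p s\<bar> \<le> p * L powr (p - 1)"
  unfolding fp'_def by (auto simp: abs_mult intro!: mult_left_mono powr_mono2)

lemma fp_Lipschitz:
  assumes "p > 1" "\<bar>a\<bar> \<le> L" "\<bar>b\<bar> \<le> L"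
  shows "\<bar>fp p a - fp p b\<bar> \<le> p * L powr (p - 1) * \<bar>a - b\<bar>"
  by (rule Lipschitz_bound[OF fp_has_derivative fp'_bound]) (use assms in auto)

lemma fp'_Lipschitz:
  assumes "p > 2" "\<bar>a\<bar> \<le> L" "\<bar>b\<bar> \<le> L"
  shows "\<bar>fp' p a - fp' p b\<bar> \<le> p * (p - 1) * L powr (p - 2) * \<bar>a - b\<bar>"
proof (rule Lipschitz_bound[OF fp'_has_derivative])
  fix z :: real assume z: "\<bar>z\<bar> \<le> L"
  have "\<bar>z\<bar> powr (p - 3) * \<bar>z\<bar> = \<bar>z\<bar> powr (p - 2)"
    by (cases "z = 0") (auto simp: powr_diff powr_one power3_eq_cube power2_eq_square powr_numeral)
  then have "\<bar>p * ((p - 1) * \<bar>z\<bar> powr (p - 3) * z)\<bar> = p * (p - 1) * \<bar>z\<bar> powr (p - 2)"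
    using assms by (simp add: abs_mult mult.assoc)
  also have "\<dots> \<le> p * (p - 1) * L powr (p - 2)"
    using assms z by (intro mult_left_mono powr_mono2) auto
  finally show "\<bar>p * ((p - 1) * \<bar>z\<bar> powr (p - 3) * z)\<bar> \<le> p * (p - 1) * L powr (p - 2)" .
qed (use assms in auto)

lemma fp_mono: "p > 1 \<Longrightarrow> a \<le> b \<Longrightarrow> fp p a \<le> fp p b"
  by (rule DERIV_nonneg_imp_nondecreasing[of a b "fp p"]) (auto intro!: exI[of _ "fp' p _"] fp_has_derivative simp: fp'_def)

lemma abs_fp: "\<bar>fp p a\<bar> = \<bar>a\<bar> powr p"
  by (cases "a = 0") (auto simp: fp_def abs_mult powr_diff)

text \<open>The Bregman divergence of the convex function \<open>Fp p\<close>.\<close>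

definition Gp :: "real \<Rightarrow> real \<Rightarrow> real \<Rightarrow> real" where
  "Gp p a b = Fp p a - Fp p b - fp p b * (a - b)"

lemma Gp_nonneg:
  assumes "p > 1" shows "0 \<le> Gp p a b"
proof (cases a b rule: linorder_cases)
  case less
  obtain z where z: "a < z" "z < b" "Fp p b - Fp p a = (b - a) * fp p z"
    using MVT2[OF less Fp_has_derivative[OF assms]] by blast
  have "(b - a) * fp p z \<le> (b - a) * fp p b"
    using z fp_mono[OF assms, of z b] by (intro mult_left_mono) auto
  then show ?thesis using z by (simp add: Gp_def algebra_simps)
next
  case greater
  obtain z where z: "b < z" "z < a" "Fp p a - Fp p b = (a - b) * fp p z"
    using MVT2[OF greater Fp_has_derivative[OF assms]] by blast
  have "(a - b) * fp p b \<le> (a - b) * fp p z"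
    using z fp_mono[OF assms, of b z] by (intro mult_left_mono) auto
  then show ?thesis using z by (simp add: Gp_def algebra_simps)
qed (simp add: Gp_def)

lemma Gp_le_square:
  assumes "p > 1" "\<bar>a\<bar> \<le> L" "\<bar>b\<bar> \<le> L"
  shows "\<bar>Gp p a b\<bar> \<le> p * L powr (p - 1) * (a - b)\<^sup>2"
  unfolding Gp_def by (rule Taylor1_bound[OF Fp_has_derivative fp_Lipschitz]) (use assms in auto)

lemma fp_Taylor:
  assumes "p > 2" "\<bar>a\<bar> \<le> L" "\<bar>b\<bar> \<le> L"
  shows "\<bar>fp p a - fp p b - fp' p b * (a - b)\<bar> \<le> p * (p - 1) * L powr (p - 2) * (a - b)\<^sup>2"
  by (rule Taylor1_bound[OF fp_has_derivative fp'_Lipschitz]) (use assms in auto)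

text \<open>For large \<open>a\<close> the convexity defect \<open>Gp\<close> is of order \<open>|a| ^ (p + 1)\<close> and beats the remainder.\<close>

lemma fp_remainder_bound:
  assumes p: "p > 2"
  obtains A where "A \<ge> 0" "\<And>a b. \<bar>b\<bar> \<le> M \<Longrightarrow> \<bar>fp p a - fp p b - fp' p b * (a - b)\<bar> \<le> A * ((a - b)\<^sup>2 + Gp p a b)"
proof -
  \<comment> \<open>\<open>m\<close> is a bound for b that is at least 1. In the region x = |a| > L
    the terms F(b) and f(b)(a - b) together are at most 3 m^p x, and the factor 6 (p + 1) in
    \<open>L\<close> makes this at most half of F(a) = x^(p+1) / (p + 1).\<close>
  define m where "m = max M 1"
  define L where "L = m * (6 * (p + 1))"
  \<comment> \<open>The first entry is the Taylor constant for |a| at most L. For larger a the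
    remainder is at most (2 + 2p) |a|^p, and |a|^p is at most 2 (p + 1) times the divergence, which
    gives the second entry.\<close>
  define A where "A = max (p * (p - 1) * L powr (p - 2)) ((2 + 2 * p) * (2 * (p + 1)))"
  have m: "m \<ge> 1" "M \<le> m" by (auto simp: m_def)
  have mL: "m \<le> L" using m p mult_left_mono[of 1 "6 * (p + 1)" m] by (simp add: L_def)
  have bound: "\<bar>fp p a - fp p b - fp' p b * (a - b)\<bar> \<le> A * ((a - b)\<^sup>2 + Gp p a b)" if b: "\<bar>b\<bar> \<le> M" for a b
  proof (cases "\<bar>a\<bar> \<le> L")
    case True
    have "\<bar>fp p a - fp p b - fp' p b * (a - b)\<bar> \<le> p * (p - 1) * L powr (p - 2) * (a - b)\<^sup>2"
      using True b m mL by (intro fp_Taylor p) auto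
    also have "\<dots> \<le> A * (a - b)\<^sup>2" by (intro mult_right_mono) (auto simp: A_def)
    also have "\<dots> \<le> A * ((a - b)\<^sup>2 + Gp p a b)"
      using Gp_nonneg[of p a b] p by (intro mult_left_mono) (auto simp: A_def le_max_iff_disj)
    finally show ?thesis .
  next
    case False
    define x where "x = \<bar>a\<bar>"
    have x: "x > L" "x \<ge> m" "x \<ge> 1" "x > 0" using False m mL by (auto simp: x_def)
    have bm: "\<bar>b\<bar> \<le> m" using b m by simp
    have fb: "\<bar>fp p b\<bar> \<le> m powr p" unfolding abs_fp using bm p by (intro powr_mono2) auto
    have mp: "m powr p \<le> x powr p" using x m p by (intro powr_mono2) auto
    have ab: "\<bar>a - b\<bar> \<le> 2 * x" using bm x by (auto simp: x_def)
    have "\<bar>fp' p b * (a - b)\<bar> \<le> (p * x powr (p - 1)) * (2 * x)"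
      unfolding abs_mult using bm x p ab by (intro mult_mono fp'_bound) auto
    also have "\<dots> = 2 * p * x powr p" using x by (simp add: powr_diff)
    finally have f'b: "\<bar>fp' p b * (a - b)\<bar> \<le> 2 * p * x powr p" .
    have lhs: "\<bar>fp p a - fp p b - fp' p b * (a - b)\<bar> \<le> (2 + 2 * p) * x powr p"
      using fb mp f'b abs_fp[of p a] by (simp add: x_def[symmetric] algebra_simps)
    have mpx: "0 \<le> m powr p" by simp
    have "m powr p * (6 * (p + 1)) \<le> m powr p * (6 * (p + 1)) powr p"
      using powr_mono[of 1 p "6 * (p + 1)"] p by (intro mult_left_mono) auto
    also have "\<dots> = L powr p" using m p by (simp add: L_def powr_mult)
    also have "\<dots> \<le> x powr p" using x mL m p by (intro powr_mono2) auto
    finally have six: "m powr p * (6 * (p + 1)) \<le> x powr p" .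
    have e1: "Fp p a = x * x powr p / (p + 1)"
      using x by (simp add: Fp_def x_def powr_add)
    have e2: "Fp p b \<le> m powr p * x"
    proof -
      have "Fp p b \<le> \<bar>b\<bar> powr (p + 1)" unfolding Fp_def using p mult_left_mono[of 1 "p + 1" "\<bar>b\<bar> powr (p + 1)"] by (simp add: divide_le_eq)
      also have "\<dots> \<le> m powr (p + 1)" using bm p by (intro powr_mono2) auto
      also have "\<dots> = m powr p * m" using m by (simp add: powr_add)
      also have "\<dots> \<le> m powr p * x" using x by (intro mult_left_mono) auto
      finally show ?thesis .
    qed
    have e3: "\<bar>fp p b * (a - b)\<bar> \<le> m powr p * (2 * x)"
      unfolding abs_mult using fb ab by (intro mult_mono) auto
    have "m powr p * 3 * x \<le> x * x powr p / (2 * (p + 1))"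
      using mult_right_mono[OF six, of x] x p by (simp add: field_simps)
    moreover have "Fp p a = 2 * (x * x powr p / (2 * (p + 1)))"
      unfolding e1 using p by (simp add: divide_simps)
    ultimately have "x * x powr p / (2 * (p + 1)) \<le> Gp p a b"
      using e2 e3 unfolding Gp_def by linarith
    moreover have "x powr p / (2 * (p + 1)) \<le> x * x powr p / (2 * (p + 1))"
      using x p by (intro divide_right_mono) auto
    ultimately have "x powr p / (2 * (p + 1)) \<le> Gp p a b" by (rule order_trans[rotated])
    then have "x powr p \<le> 2 * (p + 1) * Gp p a b"
      using p by (simp add: divide_le_eq mult.commute)
    then have "(2 + 2 * p) * x powr p \<le> (2 + 2 * p) * (2 * (p + 1) * Gp p a b)"
      using p by (intro mult_left_mono) auto
    also have "\<dots> = (2 + 2 * p) * (2 * (p + 1)) * Gp p a b" by (simp only: mult.assoc)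
    also have "\<dots> \<le> A * Gp p a b"
      unfolding A_def using Gp_nonneg[of p a b] p by (intro mult_right_mono max.cobounded2) simp
    also have "\<dots> \<le> A * ((a - b)\<^sup>2 + Gp p a b)"
      using p by (intro mult_left_mono) (auto simp: A_def le_max_iff_disj)
    finally show ?thesis using lhs by linarith
  qed
  have "A \<ge> 0" using p by (simp add: A_def le_max_iff_disj)
  then show thesis using bound by (rule that)
qed

text \<open>Continuity of f(u) in time has to come from continuity of u in L2 and a mere bound in
  L^(p+1). Values up to L are treated by the Lipschitz constant, larger ones by the higher power,
  with a factor 1/L that can be made small first.\<close>

lemma fp_diff_split:
  assumes p: "p > 1" and L: "L > 0"
  shows "\<bar>fp p a - fp p b\<bar> \<le> p * L powr (p - 1) * \<bar>a - b\<bar> + 2 / L * (\<bar>a\<bar> powr (p + 1) + \<bar>b\<bar> powr (p + 1))"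
proof (cases "\<bar>a\<bar> \<le> L \<and> \<bar>b\<bar> \<le> L")
  case True
  then have "\<bar>fp p a - fp p b\<bar> \<le> p * L powr (p - 1) * \<bar>a - b\<bar>"
    using fp_Lipschitz[OF p] by blast
  moreover have "0 \<le> 2 / L * (\<bar>a\<bar> powr (p + 1) + \<bar>b\<bar> powr (p + 1))" using L by simp
  ultimately show ?thesis by linarith
next
  case False
  define x where "x = max \<bar>a\<bar> \<bar>b\<bar>"
  have x: "x > L" "\<bar>a\<bar> \<le> x" "\<bar>b\<bar> \<le> x" using False by (auto simp: x_def)
  have "\<bar>fp p a - fp p b\<bar> \<le> \<bar>a\<bar> powr p + \<bar>b\<bar> powr p"
    using abs_fp[of p a] abs_fp[of p b] by linarith
  also have "\<dots> \<le> x powr p + x powr p" using x p by (intro add_mono powr_mono2) auto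
  \<comment> \<open>As x > L, one additional power of x absorbs the factor 1/L.\<close>
  also have "\<dots> \<le> 2 / L * x powr (p + 1)"
    using x L mult_right_mono[of L x "x powr p"] by (simp add: powr_add field_simps)
  also have "\<dots> \<le> 2 / L * (\<bar>a\<bar> powr (p + 1) + \<bar>b\<bar> powr (p + 1))"
    using L by (intro mult_left_mono) (auto simp: x_def max_def)
  also have "\<dots> \<le> p * L powr (p - 1) * \<bar>a - b\<bar> + 2 / L * (\<bar>a\<bar> powr (p + 1) + \<bar>b\<bar> powr (p + 1))"
    using p by simp
  finally show ?thesis .
qed

text \<open>The exponent p lies between 2 and p + 1: small values are dominated by the square, large
  ones by the higher power. This makes f(u) integrable over the unbounded domain.\<close>

lemma abs_fp_le: "p > 2 \<Longrightarrow> \<bar>fp p a\<bar> \<le> a\<^sup>2 + \<bar>a\<bar> powr (p + 1)"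
proof -
  assume p: "p > 2"
  show ?thesis
  proof (cases "\<bar>a\<bar> \<le> 1")
    case True
    have "\<bar>a\<bar> powr p \<le> \<bar>a\<bar> powr 2" using True p by (intro powr_mono') auto
    also have "\<bar>a\<bar> powr 2 = a\<^sup>2" by (cases "a = 0") (auto simp: powr_numeral)
    finally show ?thesis using abs_fp[of p a] powr_ge_zero[of "\<bar>a\<bar>" "p + 1"] by linarith
  next
    case False
    then have "\<bar>a\<bar> powr p \<le> \<bar>a\<bar> powr (p + 1)" by (intro powr_mono) auto
    then show ?thesis using abs_fp[of p a] zero_le_power2[of a] by linarith
  qed
qed

lemma abs_fp_linear: "p > 1 \<Longrightarrow> \<bar>b\<bar> \<le> M \<Longrightarrow> \<bar>fp p b\<bar> \<le> M powr (p - 1) * \<bar>b\<bar>"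
  unfolding fp_def abs_mult by (intro mult_right_mono) (auto intro: powr_mono2)

lemma Fp_quadratic:
  assumes "p > 1" "\<bar>b\<bar> \<le> M" shows "\<bar>Fp p b\<bar> \<le> M powr (p - 1) * b\<^sup>2"
proof -
  have "\<bar>Fp p b\<bar> \<le> \<bar>b\<bar> powr (p + 1)"
    unfolding Fp_def using assms mult_left_mono[of 1 "p + 1" "\<bar>b\<bar> powr (p + 1)"] by (simp add: divide_le_eq)
  also have "\<dots> = \<bar>fp p b\<bar> * \<bar>b\<bar>" by (cases "b = 0") (auto simp: abs_fp powr_add)
  also have "\<dots> \<le> (M powr (p - 1) * \<bar>b\<bar>) * \<bar>b\<bar>" using abs_fp_linear[OF assms] by (intro mult_right_mono) auto
  finally show ?thesis by (simp add: power2_eq_square mult.assoc flip: abs_mult)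
qed

lemma fp_measurable: "u \<in> borel_measurable M \<Longrightarrow> (\<lambda>x. fp p (u x)) \<in> borel_measurable M"
  unfolding fp_def by measurable

lemma fp'_measurable: "u \<in> borel_measurable M \<Longrightarrow> (\<lambda>x. fp' p (u x)) \<in> borel_measurable M"
  unfolding fp'_def by measurable

lemma Fp_measurable: "u \<in> borel_measurable M \<Longrightarrow> (\<lambda>x. Fp p (u x)) \<in> borel_measurable M"
  unfolding Fp_def by (intro borel_measurable_divide powr_real_measurable borel_measurable_abs) auto

subsection \<open>From distributional to pointwise second derivatives\<close>

text \<open>The derivative of a rising step is a nonnegative density of mass 1 on
  \<open>{a..a + \<eta>}\<close>, so integrating against it is an average of \<gamma> just to the
  right of a.\<close>

lemma step_average:
  assumes \<eta>: "0 < \<eta>" and a: "0 < a" "a + \<eta> < T" and \<gamma>: "continuous_on {0..T} \<gamma>"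
    and osc: "\<And>s. a \<le> s \<Longrightarrow> s \<le> a + \<eta> \<Longrightarrow> \<bar>\<gamma> s - \<gamma> a\<bar> \<le> e"
  defines "A \<equiv> \<lambda>s. smooth_step (1 / \<eta> * s + (- a / \<eta>))"
  shows "\<bar>integral {0..T} (\<lambda>s. pd 1 A s * \<gamma> s) - \<gamma> a\<bar> \<le> e"
proof -
  have sm: "smooth A" unfolding A_def by (rule smooth_affine[OF smooth_step(1)])
  have der: "(A has_real_derivative pd 1 A s) (at s)" for s by (rule smooth_real_has_deriv[OF sm])
  have cont: "continuous_on {0..T} (pd 1 A)"
    by (rule continuous_on_subset[OF smooth_continuous[OF smooth_pd[OF sm]]]) auto
  have mono: "mono A"
  proof (rule monoI)
    fix x y :: real assume "x \<le> y"
    then have "1 / \<eta> * x + - a / \<eta> \<le> 1 / \<eta> * y + - a / \<eta>"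
      using \<eta> by (simp add: divide_right_mono)
    then show "A x \<le> A y" unfolding A_def by (rule monoD[OF smooth_step(2)])
  qed
  have nn: "pd 1 A s \<ge> 0" for s
    by (rule mono_on_imp_deriv_nonneg[of UNIV A]) (use mono der in \<open>auto simp: mono_def monotone_on_def\<close>)
  have A0: "A s = 0" if "s \<le> a" for s
    unfolding A_def using that \<eta> by (intro smooth_step(3)) (simp add: field_simps)
  have A1: "A s = 1" if "a + \<eta> \<le> s" for s
    unfolding A_def using that \<eta> by (intro smooth_step(4)) (simp add: field_simps)
  have out: "pd 1 A s = 0" if "s < a \<or> a + \<eta> < s" for s
  proof (rule DERIV_unique[OF der])
    let ?c = "if s < a then 0 else 1 :: real"
    have "((\<lambda>_. ?c) has_real_derivative 0) (at s)" by simp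
    then show "(A has_real_derivative 0) (at s)"
      by (rule has_field_derivative_transform_within_open[where S = "if s < a then {..<a} else {a + \<eta><..}"])
        (use that \<eta> A0 A1 in \<open>auto split: if_splits\<close>)
  qed
  have T: "0 \<le> T" using \<eta> a by linarith
  have "(pd 1 A has_integral (A T - A 0)) {0..T}"
    by (rule fundamental_theorem_of_calculus[OF T])
      (use der in \<open>auto simp: has_real_derivative_iff_has_vector_derivative[symmetric] intro: has_field_derivative_at_within\<close>)
  then have I: "(pd 1 A has_integral 1) {0..T}" using A0[of 0] A1[of T] a by simp
  have int: "(\<lambda>s. pd 1 A s * \<gamma> s) integrable_on {0..T}"
    by (intro integrable_continuous_real continuous_intros cont \<gamma>)
  have d: "((\<lambda>s. pd 1 A s * \<gamma> s - pd 1 A s * \<gamma> a) has_integral (integral {0..T} (\<lambda>s. pd 1 A s * \<gamma> s) - 1 * \<gamma> a)) {0..T}"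
    by (intro has_integral_diff integrable_integral int has_integral_mult_left I)
  have e: "((\<lambda>s. pd 1 A s * e) has_integral 1 * e) {0..T}"
    by (intro has_integral_mult_left I)
  have "norm (integral {0..T} (\<lambda>s. pd 1 A s * \<gamma> s - pd 1 A s * \<gamma> a)) \<le> integral {0..T} (\<lambda>s. pd 1 A s * e)"
  proof (rule integral_norm_bound_integral[OF has_integral_integrable[OF d] has_integral_integrable[OF e]])
    fix s
    show "norm (pd 1 A s * \<gamma> s - pd 1 A s * \<gamma> a) \<le> pd 1 A s * e"
    proof (cases "s < a \<or> a + \<eta> < s")
      case False
      then have "\<bar>\<gamma> s - \<gamma> a\<bar> \<le> e" by (intro osc) auto
      then show ?thesis using nn[of s] by (simp add: abs_mult mult_left_mono flip: right_diff_distrib)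
    qed (simp add: out)
  qed
  then have "norm (integral {0..T} (\<lambda>s. pd 1 A s * \<gamma> s) - 1 * \<gamma> a) \<le> 1 * e"
    unfolding integral_unique[OF d] integral_unique[OF e] .
  then show ?thesis by simp
qed

text \<open>The test function is the difference of two steps that rise right after a and right after
  b. Both equal 1 further right and cancel, so the support is compact, and the derivative is a
  difference of approximate point masses at a and b.\<close>

lemma du_Bois_Reymond:
  fixes \<gamma> :: "real \<Rightarrow> real"
  assumes \<gamma>: "continuous_on {0..T} \<gamma>"
    and weak: "\<And>\<theta>. test_fun {0<..<T} \<theta> \<Longrightarrow> integral {0..T} (\<lambda>t. pd 1 \<theta> t * \<gamma> t) = 0"
    and ab: "0 < a" "a < b" "b < T"
  shows "\<gamma> a = \<gamma> b"
proof -
  have "\<bar>\<gamma> a - \<gamma> b\<bar> \<le> 0 + e" if e: "e > 0" for e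
  proof -
    have "\<exists>\<eta>>0. c + \<eta> < T \<and> (\<forall>s. c \<le> s \<and> s \<le> c + \<eta> \<longrightarrow> \<bar>\<gamma> s - \<gamma> c\<bar> \<le> e / 2)" if c: "0 < c" "c < T" for c
    proof -
      have "c \<in> {0..T}" using c by simp
      then obtain d where d: "d > 0" "\<And>s. s \<in> {0..T} \<Longrightarrow> dist s c < d \<Longrightarrow> dist (\<gamma> s) (\<gamma> c) < e / 2"
        using \<gamma> e unfolding continuous_on_iff by (metis half_gt_zero)
      define \<eta> where "\<eta> = min d (T - c) / 2"
      have "0 < \<eta>" "\<eta> < d" "c + \<eta> < T" using d(1) c by (auto simp: \<eta>_def min_def field_simps)
      moreover have "\<bar>\<gamma> s - \<gamma> c\<bar> \<le> e / 2" if "c \<le> s" "s \<le> c + \<eta>" for s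
        using d(2)[of s] that calculation c by (auto simp: dist_real_def)
      ultimately show ?thesis by blast
    qed
    from this[of a] this[of b] ab obtain \<eta>1 \<eta>2 where
      \<eta>: "\<eta>1 > 0" "\<eta>2 > 0" "a + \<eta>1 < T" "b + \<eta>2 < T"
      "\<And>s. a \<le> s \<Longrightarrow> s \<le> a + \<eta>1 \<Longrightarrow> \<bar>\<gamma> s - \<gamma> a\<bar> \<le> e / 2" "\<And>s. b \<le> s \<Longrightarrow> s \<le> b + \<eta>2 \<Longrightarrow> \<bar>\<gamma> s - \<gamma> b\<bar> \<le> e / 2"
      by (auto 0 3)
    define A where "A = (\<lambda>s. smooth_step (1 / \<eta>1 * s + (- a / \<eta>1)))"
    define B where "B = (\<lambda>s. smooth_step (1 / \<eta>2 * s + (- b / \<eta>2)))"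
    have sm: "smooth A" "smooth B" unfolding A_def B_def by (rule smooth_affine[OF smooth_step(1)])+
    define r where "r = max (a + \<eta>1) (b + \<eta>2)"
    have "test_fun {0<..<T} (\<lambda>s. A s - B s)"
    proof (rule test_funI[OF smooth_diff[OF sm], of "{a..r}"])
      show "{a..r} \<subseteq> {0<..<T}" using ab \<eta> by (auto simp: r_def)
      fix s assume "s \<notin> {a..r}"
      then consider "s < a" | "s > a + \<eta>1" "s > b + \<eta>2" by (auto simp: r_def)
      then show "A s - B s = 0"
      proof cases
        case 1
        then have "A s = 0" "B s = 0"
          unfolding A_def B_def using \<eta> ab by (auto intro!: smooth_step(3) simp: field_simps)
        then show ?thesis by simp
      next
        case 2
        then have "A s = 1" "B s = 1"
          unfolding A_def B_def using \<eta> ab by (auto intro!: smooth_step(4) simp: field_simps)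
        then show ?thesis by simp
      qed
    qed simp
    from weak[OF this] have w: "integral {0..T} (\<lambda>t. pd 1 (\<lambda>s. A s - B s) t * \<gamma> t) = 0" .
    have "pd 1 (\<lambda>s. A s - B s) t = pd 1 A t - pd 1 B t" for t
      using DERIV_unique[OF smooth_real_has_deriv[OF smooth_diff[OF sm]] DERIV_diff[OF smooth_real_has_deriv[OF sm(1)] smooth_real_has_deriv[OF sm(2)]]] .
    then have "integral {0..T} (\<lambda>t. pd 1 A t * \<gamma> t) - integral {0..T} (\<lambda>t. pd 1 B t * \<gamma> t) = 0"
    proof -
      have "(\<lambda>t. pd 1 A t * \<gamma> t) integrable_on {0..T}" "(\<lambda>t. pd 1 B t * \<gamma> t) integrable_on {0..T}"
        by (auto intro!: integrable_continuous_real continuous_on_mult \<gamma>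
            continuous_on_subset[OF smooth_continuous[OF smooth_pd[OF sm(1)]]]
            continuous_on_subset[OF smooth_continuous[OF smooth_pd[OF sm(2)]]])
      from integral_diff[OF this] w show ?thesis
        using \<open>\<And>t. pd 1 (\<lambda>s. A s - B s) t = pd 1 A t - pd 1 B t\<close> by (simp add: left_diff_distrib)
    qed
    moreover have "\<bar>integral {0..T} (\<lambda>s. pd 1 A s * \<gamma> s) - \<gamma> a\<bar> \<le> e / 2"
      unfolding A_def by (rule step_average[OF \<eta>(1) ab(1) \<eta>(3) \<gamma> \<eta>(5)])
    moreover have "\<bar>integral {0..T} (\<lambda>s. pd 1 B s * \<gamma> s) - \<gamma> b\<bar> \<le> e / 2"
      unfolding B_def using ab by (intro step_average[OF \<eta>(2) _ \<eta>(4) \<gamma> \<eta>(6)]) auto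
    ultimately show ?thesis by linarith
  qed
  then have "\<bar>\<gamma> a - \<gamma> b\<bar> \<le> 0" by (rule field_le_epsilon)
  then show ?thesis by simp
qed

text \<open>The difference of \<alpha>' and a primitive of the continuous function \<beta> has
  vanishing distributional derivative, hence is constant; so \<alpha>' inherits the
  differentiability of the primitive.\<close>

lemma second_derivative_of_weak:
  assumes T: "T > 0" and der: "\<And>t. t \<in> {0..T} \<Longrightarrow> (\<alpha> has_real_derivative \<alpha>' t) (at t within {0..T})"
    and c\<alpha>': "continuous_on {0..T} \<alpha>'" and c\<beta>: "continuous_on {0..T} \<beta>"
    and weak: "\<And>\<theta>. test_fun {0<..<T} \<theta> \<Longrightarrow> integral {0..T} (\<lambda>t. pds [1, 1] \<theta> t * \<alpha> t - \<theta> t * \<beta> t) = 0"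
    and t: "t \<in> {0..T}"
  shows "(\<alpha>' has_real_derivative \<beta> t) (at t within {0..T})"
proof -
  define B where "B t = integral {0..t} \<beta>" for t
  have derB: "(B has_real_derivative \<beta> t) (at t within {0..T})" if "t \<in> {0..T}" for t
    unfolding B_def[abs_def] by (rule integral_has_real_derivative[OF c\<beta> that])
  have cB: "continuous_on {0..T} B" using derB by (rule DERIV_continuous_on)
  have c\<alpha>: "continuous_on {0..T} \<alpha>" using der by (rule DERIV_continuous_on)
  define \<gamma> where "\<gamma> t = \<alpha>' t - B t" for t
  have c\<gamma>: "continuous_on {0..T} \<gamma>" unfolding \<gamma>_def[abs_def] by (intro continuous_intros c\<alpha>' cB)
  have w: "integral {0..T} (\<lambda>t. pd 1 \<theta> t * \<gamma> t) = 0" if \<theta>: "test_fun {0<..<T} \<theta>" for \<theta>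
  proof -
    have U: "open {0<..<T}" by simp
    obtain K where K: "K \<subseteq> {0<..<T}" "\<And>x bs. x \<notin> K \<Longrightarrow> pds bs \<theta> x = 0"
      using test_funE[OF U \<theta>] by metis
    have "0 \<notin> K" "T \<notin> K" using K(1) by auto
    then have z: "\<theta> 0 = 0" "\<theta> T = 0" "pd 1 \<theta> 0 = 0" "pd 1 \<theta> T = 0"
      using K(2)[of 0 "[]"] K(2)[of 0 "[1]"] K(2)[of T "[]"] K(2)[of T "[1]"] by auto
    have sm: "smooth \<theta>" "smooth (pd 1 \<theta>)" "smooth (pd 1 (pd 1 \<theta>))"
      using test_fun_smooth[OF U \<theta>] smooth_pds[OF test_fun_smooth[OF U \<theta>], of "[1]"]
        smooth_pds[OF test_fun_smooth[OF U \<theta>], of "[1, 1]"] by simp_all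
    have c: "continuous_on {0..T} \<theta>" "continuous_on {0..T} (pd 1 (pd 1 \<theta>))"
      using sm smooth_continuous continuous_on_subset by blast+
    have d: "(\<theta> has_real_derivative pd 1 \<theta> s) (at s within {0..T})"
      "(pd 1 \<theta> has_real_derivative pd 1 (pd 1 \<theta>) s) (at s within {0..T})" for s
      using smooth_real_has_deriv[OF sm(1)] smooth_real_has_deriv[OF sm(2)]
      by (auto intro: has_field_derivative_at_within)
    have "((\<lambda>t. pd 1 \<theta> t * \<alpha>' t + pd 1 (pd 1 \<theta>) t * \<alpha> t) has_integral (pd 1 \<theta> T * \<alpha> T - pd 1 \<theta> 0 * \<alpha> 0)) {0..T}"
      using T DERIV_mult'[OF d(2) der]
      by (intro fundamental_theorem_of_calculus) (auto simp: has_real_derivative_iff_has_vector_derivative[symmetric])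
    then have 1: "((\<lambda>t. pd 1 \<theta> t * \<alpha>' t + pd 1 (pd 1 \<theta>) t * \<alpha> t) has_integral 0) {0..T}" using z by simp
    have "((\<lambda>t. \<theta> t * \<beta> t + pd 1 \<theta> t * B t) has_integral (\<theta> T * B T - \<theta> 0 * B 0)) {0..T}"
      using T DERIV_mult'[OF d(1) derB]
      by (intro fundamental_theorem_of_calculus) (auto simp: has_real_derivative_iff_has_vector_derivative[symmetric])
    then have 2: "((\<lambda>t. \<theta> t * \<beta> t + pd 1 \<theta> t * B t) has_integral 0) {0..T}" using z by simp
    have "(\<lambda>t. pds [1, 1] \<theta> t * \<alpha> t - \<theta> t * \<beta> t) integrable_on {0..T}"
      unfolding pds.simps by (intro integrable_continuous_real continuous_intros c c\<alpha> c\<beta>)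
    with weak[OF \<theta>] have 3: "((\<lambda>t. pd 1 (pd 1 \<theta>) t * \<alpha> t - \<theta> t * \<beta> t) has_integral 0) {0..T}"
      using integrable_integral by fastforce
    \<comment> \<open>Two integrations by parts and the weak equation are combined so that only
      \<theta>' (\<alpha>' - B) survives.\<close>
    have "((\<lambda>t. (pd 1 \<theta> t * \<alpha>' t + pd 1 (pd 1 \<theta>) t * \<alpha> t) - (\<theta> t * \<beta> t + pd 1 \<theta> t * B t) -
        (pd 1 (pd 1 \<theta>) t * \<alpha> t - \<theta> t * \<beta> t)) has_integral 0 - 0 - 0) {0..T}"
      by (intro has_integral_diff 1 2 3)
    then have "((\<lambda>t. pd 1 \<theta> t * \<gamma> t) has_integral 0) {0..T}"
      by (simp add: \<gamma>_def algebra_simps)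
    then show ?thesis by (rule integral_unique)
  qed
  define c where "c = \<gamma> (T / 2)"
  have "\<gamma> s = c" if s: "s \<in> {0<..<T}" for s
  proof (cases s "T / 2" rule: linorder_cases)
    case less
    then show ?thesis unfolding c_def using s T by (intro du_Bois_Reymond[OF c\<gamma> w]) auto
  next
    case greater
    then show ?thesis unfolding c_def using s T by (intro du_Bois_Reymond[OF c\<gamma> w, symmetric]) auto
  qed (simp only: c_def)
  \<comment> \<open>Continuity carries the constancy to the end points, where the derivative is then
    one-sided; the Gronwall argument has to start at 0.\<close>
  then have "\<gamma> s = c" if "s \<in> {0..T}" for s
  proof -
    have "continuous_on (closure {0<..<T}) \<gamma>" using c\<gamma> T by simp
    moreover have "s \<in> closure {0<..<T}" using that T by simp
    ultimately show ?thesis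
      using continuous_constant_on_closure[of "{0<..<T}" \<gamma> c s] \<open>\<And>s. s \<in> {0<..<T} \<Longrightarrow> \<gamma> s = c\<close> by blast
  qed
  then have eq: "\<alpha>' s = c + B s" if "s \<in> {0..T}" for s using that by (simp add: \<gamma>_def algebra_simps)
  have "((\<lambda>s. c + B s) has_real_derivative \<beta> t) (at t within {0..T})"
    using derB[OF t] by (auto intro!: derivative_eq_intros)
  then show ?thesis
    by (rule has_field_derivative_transform_within[of _ _ _ _ 1]) (use eq t in auto)
qed

lemma tensor_test_fun:
  fixes \<theta> :: "real \<Rightarrow> real" and \<xi> :: "'a::euclidean_space \<Rightarrow> real"
  assumes U: "open U" "open V" and \<theta>: "test_fun U \<theta>" and \<xi>: "test_fun V \<xi>"
  defines "\<phi> \<equiv> \<lambda>z :: real \<times> 'a. \<theta> (fst z) * \<xi> (snd z)"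
  shows "test_fun (U \<times> V) \<phi>"
    and "pds [(1, 0), (1, 0)] \<phi> (t, x) = pds [1, 1] \<theta> t * \<xi> x"
    and "b \<in> Basis \<Longrightarrow> pds [(0, b), (0, b)] \<phi> (t, x) = \<theta> t * pds [b, b] \<xi> x"
proof -
  obtain K where K: "smooth \<theta>" "compact K" "K \<subseteq> U" "\<And>x bs. x \<notin> K \<Longrightarrow> pds bs \<theta> x = 0"
    using test_funE[OF U(1) \<theta>] by blast
  obtain L where L: "smooth \<xi>" "compact L" "L \<subseteq> V" "\<And>x bs. x \<notin> L \<Longrightarrow> pds bs \<xi> x = 0"
    using test_funE[OF U(2) \<xi>] by blast
  show "test_fun (U \<times> V) \<phi>"
  proof (rule test_funI[of _ "K \<times> L"])
    show "smooth \<phi>" unfolding \<phi>_def by (rule smooth_mult[OF smooth_fst_real[OF K(1)] smooth_snd[OF L(1)]])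
    show "\<phi> z = 0" if "z \<notin> K \<times> L" for z
      using that K(4)[of "fst z" "[]"] L(4)[of "snd z" "[]"] by (cases z) (auto simp: \<phi>_def)
  qed (use K L in \<open>auto intro: compact_Times\<close>)
  have t1: "pd (1, 0) (\<lambda>z :: real \<times> 'a. h (fst z) * g (snd z)) = (\<lambda>z. pd 1 h (fst z) * g (snd z))"
    if "smooth h" for h :: "real \<Rightarrow> real" and g :: "'a \<Rightarrow> real"
  proof (rule ext, rule pd_eqI)
    fix z :: "real \<times> 'a"
    show "((\<lambda>s. h (fst (z + s *\<^sub>R (1, 0))) * g (snd (z + s *\<^sub>R (1, 0)))) has_real_derivative pd 1 h (fst z) * g (snd z)) (at 0)"
      using DERIV_cmult_right[OF smooth_has_deriv[OF that, of 1 "fst z"]] by simp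
  qed
  have t2: "pd (0, b) (\<lambda>z :: real \<times> 'a. h (fst z) * g (snd z)) = (\<lambda>z. h (fst z) * pd b g (snd z))"
    if "smooth g" "b \<in> Basis" for h :: "real \<Rightarrow> real" and g :: "'a \<Rightarrow> real" and b
  proof (rule ext, rule pd_eqI)
    fix z :: "real \<times> 'a"
    show "((\<lambda>s. h (fst (z + s *\<^sub>R (0, b))) * g (snd (z + s *\<^sub>R (0, b)))) has_real_derivative h (fst z) * pd b g (snd z)) (at 0)"
      using DERIV_cmult[OF smooth_has_deriv[OF that, of "snd z"]] by simp
  qed
  have "smooth (pd 1 \<theta>)" by (rule smooth_pd[OF K(1)]) simp
  then show "pds [(1, 0), (1, 0)] \<phi> (t, x) = pds [1, 1] \<theta> t * \<xi> x"
    unfolding \<phi>_def by (simp add: t1 K(1))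
  show "pds [(0, b), (0, b)] \<phi> (t, x) = \<theta> t * pds [b, b] \<xi> x" if "b \<in> Basis"
    unfolding \<phi>_def using that by (simp add: t2 L(1) smooth_pd)
qed

subsection \<open>Bounded approximation in the space of Dirichlet functions\<close>

text \<open>The identity cut off by a plateau has compact support, so it is bounded together with
  its derivative.\<close>

lemma smooth_truncation:
  assumes M: "M \<ge> 0"
  obtains \<tau> :: "real \<Rightarrow> real" and K where "smooth \<tau>" "\<tau> 0 = 0" "\<And>s. \<bar>s\<bar> \<le> M \<Longrightarrow> \<tau> s = s \<and> pd 1 \<tau> s = 1"
    "K \<ge> 0" "\<And>s. \<bar>\<tau> s\<bar> \<le> K" "\<And>s. \<bar>pd 1 \<tau> s\<bar> \<le> K"
proof -
  \<comment> \<open>Margin 2 with layers of width 1 leaves \<tau> equal to the identity up to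
    modulus M + 1, a neighbourhood of [-M, M], so that its derivative is 1 on all of
    [-M, M].\<close>
  define \<tau> where "\<tau> s = s * plateau 1 (- (M + 2)) (M + 2) s" for s
  have sm: "smooth \<tau>" unfolding \<tau>_def[abs_def] by (rule smooth_mult[OF smooth_ident smooth_plateau])
  have test: "test_fun UNIV \<tau>"
    by (rule test_funI[OF sm, of "{- (M + 2)..M + 2}"]) (auto simp: \<tau>_def intro!: plateau_outside)
  obtain K1 where K1: "\<And>s. \<bar>\<tau> s\<bar> \<le> K1" using test_fun_bounded[OF open_UNIV test] by blast
  obtain K2 where K2: "\<And>s. \<bar>pd 1 \<tau> s\<bar> \<le> K2"
    using test_fun_bounded[OF open_UNIV test_fun_pd[OF open_UNIV test, of 1]] by auto
  have id: "\<tau> s = s" if "\<bar>s\<bar> < M + 1" for s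
    using that by (auto simp: \<tau>_def plateau_def smooth_step)
  have d: "pd 1 \<tau> s = 1" if "\<bar>s\<bar> \<le> M" for s
  proof (rule DERIV_unique[OF smooth_real_has_deriv[OF sm]])
    show "(\<tau> has_real_derivative 1) (at s)"
      by (rule has_field_derivative_transform_within_open[OF DERIV_ident, of "{- (M + 1)<..<M + 1}"])
        (use that id in auto)
  qed
  show thesis
  proof (rule that[of \<tau> "max 0 (max K1 K2)"])
    show "smooth \<tau>" by fact
    show "\<tau> 0 = 0" by (simp add: \<tau>_def)
    show "\<tau> s = s \<and> pd 1 \<tau> s = 1" if "\<bar>s\<bar> \<le> M" for s using that id d by auto
    show "\<bar>\<tau> s\<bar> \<le> max 0 (max K1 K2)" "\<bar>pd 1 \<tau> s\<bar> \<le> max 0 (max K1 K2)" for s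
      using K1[of s] K2[of s] by auto
  qed simp
qed

lemma L2_lim_bounded_mult:
  assumes "L2_lim M V v F" "\<forall>\<^sub>F \<tau> in F. W \<tau> \<in> borel_measurable M" "w \<in> borel_measurable M"
    and "\<forall>\<^sub>F \<tau> in F. AE x in M. \<bar>W \<tau> x - w x\<bar> \<le> K * \<bar>V \<tau> x - v x\<bar>" "sq_int M w"
  shows "L2_lim M W w F"
proof (rule L2_lim_squeeze[OF assms(5)])
  have ev: "\<forall>\<^sub>F \<tau> in F. sq_int M (\<lambda>x. W \<tau> x - w x) \<and> sq_int M (\<lambda>x. V \<tau> x - v x)"
    using L2_limD(2)[OF assms(1)] assms(4) assms(2)
  proof eventually_elim
    case (elim \<tau>)
    have V: "sq_int M (\<lambda>x. V \<tau> x - v x)" using elim L2_limD(1)[OF assms(1)] by (intro sq_int_diff)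
    show ?case using sq_int_bounded_mult[OF V _ elim(2)] elim(3) assms(3) V by auto
  qed
  then show "\<forall>\<^sub>F \<tau> in F. sq_int M (W \<tau>)"
  proof eventually_elim
    case (elim \<tau>)
    then show ?case using sq_int_add[OF _ assms(5), of "\<lambda>x. W \<tau> x - w x"] by simp
  qed
  show "((\<lambda>\<tau>. K\<^sup>2 * (LINT x|M. (V \<tau> x - v x)\<^sup>2)) \<longlongrightarrow> 0) F"
    using assms(1) by (auto simp: L2_lim_def intro: tendsto_mult_right_zero)
  show "\<forall>\<^sub>F \<tau> in F. (LINT x|M. (W \<tau> x - w x)\<^sup>2) \<le> K\<^sup>2 * (LINT x|M. (V \<tau> x - v x)\<^sup>2)"
    using ev assms(4)
  proof eventually_elim
    case (elim \<tau>)
    have "(LINT x|M. (W \<tau> x - w x)\<^sup>2) \<le> (LINT x|M. K\<^sup>2 * (V \<tau> x - v x)\<^sup>2)"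
    proof (rule integral_mono_AE)
      show "AE x in M. (W \<tau> x - w x)\<^sup>2 \<le> K\<^sup>2 * (V \<tau> x - v x)\<^sup>2"
        using elim(2)
      proof eventually_elim
        case (elim x)
        then have "\<bar>W \<tau> x - w x\<bar> \<le> \<bar>K * (V \<tau> x - v x)\<bar>"
          unfolding abs_mult by (meson abs_ge_self abs_ge_zero mult_right_mono order_trans)
        then show ?case by (metis abs_le_square_iff power_mult_distrib)
      qed
    qed (use elim in \<open>auto simp: sq_int_def\<close>)
    then show ?case by simp
  qed
qed

lemma L2_lim_dominated:
  assumes "\<And>k. W k \<in> borel_measurable M" "w \<in> borel_measurable M" "sq_int M g"
    and "AE x in M. (\<lambda>k. W k x) \<longlonglongrightarrow> w x" "\<And>k. AE x in M. \<bar>W k x - w x\<bar> \<le> \<bar>g x\<bar>" "sq_int M w"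
  shows "L2_lim M W w sequentially"
  unfolding L2_lim_def
proof (intro conjI assms(6) always_eventually allI)
  fix k
  have "sq_int M (\<lambda>x. W k x - w x)"
    by (rule sq_int_bounded_mult[OF assms(3), of _ 1]) (use assms(1,2,5) in auto)
  then show "sq_int M (W k)" using sq_int_add[OF _ assms(6), of "\<lambda>x. W k x - w x"] by simp
next
  have "(\<lambda>k. LINT x|M. (W k x - w x)\<^sup>2) \<longlonglongrightarrow> (LINT x|M. 0)"
  proof (rule integral_dominated_convergence[where w = "\<lambda>x. (g x)\<^sup>2"])
    show "AE x in M. (\<lambda>k. (W k x - w x)\<^sup>2) \<longlonglongrightarrow> 0"
      using assms(4)
    proof eventually_elim
      case (elim x)
      then have "(\<lambda>k. (W k x - w x)\<^sup>2) \<longlonglongrightarrow> (w x - w x)\<^sup>2" by (intro tendsto_intros)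
      then show ?case by simp
    qed
    show "AE x in M. norm ((W k x - w x)\<^sup>2) \<le> (g x)\<^sup>2" for k
      using assms(5)[of k] by eventually_elim (simp add: abs_le_square_iff)
  qed (use assms in \<open>auto simp: sq_int_def\<close>)
  then show "(\<lambda>k. LINT x|M. (W k x - w x)\<^sup>2) \<longlonglongrightarrow> 0" by simp
qed

text \<open>Truncating the approximants by \<tau> keeps compact support because \<tau> fixes 0, and
  leaves the limit f unchanged. The error of the gradient is \<tau>'(\<phi>) times the old error,
  small in L2, plus (\<tau>'(\<phi>) - 1) times the gradient of f, which tends to 0 by dominated
  convergence.\<close>

lemma H10_bounded_approx:
  fixes U :: "'a::euclidean_space set"
  assumes U: "open U" and f: "H10 U f" and M: "AE x in lebesgue_on U. \<bar>f x\<bar> \<le> M"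
  obtains \<xi>s K where "\<And>k. test_fun U (\<xi>s k)" "\<And>k x. \<bar>\<xi>s k x\<bar> \<le> K" "L2_lim (lebesgue_on U) \<xi>s f sequentially"
    "\<And>b. b \<in> Basis \<Longrightarrow> L2_lim (lebesgue_on U) (\<lambda>k. pd b (\<xi>s k)) (wd U [b] f) sequentially"
    "AE x in lebesgue_on U. (\<lambda>k. \<xi>s k x) \<longlonglongrightarrow> f x"
proof -
  let ?M = "lebesgue_on U"
  obtain \<phi>0 where \<phi>0: "\<And>k. test_fun U (\<phi>0 k)" "L2_lim ?M \<phi>0 f sequentially"
    "\<And>b. b \<in> Basis \<Longrightarrow> L2_lim ?M (\<lambda>k. pd b (\<phi>0 k)) (wd U [b] f) sequentially"
    using H10_approx[OF U f] by blast
  \<comment> \<open>Pointwise convergence is what makes \<tau>'(\<phi>) tend to 1 in the gradient,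
    and it is available along a subsequence.\<close>
  obtain r :: "nat \<Rightarrow> nat" where r: "strict_mono r" "AE x in ?M. (\<lambda>k. \<phi>0 (r k) x) \<longlonglongrightarrow> f x"
    using L2_lim_AE_subseq[OF \<phi>0(2)] by blast
  define \<phi> where "\<phi> k = \<phi>0 (r k)" for k
  have \<phi>: "\<And>k. test_fun U (\<phi> k)" "L2_lim ?M \<phi> f sequentially"
    "\<And>b. b \<in> Basis \<Longrightarrow> L2_lim ?M (\<lambda>k. pd b (\<phi> k)) (wd U [b] f) sequentially"
    "AE x in ?M. (\<lambda>k. \<phi> k x) \<longlonglongrightarrow> f x"
    unfolding \<phi>_def using \<phi>0 r by (auto intro: L2_lim_compose[OF _ filterlim_subseq[OF r(1)]])
  obtain \<tau> :: "real \<Rightarrow> real" and K where \<tau>: "smooth \<tau>" "\<tau> 0 = 0"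
    "\<And>s. \<bar>s\<bar> \<le> max 0 M \<Longrightarrow> \<tau> s = s \<and> pd 1 \<tau> s = 1"
    "K \<ge> 0" "\<And>s. \<bar>\<tau> s\<bar> \<le> K" "\<And>s. \<bar>pd 1 \<tau> s\<bar> \<le> K"
    using smooth_truncation[of "max 0 M"] by (metis max.cobounded1)
  have lip: "\<bar>\<tau> a - \<tau> b\<bar> \<le> K * \<bar>a - b\<bar>" for a b
    by (rule Lipschitz_bound[where L = "max \<bar>a\<bar> \<bar>b\<bar>", OF smooth_real_has_deriv[OF \<tau>(1)] \<tau>(6)]) auto
  have Mf: "AE x in ?M. \<tau> (f x) = f x \<and> pd 1 \<tau> (f x) = 1" using M by eventually_elim (use \<tau>(3) in auto)
  have fsq: "sq_int ?M f" using L2_limD(1)[OF \<phi>(2)] .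
  have meas: "\<phi> k \<in> borel_measurable ?M" for k using test_fun_sq_int[OF U \<phi>(1)] by (rule sq_int_measurable)
  have c\<tau>: "continuous_on UNIV \<tau>" "continuous_on UNIV (pd 1 \<tau>)"
    using \<tau>(1) by (auto intro!: smooth_continuous smooth_pd)
  have m\<tau>: "(\<lambda>x. \<tau> (\<phi> k x)) \<in> borel_measurable ?M" "(\<lambda>x. pd 1 \<tau> (\<phi> k x)) \<in> borel_measurable ?M" for k
    using borel_measurable_continuous_on[OF c\<tau>(1) meas] borel_measurable_continuous_on[OF c\<tau>(2) meas] by auto
  show thesis
  proof
    show "test_fun U (\<lambda>x. \<tau> (\<phi> k x))" for k by (rule test_fun_compose[OF U \<phi>(1) \<tau>(1,2)])
    show "\<bar>\<tau> (\<phi> k x)\<bar> \<le> K" for k x by (rule \<tau>(5))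
    show "L2_lim ?M (\<lambda>k x. \<tau> (\<phi> k x)) f sequentially"
    proof (rule L2_lim_bounded_mult[OF \<phi>(2) always_eventually[OF allI[OF m\<tau>(1)]] sq_int_measurable[OF fsq] _ fsq])
      have "AE x in ?M. \<bar>\<tau> (\<phi> k x) - f x\<bar> \<le> K * \<bar>\<phi> k x - f x\<bar>" for k
        using Mf
      proof eventually_elim
        case (elim x)
        then show ?case using lip[of "\<phi> k x" "f x"] by simp
      qed
      then show "\<forall>\<^sub>F k in sequentially. AE x in ?M. \<bar>\<tau> (\<phi> k x) - f x\<bar> \<le> K * \<bar>\<phi> k x - f x\<bar>" by simp
    qed
    show "AE x in ?M. (\<lambda>k. \<tau> (\<phi> k x)) \<longlonglongrightarrow> f x"
      using \<phi>(4) Mf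
    proof eventually_elim
      case (elim x)
      have "isCont \<tau> (f x)" using c\<tau>(1) by (simp add: continuous_on_eq_continuous_at)
      then have "(\<lambda>k. \<tau> (\<phi> k x)) \<longlonglongrightarrow> \<tau> (f x)" using elim(1) by (rule isCont_tendsto_compose)
      then show ?case using elim(2) by simp
    qed
    fix b :: 'a assume b: "b \<in> Basis"
    let ?g = "wd U [b] f"
    have g: "sq_int ?M ?g" using L2_limD(1)[OF \<phi>(3)[OF b]] .
    have mp: "pd b (\<phi> k) \<in> borel_measurable ?M" for k
      using test_fun_sq_int[OF U test_fun_pd[OF U \<phi>(1) b]] by (rule sq_int_measurable)
    have 1: "L2_lim ?M (\<lambda>k x. pd 1 \<tau> (\<phi> k x) * (pd b (\<phi> k) x - ?g x)) (\<lambda>_. 0) sequentially"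
    proof (rule L2_lim_bounded_mult[OF \<phi>(3)[OF b] _ _ _ sq_int_zero])
      show "\<forall>\<^sub>F k in sequentially. (\<lambda>x. pd 1 \<tau> (\<phi> k x) * (pd b (\<phi> k) x - ?g x)) \<in> borel_measurable ?M"
        by (intro always_eventually allI borel_measurable_times borel_measurable_diff m\<tau>(2) mp sq_int_measurable[OF g])
      show "\<forall>\<^sub>F k in sequentially. AE x in ?M. \<bar>pd 1 \<tau> (\<phi> k x) * (pd b (\<phi> k) x - ?g x) - 0\<bar> \<le> K * \<bar>pd b (\<phi> k) x - ?g x\<bar>"
        by (intro always_eventually allI AE_I2) (auto simp: abs_mult intro!: mult_right_mono \<tau>(6))
    qed simp
    have 2: "L2_lim ?M (\<lambda>k x. (pd 1 \<tau> (\<phi> k x) - 1) * ?g x) (\<lambda>_. 0) sequentially"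
    proof (rule L2_lim_dominated[OF _ _ sq_int_cmult[OF g, of "K + 1"] _ _ sq_int_zero])
      show "(\<lambda>x. (pd 1 \<tau> (\<phi> k x) - 1) * ?g x) \<in> borel_measurable ?M" for k
        by (intro borel_measurable_times borel_measurable_diff m\<tau>(2) sq_int_measurable[OF g] borel_measurable_const)
      show "AE x in ?M. (\<lambda>k. (pd 1 \<tau> (\<phi> k x) - 1) * ?g x) \<longlonglongrightarrow> 0"
        using \<phi>(4) Mf
      proof eventually_elim
        case (elim x)
        have "isCont (pd 1 \<tau>) (f x)" using c\<tau>(2) by (simp add: continuous_on_eq_continuous_at)
        then have "(\<lambda>k. pd 1 \<tau> (\<phi> k x)) \<longlonglongrightarrow> pd 1 \<tau> (f x)" using elim(1) by (rule isCont_tendsto_compose)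
        then have "(\<lambda>k. (pd 1 \<tau> (\<phi> k x) - 1) * ?g x) \<longlonglongrightarrow> (pd 1 \<tau> (f x) - 1) * ?g x" by (intro tendsto_intros)
        then show ?case using elim(2) by simp
      qed
      show "AE x in ?M. \<bar>(pd 1 \<tau> (\<phi> k x) - 1) * ?g x - 0\<bar> \<le> \<bar>(K + 1) * ?g x\<bar>" for k
      proof (rule AE_I2)
        fix x
        have "\<bar>pd 1 \<tau> (\<phi> k x) - 1\<bar> \<le> \<bar>K + 1\<bar>" using \<tau>(6)[of "\<phi> k x"] \<tau>(4) by linarith
        then show "\<bar>(pd 1 \<tau> (\<phi> k x) - 1) * ?g x - 0\<bar> \<le> \<bar>(K + 1) * ?g x\<bar>"
          by (simp add: abs_mult mult_right_mono)
      qed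
    qed simp
    have eq: "pd b (\<lambda>x. \<tau> (\<phi> k x)) = (\<lambda>x. pd 1 \<tau> (\<phi> k x) * (pd b (\<phi> k) x - ?g x) + (pd 1 \<tau> (\<phi> k x) - 1) * ?g x + ?g x)" for k
      using pd_compose(2)[OF \<tau>(1) test_fun_smooth[OF U \<phi>(1)] b] by (auto simp: algebra_simps)
    show "L2_lim ?M (\<lambda>k. pd b (\<lambda>x. \<tau> (\<phi> k x))) ?g sequentially"
      unfolding eq using L2_lim_add[OF L2_lim_add[OF 1 2] L2_lim_const[OF g]] by simp
  qed
qed

subsection \<open>Weak solutions tested against bounded Dirichlet functions\<close>

text \<open>Fatou's lemma for nonnegative integrals gives the integrability of the limit along with
  the bound. It extends a bound from almost all times to every time.\<close>

lemma Fatou_powr: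
  fixes V :: "nat \<Rightarrow> 'a \<Rightarrow> real"
  assumes lim: "AE x in M. (\<lambda>k. V k x) \<longlonglongrightarrow> v x" and v: "v \<in> borel_measurable M" and q: "q > 0"
    and int: "\<And>k. integrable M (\<lambda>x. \<bar>V k x\<bar> powr q)" "\<And>k. (LINT x|M. \<bar>V k x\<bar> powr q) \<le> C"
  shows "integrable M (\<lambda>x. \<bar>v x\<bar> powr q)" "(LINT x|M. \<bar>v x\<bar> powr q) \<le> C"
proof -
  have "(LINT x|M. \<bar>V 0 x\<bar> powr q) \<ge> 0" by simp
  then have C: "C \<ge> 0" using int(2)[of 0] by linarith
  have nn: "(\<integral>\<^sup>+x. ennreal (\<bar>V k x\<bar> powr q) \<partial>M) \<le> ennreal C" for k
    using int[of k] by (subst nn_integral_eq_integral) (auto intro: ennreal_leI)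
  have "(\<integral>\<^sup>+x. ennreal (\<bar>v x\<bar> powr q) \<partial>M) = (\<integral>\<^sup>+x. liminf (\<lambda>k. ennreal (\<bar>V k x\<bar> powr q)) \<partial>M)"
  proof (rule nn_integral_cong_AE)
    show "AE x in M. ennreal (\<bar>v x\<bar> powr q) = liminf (\<lambda>k. ennreal (\<bar>V k x\<bar> powr q))"
      using lim
    proof eventually_elim
      case (elim x)
      have "(\<lambda>k. \<bar>V k x\<bar> powr q) \<longlonglongrightarrow> \<bar>v x\<bar> powr q"
        using elim q by (intro tendsto_powr' tendsto_rabs tendsto_const) auto
      then have "(\<lambda>k. ennreal (\<bar>V k x\<bar> powr q)) \<longlonglongrightarrow> ennreal (\<bar>v x\<bar> powr q)"
        by (rule tendsto_ennrealI)
      then show ?case by (intro lim_imp_Liminf[symmetric]) auto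
    qed
  qed
  also have "\<dots> \<le> liminf (\<lambda>k. \<integral>\<^sup>+x. ennreal (\<bar>V k x\<bar> powr q) \<partial>M)"
    using int(1) by (intro nn_integral_liminf) auto
  also have "\<dots> \<le> limsup (\<lambda>k. \<integral>\<^sup>+x. ennreal (\<bar>V k x\<bar> powr q) \<partial>M)"
    by (rule Liminf_le_Limsup) simp
  also have "\<dots> \<le> ennreal C" by (intro Limsup_bounded always_eventually allI nn)
  finally have le: "(\<integral>\<^sup>+x. ennreal (\<bar>v x\<bar> powr q) \<partial>M) \<le> ennreal C" .
  have meas: "(\<lambda>x. \<bar>v x\<bar> powr q) \<in> borel_measurable M" using v by simp
  show I: "integrable M (\<lambda>x. \<bar>v x\<bar> powr q)"
    using le by (intro integrableI_nonneg meas) (auto simp: top_unique less_top[symmetric] intro: le_less_trans)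
  then have "ennreal (LINT x|M. \<bar>v x\<bar> powr q) \<le> ennreal C"
    using le by (subst (asm) nn_integral_eq_integral) auto
  then show "(LINT x|M. \<bar>v x\<bar> powr q) \<le> C" using C by (simp add: ennreal_le_iff)
qed

section \<open>Weak solutions in the exterior of the unit ball\<close>

lemma open_Omega: "open (Omega :: (real^'n::finite) set)"
  unfolding Omega_def by (intro open_Collect_less continuous_intros)

lemma sets_Omega: "Omega \<in> sets lebesgue"
  by (rule open_lebesgue[OF open_Omega])

text \<open>The Sobolev hypotheses on the weak solution, reduced to L2 statements on [0,T]. The
  curve \<open>ud\<close> is continuous in L2 and no more, so the wave equation can be used only
  after pairing with a function of x; \<open>C\<close> bounds the L^(p+1) integral at every
  time.\<close>

locale weak_solution =
  fixes p T C :: real and u ud :: "real \<Rightarrow> real^'n::finite \<Rightarrow> real" and M :: "(real^'n) measure"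
  defines "M \<equiv> lebesgue_on Omega"
  assumes p: "p > 2" and T: "T > 0"
    and u_H1: "\<And>t. t \<in> {0..T} \<Longrightarrow> Hk 1 Omega (u t)"
    and grad_cont: "\<And>t b. t \<in> {0..T} \<Longrightarrow> b \<in> Basis \<Longrightarrow> L2_cont M (\<lambda>\<tau>. wd Omega [b] (u \<tau>)) t {0..T}"
    and u_deriv: "\<And>t. t \<in> {0..T} \<Longrightarrow> L2_deriv M u (ud t) t {0..T}"
    and ud_cont: "\<And>t. t \<in> {0..T} \<Longrightarrow> L2_cont M ud t {0..T}"
    and Lp: "\<And>t. t \<in> {0..T} \<Longrightarrow> integrable M (\<lambda>x. \<bar>u t x\<bar> powr (p + 1))"
      "\<And>t. t \<in> {0..T} \<Longrightarrow> (LINT x|M. \<bar>u t x\<bar> powr (p + 1)) \<le> C"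
    and sol: "distr_sol T (fp p) u"
begin

text \<open>The pairing of \<Delta>u - f(u) with \<xi>, one derivative moved onto \<xi>. The
  gradient of \<xi> is a separate argument \<open>g\<close>, so that classical gradients of test
  functions and weak gradients of their limits are covered at once.\<close>

definition force :: "(real^'n \<Rightarrow> real) \<Rightarrow> (real^'n \<Rightarrow> real^'n \<Rightarrow> real) \<Rightarrow> real \<Rightarrow> real" where
  "force \<xi> g t = - (\<Sum>b\<in>Basis. ip M (wd Omega [b] (u t)) (g b)) - (LINT x|M. fp p (u t x) * \<xi> x)"

lemma u_sq: "t \<in> {0..T} \<Longrightarrow> sq_int M (u t)"
  using u_deriv by (simp add: L2_deriv_def)

lemma grad_sq: "t \<in> {0..T} \<Longrightarrow> b \<in> Basis \<Longrightarrow> sq_int M (wd Omega [b] (u t))"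
  using grad_cont L2_limD(1) by blast

lemma fp_u_integrable:
  assumes t: "t \<in> {0..T}" shows "integrable M (\<lambda>x. fp p (u t x))"
proof (rule Bochner_Integration.integrable_bound)
  show "integrable M (\<lambda>x. (u t x)\<^sup>2 + \<bar>u t x\<bar> powr (p + 1))"
    using u_sq[OF t] Lp(1)[OF t] by (simp add: sq_int_def)
  show "(\<lambda>x. fp p (u t x)) \<in> borel_measurable M"
    by (rule fp_measurable[OF sq_int_measurable[OF u_sq[OF t]]])
  show "AE x in M. norm (fp p (u t x)) \<le> norm ((u t x)\<^sup>2 + \<bar>u t x\<bar> powr (p + 1))"
    using abs_fp_le[OF p] by (intro AE_I2) simp
qed

lemma fp_u_mult_integrable:
  assumes t: "t \<in> {0..T}" and \<xi>: "\<xi> \<in> borel_measurable M" "AE x in M. \<bar>\<xi> x\<bar> \<le> K"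
  shows "integrable M (\<lambda>x. fp p (u t x) * \<xi> x)"
proof (rule Bochner_Integration.integrable_bound)
  show "integrable M (\<lambda>x. K * fp p (u t x))" using fp_u_integrable[OF t] by simp
  show "(\<lambda>x. fp p (u t x) * \<xi> x) \<in> borel_measurable M"
    using fp_u_integrable[OF t] \<xi> by auto
  show "AE x in M. norm (fp p (u t x) * \<xi> x) \<le> norm (K * fp p (u t x))"
    using \<xi>(2)
  proof eventually_elim
    case (elim x)
    then have "\<bar>\<xi> x\<bar> * \<bar>fp p (u t x)\<bar> \<le> \<bar>K\<bar> * \<bar>fp p (u t x)\<bar>" by (intro mult_right_mono) auto
    then show ?case by (simp add: abs_mult mult.commute)
  qed
qed

lemma C_nonneg: "C \<ge> 0"
proof -
  have "(LINT x|M. \<bar>u 0 x\<bar> powr (p + 1)) \<ge> 0" by simp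
  also have "\<dots> \<le> C" using T by (intro Lp(2)) simp
  finally show ?thesis .
qed

text \<open>Integrates \<open>fp_diff_split\<close>. The Lipschitz part is handled by
  Cauchy-Schwarz; the part above L is paid by the L^(p+1) bound at both times, so that 2 / L times K
  times C + C gives the last term. \<open>K\<close> bounds \<xi> both in L2 and in sup norm.\<close>

lemma fp_u_diff_bound:
  assumes r: "r \<in> {0..T}" and s: "s \<in> {0..T}" and L: "L > 0" and K: "K \<ge> 0"
    and \<xi>: "sq_int M \<xi>" "ip M \<xi> \<xi> \<le> K\<^sup>2" "AE x in M. \<bar>\<xi> x\<bar> \<le> K"
  shows "\<bar>(LINT x|M. fp p (u r x) * \<xi> x) - (LINT x|M. fp p (u s x) * \<xi> x)\<bar> \<le>
    p * L powr (p - 1) * (sqrt (LINT x|M. (u r x - u s x)\<^sup>2) * K) + 4 * K * C / L"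
proof -
  let ?w = "\<lambda>x. u r x - u s x" and ?c = "p * L powr (p - 1)"
  have m\<xi>: "\<xi> \<in> borel_measurable M" using \<xi>(1) by (rule sq_int_measurable)
  have w: "sq_int M ?w" using u_sq r s by (intro sq_int_diff) auto
  have abs_sq: "sq_int M (\<lambda>x. \<bar>a x\<bar>)" if "sq_int M a" for a using that by (auto simp: sq_int_def)
  have i1: "integrable M (\<lambda>x. \<bar>?w x\<bar> * \<bar>\<xi> x\<bar>)" by (intro sq_int_mult abs_sq w \<xi>)
  have i2: "integrable M (\<lambda>x. fp p (u r x) * \<xi> x)" "integrable M (\<lambda>x. fp p (u s x) * \<xi> x)"
    using fp_u_mult_integrable[OF _ m\<xi> \<xi>(3)] r s by auto
  have "(LINT x|M. fp p (u r x) * \<xi> x) - (LINT x|M. fp p (u s x) * \<xi> x) =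
      (LINT x|M. (fp p (u r x) - fp p (u s x)) * \<xi> x)"
    using i2 by (simp add: left_diff_distrib)
  also have "\<bar>\<dots>\<bar> \<le> (LINT x|M. \<bar>(fp p (u r x) - fp p (u s x)) * \<xi> x\<bar>)"
    by (rule integral_abs_bound)
  also have "\<dots> \<le> (LINT x|M. ?c * (\<bar>?w x\<bar> * \<bar>\<xi> x\<bar>) + (2 / L * K) * (\<bar>u r x\<bar> powr (p + 1) + \<bar>u s x\<bar> powr (p + 1)))"
  proof (rule integral_mono_AE)
    have "integrable M (\<lambda>x. (fp p (u r x) - fp p (u s x)) * \<xi> x)" using i2 by (simp add: left_diff_distrib)
    then show "integrable M (\<lambda>x. \<bar>(fp p (u r x) - fp p (u s x)) * \<xi> x\<bar>)" by (rule integrable_abs)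
    show "integrable M (\<lambda>x. ?c * (\<bar>?w x\<bar> * \<bar>\<xi> x\<bar>) + (2 / L * K) * (\<bar>u r x\<bar> powr (p + 1) + \<bar>u s x\<bar> powr (p + 1)))"
      using i1 Lp(1)[OF r] Lp(1)[OF s] by (intro Bochner_Integration.integrable_add integrable_mult_right)
    show "AE x in M. \<bar>(fp p (u r x) - fp p (u s x)) * \<xi> x\<bar> \<le>
        ?c * (\<bar>?w x\<bar> * \<bar>\<xi> x\<bar>) + (2 / L * K) * (\<bar>u r x\<bar> powr (p + 1) + \<bar>u s x\<bar> powr (p + 1))"
      using \<xi>(3)
    proof eventually_elim
      case (elim x)
      let ?P = "\<bar>u r x\<bar> powr (p + 1) + \<bar>u s x\<bar> powr (p + 1)"
      have "\<bar>(fp p (u r x) - fp p (u s x)) * \<xi> x\<bar> \<le> (?c * \<bar>?w x\<bar> + 2 / L * ?P) * \<bar>\<xi> x\<bar>"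
        unfolding abs_mult using p L by (intro mult_right_mono fp_diff_split) auto
      also have "\<dots> = ?c * (\<bar>?w x\<bar> * \<bar>\<xi> x\<bar>) + (2 / L * ?P) * \<bar>\<xi> x\<bar>" by (simp add: algebra_simps)
      also have "\<dots> \<le> ?c * (\<bar>?w x\<bar> * \<bar>\<xi> x\<bar>) + (2 / L * ?P) * K"
        using elim L by (intro add_left_mono mult_left_mono) auto
      also have "(2 / L * ?P) * K = (2 / L * K) * ?P" by (simp only: mult.commute mult.left_commute)
      finally show ?case .
    qed
  qed
  also have "\<dots> = ?c * (LINT x|M. \<bar>?w x\<bar> * \<bar>\<xi> x\<bar>) +
      (2 / L * K) * ((LINT x|M. \<bar>u r x\<bar> powr (p + 1)) + (LINT x|M. \<bar>u s x\<bar> powr (p + 1)))"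
    using i1 Lp(1)[OF r] Lp(1)[OF s] by simp
  also have "\<dots> \<le> ?c * (sqrt (LINT x|M. (?w x)\<^sup>2) * K) + (2 / L * K) * (C + C)"
  proof (intro add_mono mult_left_mono)
    have "(LINT x|M. \<bar>?w x\<bar> * \<bar>\<xi> x\<bar>) \<le> sqrt (ip M (\<lambda>x. \<bar>?w x\<bar>) (\<lambda>x. \<bar>?w x\<bar>)) * sqrt (ip M (\<lambda>x. \<bar>\<xi> x\<bar>) (\<lambda>x. \<bar>\<xi> x\<bar>))"
      using L2_Cauchy_Schwarz_sqrt[OF abs_sq[OF w] abs_sq[OF \<xi>(1)]] unfolding ip_def by linarith
    also have "\<dots> = sqrt (LINT x|M. (?w x)\<^sup>2) * sqrt (ip M \<xi> \<xi>)" by (simp add: ip_self)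
    also have "\<dots> \<le> sqrt (LINT x|M. (?w x)\<^sup>2) * K"
      using \<xi>(2) K by (intro mult_left_mono real_le_lsqrt) auto
    finally show "(LINT x|M. \<bar>?w x\<bar> * \<bar>\<xi> x\<bar>) \<le> sqrt (LINT x|M. (?w x)\<^sup>2) * K" .
  qed (use Lp(2)[OF r] Lp(2)[OF s] p L K in auto)
  finally show ?thesis using L by (simp add: field_simps)
qed

text \<open>The modulus of continuity depends on the bound K alone and not on \<xi> and g. This
  uniformity is what lets time derivatives pass from test functions to their limits.\<close>

lemma force_equicontinuous:
  assumes s: "s \<in> {0..T}" and \<delta>: "\<delta> > 0" and K: "K \<ge> 0"
  obtains d where "d > 0" "\<And>r \<xi> g. r \<in> {0..T} \<Longrightarrow> \<bar>r - s\<bar> < d \<Longrightarrow> sq_int M \<xi> \<Longrightarrow> ip M \<xi> \<xi> \<le> K\<^sup>2 \<Longrightarrow>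
    AE x in M. \<bar>\<xi> x\<bar> \<le> K \<Longrightarrow> (\<And>b. b \<in> Basis \<Longrightarrow> sq_int M (g b)) \<Longrightarrow>
    (\<And>b. b \<in> Basis \<Longrightarrow> ip M (g b) (g b) \<le> K\<^sup>2) \<Longrightarrow> \<bar>force \<xi> g r - force \<xi> g s\<bar> \<le> \<delta>"
proof -
  \<comment> \<open>Chosen so that the contribution 4 K C / L of large values stays below \<delta>/2
    at all times; the other half is left for \<open>D\<close>, which tends to 0 as r tends to s with
    L fixed.\<close>
  define L where "L = 8 * K * C / \<delta> + 1"
  have L: "L > 0" "4 * K * C / L \<le> \<delta> / 2"
  proof -
    have "0 \<le> 8 * K * C / \<delta>" using \<delta> K C_nonneg by simp
    then show "L > 0" by (simp add: L_def)
    have "4 * K * C \<le> \<delta> / 2 * L" using \<delta> by (simp add: L_def field_simps)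
    then show "4 * K * C / L \<le> \<delta> / 2" using \<open>L > 0\<close> by (simp add: pos_divide_le_eq)
  qed
  define D where "D r = (\<Sum>b\<in>Basis. sqrt (LINT x|M. (wd Omega [b] (u r) x - wd Omega [b] (u s) x)\<^sup>2) * K) +
    p * L powr (p - 1) * (sqrt (LINT x|M. (u r x - u s x)\<^sup>2) * K)" for r
  have "(D \<longlongrightarrow> (\<Sum>b\<in>(Basis :: (real^'n) set). sqrt 0 * K) + p * L powr (p - 1) * (sqrt 0 * K)) (at s within {0..T})"
    unfolding D_def
    using grad_cont[OF s] L2_deriv_imp_cont[OF u_deriv[OF s]]
    by (intro tendsto_intros) (auto simp: L2_lim_def)
  then have "(D \<longlongrightarrow> 0) (at s within {0..T})" by simp
  then have "\<forall>\<^sub>F r in at s within {0..T}. D r < \<delta> / 2" using \<delta> by (intro order_tendstoD(2)) auto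
  then obtain d where d: "d > 0" "\<And>r. r \<in> {0..T} \<Longrightarrow> r \<noteq> s \<Longrightarrow> dist r s < d \<Longrightarrow> D r < \<delta> / 2"
    unfolding eventually_at by blast
  show thesis
  proof (rule that[OF d(1)])
    fix r \<xi> and g :: "real^'n \<Rightarrow> real^'n \<Rightarrow> real"
    assume r: "r \<in> {0..T}" "\<bar>r - s\<bar> < d"
      and \<xi>: "sq_int M \<xi>" "ip M \<xi> \<xi> \<le> K\<^sup>2" "AE x in M. \<bar>\<xi> x\<bar> \<le> K"
      and g: "\<And>b. b \<in> Basis \<Longrightarrow> sq_int M (g b)" "\<And>b. b \<in> Basis \<Longrightarrow> ip M (g b) (g b) \<le> K\<^sup>2"
    show "\<bar>force \<xi> g r - force \<xi> g s\<bar> \<le> \<delta>"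
    proof (cases "r = s")
      case False
      let ?I = "\<lambda>r. LINT x|M. fp p (u r x) * \<xi> x"
      have "\<bar>(\<Sum>b\<in>Basis. ip M (wd Omega [b] (u r)) (g b)) - (\<Sum>b\<in>Basis. ip M (wd Omega [b] (u s)) (g b))\<bar> \<le>
          (\<Sum>b\<in>Basis. sqrt (LINT x|M. (wd Omega [b] (u r) x - wd Omega [b] (u s) x)\<^sup>2) * K)"
        unfolding sum_subtractf[symmetric]
      proof (rule order_trans[OF sum_abs sum_mono])
        fix b :: "real^'n" assume b: "b \<in> Basis"
        let ?w = "\<lambda>x. wd Omega [b] (u r) x - wd Omega [b] (u s) x"
        have w: "sq_int M ?w" using grad_sq r s b by (intro sq_int_diff) auto
        have eq: "ip M (wd Omega [b] (u r)) (g b) - ip M (wd Omega [b] (u s)) (g b) = ip M ?w (g b)"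
          using grad_sq r s b g by (simp add: ip_diff_left)
        have "\<bar>ip M ?w (g b)\<bar> \<le> sqrt (ip M ?w ?w) * sqrt (ip M (g b) (g b))"
          by (rule L2_Cauchy_Schwarz_sqrt[OF w g(1)[OF b]])
        also have "\<dots> \<le> sqrt (ip M ?w ?w) * K"
          by (intro mult_left_mono real_le_lsqrt g(2)[OF b] K) (simp add: ip_self_nonneg)
        also have "\<dots> = sqrt (LINT x|M. (?w x)\<^sup>2) * K" by (simp only: ip_self)
        finally show "\<bar>ip M (wd Omega [b] (u r)) (g b) - ip M (wd Omega [b] (u s)) (g b)\<bar> \<le> sqrt (LINT x|M. (?w x)\<^sup>2) * K"
          unfolding eq .
      qed
      moreover have "\<bar>?I r - ?I s\<bar> \<le> p * L powr (p - 1) * (sqrt (LINT x|M. (u r x - u s x)\<^sup>2) * K) + 4 * K * C / L"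
        by (rule fp_u_diff_bound[OF r(1) s L(1) K \<xi>])
      moreover have "D r < \<delta> / 2" using d(2)[OF r(1) False] r(2) by (simp add: dist_real_def)
      ultimately show ?thesis
        using L(2) unfolding force_def D_def by linarith
    qed (use \<delta> in simp)
  qed
qed

text \<open>Product test functions \<theta>(t) \<xi>(x) turn the distributional equation into a weak
  second-order equation for the scalar function t |-> <u(t), \<xi>>. Its right-hand side is
  continuous, so it holds classically up to both ends of [0,T].\<close>

lemma test_weak_equation:
  assumes \<xi>: "test_fun Omega \<xi>" and t: "t \<in> {0..T}"
  shows "((\<lambda>\<tau>. ip M (ud \<tau>) \<xi>) has_real_derivative force \<xi> (\<lambda>b. pd b \<xi>) t) (at t within {0..T})"
proof (rule second_derivative_of_weak[OF T _ _ _ _ t, where \<alpha> = "\<lambda>t. ip M (u t) \<xi>"])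
  have \<xi>sq: "sq_int M \<xi>" unfolding M_def by (rule test_fun_sq_int[OF open_Omega \<xi>])
  have gsq: "sq_int M (pd b \<xi>)" if "b \<in> Basis" for b
    unfolding M_def by (rule test_fun_sq_int[OF open_Omega test_fun_pd[OF open_Omega \<xi> that]])
  show d\<alpha>: "((\<lambda>\<tau>. ip M (u \<tau>) \<xi>) has_real_derivative ip M (ud t) \<xi>) (at t within {0..T})" if "t \<in> {0..T}" for t
    by (rule L2_deriv_ip_const[OF u_deriv[OF that] \<xi>sq])
  show "continuous_on {0..T} (\<lambda>\<tau>. ip M (ud \<tau>) \<xi>)"
    unfolding continuous_on_def using ud_cont \<xi>sq by (auto intro: L2_lim_ip L2_lim_const)
  obtain K0 where K0: "\<And>x. \<bar>\<xi> x\<bar> \<le> K0" using test_fun_bounded[OF open_Omega \<xi>] by blast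
  \<comment> \<open>One constant above the sup bound, the L2 norm and all gradient norms, as
    \<open>force_equicontinuous\<close> takes a single K.\<close>
  define K where "K = Max (insert \<bar>K0\<bar> (insert (sqrt (ip M \<xi> \<xi>)) ((\<lambda>b. sqrt (ip M (pd b \<xi>) (pd b \<xi>))) ` Basis)))"
  have K: "\<bar>K0\<bar> \<le> K" "sqrt (ip M \<xi> \<xi>) \<le> K" "\<And>b. b \<in> Basis \<Longrightarrow> sqrt (ip M (pd b \<xi>) (pd b \<xi>)) \<le> K"
    unfolding K_def by (rule Max_ge, simp, simp)+
  have "K \<ge> 0" using K(1) by linarith
  show cont: "continuous_on {0..T} (force \<xi> (\<lambda>b. pd b \<xi>))"
    unfolding continuous_on_iff
  proof (intro ballI allI impI)
    fix s and e :: real assume s: "s \<in> {0..T}" and "e > 0"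
    then have "e / 2 > 0" by simp
    from force_equicontinuous[OF s this \<open>K \<ge> 0\<close>] obtain d where d: "d > 0"
      "\<And>r \<xi> g. r \<in> {0..T} \<Longrightarrow> \<bar>r - s\<bar> < d \<Longrightarrow> sq_int M \<xi> \<Longrightarrow> ip M \<xi> \<xi> \<le> K\<^sup>2 \<Longrightarrow>
      AE x in M. \<bar>\<xi> x\<bar> \<le> K \<Longrightarrow> (\<And>b. b \<in> Basis \<Longrightarrow> sq_int M (g b)) \<Longrightarrow>
      (\<And>b. b \<in> Basis \<Longrightarrow> ip M (g b) (g b) \<le> K\<^sup>2) \<Longrightarrow> \<bar>force \<xi> g r - force \<xi> g s\<bar> \<le> e / 2"
      by blast
    have "\<bar>force \<xi> (\<lambda>b. pd b \<xi>) r - force \<xi> (\<lambda>b. pd b \<xi>) s\<bar> < e" if "r \<in> {0..T}" "\<bar>r - s\<bar> < d" for r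
    proof -
      have "\<bar>force \<xi> (\<lambda>b. pd b \<xi>) r - force \<xi> (\<lambda>b. pd b \<xi>) s\<bar> \<le> e / 2"
      proof (rule d(2)[OF that \<xi>sq])
        show "ip M \<xi> \<xi> \<le> K\<^sup>2" "\<And>b. b \<in> Basis \<Longrightarrow> ip M (pd b \<xi>) (pd b \<xi>) \<le> K\<^sup>2"
          using K \<open>K \<ge> 0\<close> by (auto intro: sqrt_le_D)
        show "AE x in M. \<bar>\<xi> x\<bar> \<le> K"
        proof (rule AE_I2)
          fix x show "\<bar>\<xi> x\<bar> \<le> K" using K0[of x] K(1) by linarith
        qed
      qed (rule gsq)
      then show ?thesis using \<open>e > 0\<close> by linarith
    qed
    then show "\<exists>d>0. \<forall>x'\<in>{0..T}. dist x' s < d \<longrightarrow>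
        dist (force \<xi> (\<lambda>b. pd b \<xi>) x') (force \<xi> (\<lambda>b. pd b \<xi>) s) < e"
      using d(1) by (auto simp: dist_real_def)
  qed
  have calpha: "continuous_on {0..T} (\<lambda>t. ip M (u t) \<xi>)" using d\<alpha> by (rule DERIV_continuous_on)
  fix \<theta> :: "real \<Rightarrow> real" assume \<theta>: "test_fun {0<..<T} \<theta>"
  have op: "open {0<..<T}" by simp
  let ?h = "\<lambda>t. pds [1, 1] \<theta> t * ip M (u t) \<xi> - \<theta> t * force \<xi> (\<lambda>b. pd b \<xi>) t"
  note tensor = tensor_test_fun[OF op open_Omega \<theta> \<xi>]
  have inner: "(LINT x:Omega|lebesgue.
            u t x * pds [(1::real, 0 :: real^'n), (1, 0)] (\<lambda>z. \<theta> (fst z) * \<xi> (snd z)) (t, x)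
          - u t x * (\<Sum>b\<in>(Basis :: (real^'n) set). pds [(0::real, b), (0, b)] (\<lambda>z. \<theta> (fst z) * \<xi> (snd z)) (t, x))
          + fp p (u t x) * (\<theta> (fst (t, x)) * \<xi> (snd (t, x)))) = ?h t" if t: "t \<in> {0..T}" for t
  proof -
    have dsq: "sq_int M (pds [b, b] \<xi>)" if "b \<in> Basis" for b
      unfolding M_def using that by (intro test_fun_sq_int[OF open_Omega] test_fun_pds[OF open_Omega \<xi>]) auto
    have i: "integrable M (\<lambda>x. u t x * \<xi> x)" "\<And>b. b \<in> Basis \<Longrightarrow> integrable M (\<lambda>x. u t x * pds [b, b] \<xi> x)"
      using u_sq[OF t] \<xi>sq dsq by (auto intro: sq_int_mult)
    have i3: "integrable M (\<lambda>x. fp p (u t x) * \<xi> x)"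
      using K0 by (intro fp_u_mult_integrable[OF t sq_int_measurable[OF \<xi>sq]] AE_I2)
    have "(LINT x:Omega|lebesgue.
            u t x * pds [(1::real, 0 :: real^'n), (1, 0)] (\<lambda>z. \<theta> (fst z) * \<xi> (snd z)) (t, x)
          - u t x * (\<Sum>b\<in>(Basis :: (real^'n) set). pds [(0::real, b), (0, b)] (\<lambda>z. \<theta> (fst z) * \<xi> (snd z)) (t, x))
          + fp p (u t x) * (\<theta> (fst (t, x)) * \<xi> (snd (t, x)))) =
        (LINT x|M. pds [1, 1] \<theta> t * (u t x * \<xi> x) - (\<Sum>b\<in>Basis. \<theta> t * (u t x * pds [b, b] \<xi> x)) + \<theta> t * (fp p (u t x) * \<xi> x))"
      unfolding LINT_lebesgue_on[OF sets_Omega] M_def[symmetric] tensor(2)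
      by (rule Bochner_Integration.integral_cong)
        (simp_all add: tensor(3) sum_distrib_left mult.commute mult.left_commute del: pds.simps)
    also have "\<dots> = pds [1, 1] \<theta> t * ip M (u t) \<xi> - (\<Sum>b\<in>Basis. \<theta> t * ip M (u t) (pds [b, b] \<xi>)) + \<theta> t * (LINT x|M. fp p (u t x) * \<xi> x)"
      using i i3 by (simp add: ip_def del: pds.simps)
    also have "(\<Sum>b\<in>Basis. \<theta> t * ip M (u t) (pds [b, b] \<xi>)) = \<theta> t * (- (\<Sum>b\<in>Basis. ip M (wd Omega [b] (u t)) (pd b \<xi>)))"
    proof -
      have "ip M (u t) (pds [b, b] \<xi>) = - ip M (wd Omega [b] (u t)) (pd b \<xi>)" if b: "b \<in> Basis" for b
        using Hk_wd(1)[OF open_Omega u_H1[OF t], of "[b]"] b test_fun_pd[OF open_Omega \<xi> b]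
        by (simp add: weak_deriv_iff[OF open_Omega] multi_idx_def M_def)
      then show ?thesis by (simp add: sum_distrib_left sum_negf del: pds.simps)
    qed
    finally show ?thesis by (simp add: force_def algebra_simps del: pds.simps)
  qed
  have smt: "smooth \<theta>" by (rule test_fun_smooth[OF op \<theta>])
  have ch: "continuous_on {0..T} ?h"
    by (intro continuous_intros calpha cont continuous_on_subset[OF smooth_continuous[OF smt]]
        continuous_on_subset[OF smooth_continuous[OF smooth_pds[OF smt]]]) auto
  have "0 = (LINT t:{0..T}|lborel. ?h t)"
    using sol[unfolded distr_sol_def, rule_format, OF tensor(1)] inner
    by (subst set_lebesgue_integral_cong[of _ _ _ "\<lambda>t. LINT x:Omega|lebesgue.
            u t x * pds [(1::real, 0 :: real^'n), (1, 0)] (\<lambda>z. \<theta> (fst z) * \<xi> (snd z)) (t, x)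
          - u t x * (\<Sum>b\<in>(Basis :: (real^'n) set). pds [(0::real, b), (0, b)] (\<lambda>z. \<theta> (fst z) * \<xi> (snd z)) (t, x))
          + fp p (u t x) * (\<theta> (fst (t, x)) * \<xi> (snd (t, x)))"]) (auto simp del: pds.simps)
  also have "\<dots> = integral {0..T} ?h"
    using borel_integrable_atLeastAtMost'[OF ch] by (rule set_borel_integral_eq_integral(2))
  finally show "integral {0..T} ?h = 0" by simp
qed

text \<open>For bounded approximating test functions the difference quotient is close to the force
  with an error that does not depend on the index, by equicontinuity. So the limit in the index can
  be taken first, at fixed times, and the limit of the quotient afterwards.\<close>

theorem H10_weak_equation:
  assumes \<xi>: "H10 Omega \<xi>" "AE x in M. \<bar>\<xi> x\<bar> \<le> B" and s: "s \<in> {0..T}"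
  shows "((\<lambda>\<tau>. ip M (ud \<tau>) \<xi>) has_real_derivative force \<xi> (\<lambda>b. wd Omega [b] \<xi>) s) (at s within {0..T})"
proof -
  obtain \<xi>s K0 where x: "\<And>k. test_fun Omega (\<xi>s k)" "\<And>k x. \<bar>\<xi>s k x\<bar> \<le> K0" "L2_lim M \<xi>s \<xi> sequentially"
    "\<And>b. b \<in> Basis \<Longrightarrow> L2_lim M (\<lambda>k. pd b (\<xi>s k)) (wd Omega [b] \<xi>) sequentially"
    "AE x in M. (\<lambda>k. \<xi>s k x) \<longlonglongrightarrow> \<xi> x"
    unfolding M_def using H10_bounded_approx[OF open_Omega \<xi>(1) \<xi>(2)[unfolded M_def]] by blast
  have xsq: "sq_int M (\<xi>s k)" for k unfolding M_def by (rule test_fun_sq_int[OF open_Omega x(1)])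
  have gsq: "sq_int M (pd b (\<xi>s k))" if "b \<in> Basis" for k b
    unfolding M_def by (rule test_fun_sq_int[OF open_Omega test_fun_pd[OF open_Omega x(1) that]])
  \<comment> \<open>Convergent sequences in L2 are bounded, so one \<open>K\<close> dominates all
    approximants and their gradients.\<close>
  have bd: "\<exists>c. \<forall>k. sqrt (ip M (V k) (V k)) \<le> c" if "L2_lim M V v sequentially" for V :: "nat \<Rightarrow> real^'n \<Rightarrow> real" and v
  proof -
    have "convergent (\<lambda>k. sqrt (ip M (V k) (V k)))"
      using tendsto_real_sqrt[OF L2_lim_ip[OF that that]] by (rule convergentI)
    then have "Bseq (\<lambda>k. sqrt (ip M (V k) (V k)))" by (rule convergent_imp_Bseq)
    then obtain c where "\<And>k. norm (sqrt (ip M (V k) (V k))) \<le> c" unfolding Bseq_def by blast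
    then show ?thesis by (intro exI[of _ c]) (auto intro: order_trans[OF abs_ge_self])
  qed
  obtain K1 where K1: "\<And>k. sqrt (ip M (\<xi>s k) (\<xi>s k)) \<le> K1" using bd[OF x(3)] by blast
  have "\<forall>b\<in>Basis. \<exists>c. \<forall>k. sqrt (ip M (pd b (\<xi>s k)) (pd b (\<xi>s k))) \<le> c" using bd[OF x(4)] by blast
  then obtain K2 where K2: "\<And>b k. b \<in> Basis \<Longrightarrow> sqrt (ip M (pd b (\<xi>s k)) (pd b (\<xi>s k))) \<le> K2 b" by metis
  define K where "K = Max (insert \<bar>K0\<bar> (insert K1 (K2 ` Basis)))"
  have K: "\<bar>K0\<bar> \<le> K" "K1 \<le> K" "\<And>b. b \<in> Basis \<Longrightarrow> K2 b \<le> K" unfolding K_def by (rule Max_ge, simp, simp)+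
  have K_nonneg: "K \<ge> 0" using K(1) by linarith
  have flim: "(\<lambda>k. force (\<xi>s k) (\<lambda>b. pd b (\<xi>s k)) s) \<longlonglongrightarrow> force \<xi> (\<lambda>b. wd Omega [b] \<xi>) s"
    unfolding force_def
  proof (intro tendsto_diff tendsto_minus tendsto_sum)
    show "(\<lambda>k. ip M (wd Omega [b] (u s)) (pd b (\<xi>s k))) \<longlonglongrightarrow> ip M (wd Omega [b] (u s)) (wd Omega [b] \<xi>)"
      if "b \<in> Basis" for b by (intro L2_lim_ip L2_lim_const grad_sq s that x(4))
    show "(\<lambda>k. LINT y|M. fp p (u s y) * \<xi>s k y) \<longlonglongrightarrow> (LINT y|M. fp p (u s y) * \<xi> y)"
    proof (rule integral_dominated_convergence[where w = "\<lambda>y. \<bar>K0\<bar> * \<bar>fp p (u s y)\<bar>"])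
      have mf: "(\<lambda>y. fp p (u s y)) \<in> borel_measurable M" using fp_u_integrable[OF s] by auto
      show "(\<lambda>y. fp p (u s y) * \<xi> y) \<in> borel_measurable M"
        by (rule borel_measurable_times[OF mf sq_int_measurable[OF L2_limD(1)[OF x(3)]]])
      show "(\<lambda>y. fp p (u s y) * \<xi>s k y) \<in> borel_measurable M" for k
        by (rule borel_measurable_times[OF mf sq_int_measurable[OF xsq]])
      show "integrable M (\<lambda>y. \<bar>K0\<bar> * \<bar>fp p (u s y)\<bar>)" using fp_u_integrable[OF s] by simp
      show "AE y in M. (\<lambda>k. fp p (u s y) * \<xi>s k y) \<longlonglongrightarrow> fp p (u s y) * \<xi> y"
        using x(5) by eventually_elim (intro tendsto_intros)
      show "AE y in M. norm (fp p (u s y) * \<xi>s k y) \<le> \<bar>K0\<bar> * \<bar>fp p (u s y)\<bar>" for k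
      proof (rule AE_I2)
        fix y
        have "\<bar>\<xi>s k y\<bar> \<le> \<bar>K0\<bar>" using x(2)[of k y] by linarith
        then show "norm (fp p (u s y) * \<xi>s k y) \<le> \<bar>K0\<bar> * \<bar>fp p (u s y)\<bar>"
          by (simp add: abs_mult mult.commute mult_right_mono)
      qed
    qed
  qed
  have udsq: "sq_int M (ud r)" if "r \<in> {0..T}" for r using L2_limD(1)[OF ud_cont[OF that]] .
  have main: "\<exists>d>0. \<forall>r\<in>{0..T}. \<bar>r - s\<bar> < d \<longrightarrow>
      \<bar>ip M (ud r) \<xi> - ip M (ud s) \<xi> - (r - s) * force \<xi> (\<lambda>b. wd Omega [b] \<xi>) s\<bar> \<le> \<delta> * \<bar>r - s\<bar>" if \<delta>: "\<delta> > 0" for \<delta>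
  proof -
    obtain d where d: "d > 0"
      "\<And>r \<xi> g. r \<in> {0..T} \<Longrightarrow> \<bar>r - s\<bar> < d \<Longrightarrow> sq_int M \<xi> \<Longrightarrow> ip M \<xi> \<xi> \<le> K\<^sup>2 \<Longrightarrow>
      AE x in M. \<bar>\<xi> x\<bar> \<le> K \<Longrightarrow> (\<And>b. b \<in> Basis \<Longrightarrow> sq_int M (g b)) \<Longrightarrow>
      (\<And>b. b \<in> Basis \<Longrightarrow> ip M (g b) (g b) \<le> K\<^sup>2) \<Longrightarrow> \<bar>force \<xi> g r - force \<xi> g s\<bar> \<le> \<delta>"
      using force_equicontinuous[OF s \<delta> K_nonneg] by blast
    have "\<bar>ip M (ud r) \<xi> - ip M (ud s) \<xi> - (r - s) * force \<xi> (\<lambda>b. wd Omega [b] \<xi>) s\<bar> \<le> \<delta> * \<bar>r - s\<bar>"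
      if r: "r \<in> {0..T}" "\<bar>r - s\<bar> < d" for r
    proof (rule LIMSEQ_le_const2)
      show "(\<lambda>k. \<bar>ip M (ud r) (\<xi>s k) - ip M (ud s) (\<xi>s k) - (r - s) * force (\<xi>s k) (\<lambda>b. pd b (\<xi>s k)) s\<bar>) \<longlonglongrightarrow>
          \<bar>ip M (ud r) \<xi> - ip M (ud s) \<xi> - (r - s) * force \<xi> (\<lambda>b. wd Omega [b] \<xi>) s\<bar>"
        by (intro tendsto_intros flim L2_lim_ip L2_lim_const udsq r s x(3))
      have "\<bar>ip M (ud r) (\<xi>s k) - ip M (ud s) (\<xi>s k) - (r - s) * force (\<xi>s k) (\<lambda>b. pd b (\<xi>s k)) s\<bar> \<le> \<delta> * \<bar>r - s\<bar>" for k
      proof -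
        \<comment> \<open>Subtracting the linear function of slope \<open>?c s\<close> leaves the
          derivative \<open>?c \<tau> - ?c s\<close>, at most \<delta> on the convex set
          \<open>?S\<close>; the mean value inequality gives the same \<delta> for every k.\<close>
        let ?c = "force (\<xi>s k) (\<lambda>b. pd b (\<xi>s k))" and ?S = "{0..T} \<inter> ball s d"
        let ?f = "\<lambda>\<tau>. ip M (ud \<tau>) (\<xi>s k) - \<tau> * ?c s"
        have "norm (?f r - ?f s) \<le> \<delta> * norm (r - s)"
        proof (rule field_differentiable_bound[of ?S ?f "\<lambda>\<tau>. ?c \<tau> - ?c s"])
          show "convex ?S" by (intro convex_Int convex_ball convex_real_interval)
          show "(?f has_field_derivative ?c \<tau> - ?c s) (at \<tau> within ?S)" if "\<tau> \<in> ?S" for \<tau>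
          proof -
            have "((\<lambda>\<tau>. ip M (ud \<tau>) (\<xi>s k)) has_real_derivative ?c \<tau>) (at \<tau> within {0..T})"
              using test_weak_equation[OF x(1)] that by blast
            then have "((\<lambda>\<tau>. ip M (ud \<tau>) (\<xi>s k)) has_real_derivative ?c \<tau>) (at \<tau> within ?S)"
              by (rule has_field_derivative_subset) auto
            then show ?thesis by (auto intro!: derivative_eq_intros)
          qed
          show "norm (?c \<tau> - ?c s) \<le> \<delta>" if \<tau>: "\<tau> \<in> ?S" for \<tau>
            unfolding real_norm_def
          proof (rule d(2))
            show "\<tau> \<in> {0..T}" "\<bar>\<tau> - s\<bar> < d" using \<tau> by (auto simp: dist_real_def abs_minus_commute)
            show "ip M (\<xi>s k) (\<xi>s k) \<le> K\<^sup>2" using K1[of k] K(2) by (intro sqrt_le_D) linarith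
            show "ip M (pd b (\<xi>s k)) (pd b (\<xi>s k)) \<le> K\<^sup>2" if "b \<in> Basis" for b
              using K2[OF that, of k] K(3)[OF that] by (intro sqrt_le_D) linarith
            show "AE y in M. \<bar>\<xi>s k y\<bar> \<le> K"
            proof (rule AE_I2)
              fix y show "\<bar>\<xi>s k y\<bar> \<le> K" using x(2)[of k y] K(1) by linarith
            qed
          qed (use xsq gsq in auto)
          show "r \<in> ?S" "s \<in> ?S" using r s d(1) by (auto simp: dist_real_def abs_minus_commute)
        qed
        then show ?thesis by (simp add: algebra_simps)
      qed
      then show "\<exists>N. \<forall>k\<ge>N. \<bar>ip M (ud r) (\<xi>s k) - ip M (ud s) (\<xi>s k) - (r - s) * force (\<xi>s k) (\<lambda>b. pd b (\<xi>s k)) s\<bar> \<le> \<delta> * \<bar>r - s\<bar>"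
        by blast
    qed
    then show ?thesis using d(1) by blast
  qed
  show ?thesis
    unfolding has_field_derivative_iff
  proof (rule tendstoI)
    fix e :: real assume "e > 0"
    then have "e / 2 > 0" by simp
    from main[OF this] obtain d where d: "d > 0" "\<And>r. r \<in> {0..T} \<Longrightarrow> \<bar>r - s\<bar> < d \<Longrightarrow>
      \<bar>ip M (ud r) \<xi> - ip M (ud s) \<xi> - (r - s) * force \<xi> (\<lambda>b. wd Omega [b] \<xi>) s\<bar> \<le> e / 2 * \<bar>r - s\<bar>" by blast
    have "dist ((ip M (ud r) \<xi> - ip M (ud s) \<xi>) / (r - s)) (force \<xi> (\<lambda>b. wd Omega [b] \<xi>) s) < e"
      if "r \<in> {0..T}" "r \<noteq> s" "dist r s < d" for r
    proof -
      let ?a = "ip M (ud r) \<xi> - ip M (ud s) \<xi>" and ?c = "force \<xi> (\<lambda>b. wd Omega [b] \<xi>) s"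
      have "?a / (r - s) - ?c = (?a - (r - s) * ?c) / (r - s)" using that by (simp add: diff_divide_distrib)
      then have "\<bar>?a / (r - s) - ?c\<bar> \<le> e / 2"
        using d(2)[of r] that by (simp add: divide_le_eq dist_real_def)
      then show ?thesis using \<open>e > 0\<close> by (simp add: dist_real_def)
    qed
    then show "\<forall>\<^sub>F r in at s within {0..T}. dist ((ip M (ud r) \<xi> - ip M (ud s) \<xi>) / (r - s)) (force \<xi> (\<lambda>b. wd Omega [b] \<xi>) s) < e"
      unfolding eventually_at using d(1) by blast
  qed
qed

end

subsection \<open>Relative energy of a weak and a strong solution\<close>

text \<open>Meant for Taylor remainders divided by \<tau> - t: they are a difference quotient,
  bounded in L2, times a factor that is uniformly small in x.\<close>

lemma L2_lim_small_mult:
  assumes Q: "L2_lim M Q q F" and W: "\<forall>\<^sub>F \<tau> in F. W \<tau> \<in> borel_measurable M"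
    and small: "\<And>e. e > 0 \<Longrightarrow> \<forall>\<^sub>F \<tau> in F. AE x in M. \<bar>W \<tau> x\<bar> \<le> e * \<bar>Q \<tau> x\<bar>"
  shows "L2_lim M W (\<lambda>_. 0) F"
  unfolding L2_lim_def
proof (intro conjI sq_int_zero)
  have sq: "\<forall>\<^sub>F \<tau> in F. sq_int M (Q \<tau>)" using Q by (auto simp: L2_lim_def)
  have "\<forall>\<^sub>F \<tau> in F. AE x in M. \<bar>W \<tau> x\<bar> \<le> 1 * \<bar>Q \<tau> x\<bar>" by (rule small) simp
  with sq W show "\<forall>\<^sub>F \<tau> in F. sq_int M (W \<tau>)"
    by eventually_elim (rule sq_int_bounded_mult)
  show "((\<lambda>\<tau>. LINT x|M. (W \<tau> x - 0)\<^sup>2) \<longlongrightarrow> 0) F"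
  proof (rule tendstoI)
    fix \<epsilon> :: real assume \<epsilon>: "\<epsilon> > 0"
    \<comment> \<open>The squared norms of \<open>Q \<tau>\<close> converge and are therefore
      eventually below N; then \<open>e\<close> is chosen with e^2 N = \<epsilon>/2.\<close>
    define N where "N = ip M q q + 1"
    have N: "N > 0" using ip_self_nonneg[of M q] by (simp add: N_def)
    define e where "e = sqrt (\<epsilon> / (2 * N))"
    have e: "e > 0" "e\<^sup>2 * N = \<epsilon> / 2" using \<epsilon> N by (auto simp: e_def)
    have "\<forall>\<^sub>F \<tau> in F. ip M (Q \<tau>) (Q \<tau>) < N"
      by (rule order_tendstoD(2)[OF L2_lim_ip[OF Q Q]]) (simp add: N_def)
    with small[OF e(1)] sq W show "\<forall>\<^sub>F \<tau> in F. dist (LINT x|M. (W \<tau> x - 0)\<^sup>2) 0 < \<epsilon>"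
    proof eventually_elim
      case (elim \<tau>)
      have sW: "sq_int M (W \<tau>)" by (rule sq_int_bounded_mult[OF elim(2,3,1)])
      have "(LINT x|M. (W \<tau> x)\<^sup>2) \<le> (LINT x|M. e\<^sup>2 * (Q \<tau> x)\<^sup>2)"
      proof (rule integral_mono_AE)
        show "AE x in M. (W \<tau> x)\<^sup>2 \<le> e\<^sup>2 * (Q \<tau> x)\<^sup>2"
          using elim(1)
        proof eventually_elim
          case (elim x)
          then have "\<bar>W \<tau> x\<bar> \<le> \<bar>e * Q \<tau> x\<bar>" using e(1) by (simp add: abs_mult)
          then show ?case by (metis abs_le_square_iff power_mult_distrib)
        qed
      qed (use sW elim(2) in \<open>auto simp: sq_int_def\<close>)
      also have "\<dots> = e\<^sup>2 * ip M (Q \<tau>) (Q \<tau>)" by (simp add: ip_self)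
      also have "\<dots> \<le> e\<^sup>2 * N" using elim(4) by (intro mult_left_mono) auto
      also have "\<dots> < \<epsilon>" using e(2) \<epsilon> by simp
      finally show ?case by (simp add: dist_real_def)
    qed
  qed
qed

lemma DERIV_zero_of_bound:
  fixes q h :: "real \<Rightarrow> real"
  assumes h: "(h has_real_derivative 0) (at t within J)" "h t = 0" "q t = 0"
    and b: "\<forall>\<^sub>F \<tau> in at t within J. \<bar>q \<tau>\<bar> \<le> K * \<bar>h \<tau>\<bar>"
  shows "(q has_real_derivative 0) (at t within J)"
  unfolding has_field_derivative_iff
proof (rule Lim_null_comparison)
  have "((\<lambda>\<tau>. h \<tau> / (\<tau> - t)) \<longlongrightarrow> 0) (at t within J)" using h by (simp add: has_field_derivative_iff)
  then have "((\<lambda>\<tau>. K * \<bar>h \<tau> / (\<tau> - t)\<bar>) \<longlongrightarrow> K * \<bar>0\<bar>) (at t within J)" by (intro tendsto_intros)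
  then show "((\<lambda>\<tau>. K * \<bar>h \<tau> / (\<tau> - t)\<bar>) \<longlongrightarrow> 0) (at t within J)" by simp
  show "\<forall>\<^sub>F \<tau> in at t within J. norm ((q \<tau> - q t) / (\<tau> - t)) \<le> K * \<bar>h \<tau> / (\<tau> - t)\<bar>"
    using b
  proof eventually_elim
    case (elim \<tau>)
    then have "\<bar>q \<tau>\<bar> / \<bar>\<tau> - t\<bar> \<le> K * \<bar>h \<tau>\<bar> / \<bar>\<tau> - t\<bar>" by (intro divide_right_mono) auto
    then show ?case using h(3) by simp
  qed
qed

lemma L2_derivI:
  assumes "\<And>\<tau>. \<tau> \<in> J \<Longrightarrow> sq_int M (V \<tau>)" "t \<in> J"
    and "L2_lim M (\<lambda>\<tau> x. (V \<tau> x - V t x) / (\<tau> - t)) W (at t within J)"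
  shows "L2_deriv M V W t J"
  unfolding L2_deriv_def eventually_at_filter using assms by (auto intro: always_eventually)

text \<open>With the integrating factor exp(-c s) the product has nonpositive derivative and cannot
  increase from its value at 0.\<close>

lemma Gronwall_zero:
  fixes S S' :: "real \<Rightarrow> real"
  assumes der: "\<And>t. t \<in> {0..T} \<Longrightarrow> (S has_real_derivative S' t) (at t within {0..T})"
    and le: "\<And>t. t \<in> {0..T} \<Longrightarrow> S' t \<le> c * S t" and S0: "S 0 \<le> 0" and t: "t \<in> {0..T}"
  shows "S t \<le> 0"
proof -
  let ?E = "\<lambda>s. exp (- c * s) * S s" and ?E' = "\<lambda>s. exp (- c * s) * S' s + (exp (- c * s) * - c) * S s"
  have d: "(?E has_real_derivative ?E' s) (at s within {0..t})" if "s \<in> {0..t}" for s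
  proof -
    have "(S has_real_derivative S' s) (at s within {0..t})"
      using der[of s] that t by (auto intro: has_field_derivative_subset)
    moreover have "((\<lambda>s. exp (- c * s)) has_real_derivative exp (- c * s) * - c) (at s within {0..t})"
      by (auto intro!: derivative_eq_intros)
    ultimately show ?thesis by (rule DERIV_mult'[rotated])
  qed
  have "?E t \<le> ?E 0"
  proof (cases "t = 0")
    case False
    with t have "0 < t" by simp
    have "\<exists>z\<in>{0<..<t}. ?E t - ?E 0 = ?E' z * (t - 0)"
    proof (rule mvt_simple[OF \<open>0 < t\<close>])
      fix s assume "0 \<le> s" "s \<le> t"
      then show "(?E has_derivative (\<lambda>x. ?E' s * x)) (at s within {0..t})"
        using d[of s] by (simp add: has_field_derivative_def)
    qed
    then obtain z where z: "z \<in> {0<..<t}" "?E t - ?E 0 = ?E' z * (t - 0)" by blast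
    have "?E' z = exp (- c * z) * (S' z - c * S z)" by (simp add: algebra_simps)
    also have "\<dots> \<le> 0" using le[of z] z t by (intro mult_nonneg_nonpos) auto
    finally have "?E' z * (t - 0) \<le> 0" using \<open>0 < t\<close> by (intro mult_nonpos_nonneg) auto
    then show ?thesis using z(2) by linarith
  qed simp
  then have "exp (- c * t) * S t \<le> 0" using S0 by simp
  then show ?thesis by (simp add: mult_le_0_iff)
qed

text \<open>The regularity of v enters as sup bounds on v and v_t, differentiability in L2 of v,
  v_t, gradient and Laplacian, and continuity of v in sup norm, which makes f(v) differentiable in
  L2. Both u and v_t lie in H10, so each can be the vanishing factor in Green's formula.\<close>

locale weak_strong = weak_solution p T C u ud M
  for p T C and u ud :: "real \<Rightarrow> real^'n::finite \<Rightarrow> real" and M :: "(real^'n) measure" +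
  fixes v vt vtt :: "real \<Rightarrow> real^'n \<Rightarrow> real" and B :: real
  assumes v_bound: "\<And>t. t \<in> {0..T} \<Longrightarrow> AE x in M. \<bar>v t x\<bar> \<le> B"
    and vt_bound: "\<And>t. t \<in> {0..T} \<Longrightarrow> AE x in M. \<bar>vt t x\<bar> \<le> B"
    and v_sup_cont: "\<And>t e. t \<in> {0..T} \<Longrightarrow> e > 0 \<Longrightarrow>
      \<forall>\<^sub>F \<tau> in at t within {0..T}. AE x in M. \<bar>v \<tau> x - v t x\<bar> \<le> e"
    and v_deriv: "\<And>t. t \<in> {0..T} \<Longrightarrow> L2_deriv M v (vt t) t {0..T}"
    and vt_deriv: "\<And>t. t \<in> {0..T} \<Longrightarrow> L2_deriv M vt (vtt t) t {0..T}"
    and grad_deriv: "\<And>t b. t \<in> {0..T} \<Longrightarrow> b \<in> Basis \<Longrightarrow>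
      L2_deriv M (\<lambda>\<tau>. wd Omega [b] (v \<tau>)) (wd Omega [b] (vt t)) t {0..T}"
    and lap_deriv: "\<And>t. t \<in> {0..T} \<Longrightarrow> L2_deriv M (\<lambda>\<tau>. lap Omega (v \<tau>)) (lap Omega (vt t)) t {0..T}"
    and v_H2: "\<And>t. t \<in> {0..T} \<Longrightarrow> Hk 2 Omega (v t)" and vt_H2: "\<And>t. t \<in> {0..T} \<Longrightarrow> Hk 2 Omega (vt t)"
    and vt_H10: "\<And>t. t \<in> {0..T} \<Longrightarrow> H10 Omega (vt t)"
    and eqn: "\<And>t. t \<in> {0..T} \<Longrightarrow> AE x in M. vtt t x - lap Omega (v t) x + fp p (v t x) = 0"
    and u_H10: "\<And>t. t \<in> {0..T} \<Longrightarrow> H10 Omega (u t)"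
    and init: "AE x in M. u 0 x = v 0 x" "AE x in M. ud 0 x = vt 0 x"
    and energy_ineq: "\<And>t. t \<in> {0..T} \<Longrightarrow> energy p (u t) (ud t) \<le> energy p (u 0) (ud 0)"
begin

lemma sq_facts:
  assumes t: "t \<in> {0..T}"
  shows "sq_int M (ud t)" "sq_int M (v t)" "sq_int M (vt t)" "sq_int M (vtt t)"
    "sq_int M (lap Omega (v t))" "sq_int M (lap Omega (vt t))"
    "\<And>b. b \<in> Basis \<Longrightarrow> sq_int M (wd Omega [b] (v t))"
    "\<And>b. b \<in> Basis \<Longrightarrow> sq_int M (wd Omega [b] (vt t))"
  using L2_limD(1)[OF ud_cont[OF t]] v_deriv[OF t] vt_deriv[OF t] lap_deriv[OF t] grad_deriv[OF t]
  by (auto simp: L2_deriv_def L2_lim_def)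

lemma fv_sq:
  assumes t: "t \<in> {0..T}" shows "sq_int M (\<lambda>x. fp p (v t x))"
proof (rule sq_int_bounded_mult[OF sq_facts(2)[OF t]])
  show "(\<lambda>x. fp p (v t x)) \<in> borel_measurable M"
    by (rule fp_measurable[OF sq_int_measurable[OF sq_facts(2)[OF t]]])
  show "AE x in M. \<bar>fp p (v t x)\<bar> \<le> B powr (p - 1) * \<bar>v t x\<bar>"
    using v_bound[OF t] by eventually_elim (use p in \<open>auto intro: abs_fp_linear\<close>)
qed

lemma f'v_sq:
  assumes t: "t \<in> {0..T}" shows "sq_int M (\<lambda>x. fp' p (v t x) * vt t x)"
proof (rule sq_int_bounded_mult[OF sq_facts(3)[OF t]])
  show "(\<lambda>x. fp' p (v t x) * vt t x) \<in> borel_measurable M"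
    using sq_facts[OF t] by (intro borel_measurable_times fp'_measurable) (auto dest: sq_int_measurable)
  show "AE x in M. \<bar>fp' p (v t x) * vt t x\<bar> \<le> (p * B powr (p - 1)) * \<bar>vt t x\<bar>"
    using v_bound[OF t]
  proof eventually_elim
    case (elim x)
    then have "\<bar>fp' p (v t x)\<bar> \<le> p * B powr (p - 1)" using p by (intro fp'_bound) auto
    then show ?case by (simp add: abs_mult mult_right_mono)
  qed
qed

text \<open>The quotient of f(v) is f'(v) times the quotient of v, with f'(v) bounded, plus a Taylor
  remainder of at most a constant times |v(\<tau>) - v(t)| times the quotient. Here the first factor
  tends to 0 uniformly in x.\<close>

lemma fv_deriv:
  assumes t: "t \<in> {0..T}"
  shows "L2_deriv M (\<lambda>\<tau> x. fp p (v \<tau> x)) (\<lambda>x. fp' p (v t x) * vt t x) t {0..T}"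
proof (rule L2_derivI[OF fv_sq t])
  let ?F = "at t within {0..T}"
  let ?Q = "\<lambda>\<tau> x. (v \<tau> x - v t x) / (\<tau> - t)"
  let ?rem = "\<lambda>\<tau> x. (fp p (v \<tau> x) - fp p (v t x) - fp' p (v t x) * (v \<tau> x - v t x)) / (\<tau> - t)"
  have J: "\<forall>\<^sub>F \<tau> in ?F. \<tau> \<in> {0..T}" by (simp add: eventually_at_filter)
  have Q: "L2_lim M ?Q (vt t) ?F" using v_deriv[OF t] by (simp add: L2_deriv_def)
  have mv: "v \<tau> \<in> borel_measurable M" if "\<tau> \<in> {0..T}" for \<tau> using sq_facts(2)[OF that] by (rule sq_int_measurable)
  have 1: "L2_lim M (\<lambda>\<tau> x. fp' p (v t x) * ?Q \<tau> x) (\<lambda>x. fp' p (v t x) * vt t x) ?F"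
  proof (rule L2_lim_bounded_mult[OF Q _ sq_int_measurable[OF f'v_sq[OF t]] _ f'v_sq[OF t]])
    show "\<forall>\<^sub>F \<tau> in ?F. (\<lambda>x. fp' p (v t x) * ?Q \<tau> x) \<in> borel_measurable M"
      using J
    proof eventually_elim
      case (elim \<tau>)
      show ?case using mv[OF elim] mv[OF t]
        by (intro borel_measurable_times borel_measurable_divide borel_measurable_diff fp'_measurable) auto
    qed
    have ev: "AE x in M. \<bar>fp' p (v t x) * ?Q \<tau> x - fp' p (v t x) * vt t x\<bar> \<le> (p * B powr (p - 1)) * \<bar>?Q \<tau> x - vt t x\<bar>" for \<tau>
      using v_bound[OF t]
    proof eventually_elim
      case (elim x)
      then have "\<bar>fp' p (v t x)\<bar> \<le> p * B powr (p - 1)" using p by (intro fp'_bound) auto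
      then show ?case unfolding right_diff_distrib[symmetric] abs_mult by (intro mult_right_mono) auto
    qed
    show "\<forall>\<^sub>F \<tau> in ?F. AE x in M. \<bar>fp' p (v t x) * ?Q \<tau> x - fp' p (v t x) * vt t x\<bar> \<le> (p * B powr (p - 1)) * \<bar>?Q \<tau> x - vt t x\<bar>"
      by (rule always_eventually, rule allI, rule ev)
  qed
  have 2: "L2_lim M ?rem (\<lambda>_. 0) ?F"
  proof (rule L2_lim_small_mult[OF Q])
    show "\<forall>\<^sub>F \<tau> in ?F. ?rem \<tau> \<in> borel_measurable M"
      using J
    proof eventually_elim
      case (elim \<tau>)
      show ?case using mv[OF elim] mv[OF t]
        by (intro borel_measurable_times borel_measurable_divide borel_measurable_diff fp_measurable fp'_measurable) auto
    qed
    fix e :: real assume e: "e > 0"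
    \<comment> \<open>The summand 1 keeps \<open>K\<close> positive, so that \<epsilon>/K makes
      sense even if the power of B vanishes.\<close>
    define K where "K = p * (p - 1) * B powr (p - 2) + 1"
    have K: "K > 0" using p by (simp add: K_def add_nonneg_pos)
    have "e / K > 0" using e K by simp
    from v_sup_cont[OF t this] J show "\<forall>\<^sub>F \<tau> in ?F. AE x in M. \<bar>?rem \<tau> x\<bar> \<le> e * \<bar>?Q \<tau> x\<bar>"
    proof eventually_elim
      case (elim \<tau>)
      from elim(1) v_bound[OF t] v_bound[OF elim(2)] show ?case
      proof eventually_elim
        case (elim x)
        let ?d = "\<bar>v \<tau> x - v t x\<bar>"
        have "\<bar>fp p (v \<tau> x) - fp p (v t x) - fp' p (v t x) * (v \<tau> x - v t x)\<bar> \<le> p * (p - 1) * B powr (p - 2) * (v \<tau> x - v t x)\<^sup>2"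
          using elim p by (intro fp_Taylor) auto
        also have "\<dots> \<le> K * (v \<tau> x - v t x)\<^sup>2" by (intro mult_right_mono) (auto simp: K_def)
        also have "\<dots> = K * ?d * ?d" by (simp add: power2_eq_square flip: abs_mult)
        also have "\<dots> \<le> e * ?d"
          using elim(1) K by (intro mult_right_mono) (auto simp: pos_le_divide_eq mult.commute)
        finally have "\<bar>fp p (v \<tau> x) - fp p (v t x) - fp' p (v t x) * (v \<tau> x - v t x)\<bar> / \<bar>\<tau> - t\<bar> \<le> e * ?d / \<bar>\<tau> - t\<bar>"
          by (rule divide_right_mono) simp
        then show ?case by simp
      qed
    qed
  qed
  have "(fp p (v \<tau> x) - fp p (v t x)) / (\<tau> - t) = fp' p (v t x) * ?Q \<tau> x + ?rem \<tau> x" for \<tau> x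
    by (simp add: add_divide_distrib[symmetric])
  then show "L2_lim M (\<lambda>\<tau> x. (fp p (v \<tau> x) - fp p (v t x)) / (\<tau> - t)) (\<lambda>x. fp' p (v t x) * vt t x) ?F"
    using L2_lim_add[OF 1 2] by simp
qed

lemma Fv_integrable:
  assumes t: "t \<in> {0..T}" shows "integrable M (\<lambda>x. Fp p (v t x))"
proof (rule Bochner_Integration.integrable_bound)
  show "integrable M (\<lambda>x. B powr (p - 1) * (v t x)\<^sup>2)" using sq_facts(2)[OF t] by (simp add: sq_int_def)
  show "(\<lambda>x. Fp p (v t x)) \<in> borel_measurable M"
    by (rule Fp_measurable[OF sq_int_measurable[OF sq_facts(2)[OF t]]])
  show "AE x in M. norm (Fp p (v t x)) \<le> norm (B powr (p - 1) * (v t x)\<^sup>2)"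
    using v_bound[OF t]
  proof eventually_elim
    case (elim x)
    then have "\<bar>Fp p (v t x)\<bar> \<le> B powr (p - 1) * (v t x)\<^sup>2" using p by (intro Fp_quadratic) auto
    then show ?case by simp
  qed
qed

lemma Fu_integrable: "t \<in> {0..T} \<Longrightarrow> integrable M (\<lambda>x. Fp p (u t x))"
  using Lp(1) unfolding Fp_def by simp

text \<open>The first-order remainder of F(v(\<tau>)) at v(t) is the Bregman divergence, bounded by
  a multiple of (v(\<tau>) - v(t))^2. The integral of that square has derivative 0 at t, so only the
  linear term contributes.\<close>

lemma Fv_deriv:
  assumes t: "t \<in> {0..T}"
  shows "((\<lambda>\<tau>. LINT x|M. Fp p (v \<tau> x)) has_real_derivative ip M (vt t) (\<lambda>x. fp p (v t x))) (at t within {0..T})"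
proof -
  let ?F = "at t within {0..T}"
  define q where "q \<tau> = (LINT x|M. Gp p (v \<tau> x) (v t x))" for \<tau>
  define h where "h \<tau> = ip M (\<lambda>x. v \<tau> x - v t x) (\<lambda>x. v \<tau> x - v t x)" for \<tau>
  have vsq: "sq_int M (v \<tau>)" if "\<tau> \<in> {0..T}" for \<tau> using sq_facts(2)[OF that] .
  have J: "\<forall>\<^sub>F \<tau> in ?F. \<tau> \<in> {0..T}" by (simp add: eventually_at_filter)
  have "L2_deriv M (\<lambda>_. v t) (\<lambda>_. 0) t {0..T}"
    using vsq[OF t] by (auto simp: L2_deriv_def intro: L2_lim_const sq_int_zero)
  from L2_deriv_diff[OF v_deriv[OF t] this]
  have D: "L2_deriv M (\<lambda>\<tau> x. v \<tau> x - v t x) (vt t) t {0..T}" by simp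
  have hd: "(h has_real_derivative 0) ?F"
    using L2_deriv_ip[OF D D] unfolding h_def[abs_def] by (simp add: ip_def)
  have h0: "h t = 0" "q t = 0" by (auto simp: h_def q_def ip_def Gp_def)
  have Gi: "integrable M (\<lambda>x. Gp p (v \<tau> x) (v t x))" if \<tau>: "\<tau> \<in> {0..T}" for \<tau>
    unfolding Gp_def using Fv_integrable[OF \<tau>] Fv_integrable[OF t]
    by (intro Bochner_Integration.integrable_diff sq_int_mult fv_sq[OF t] sq_int_diff vsq t \<tau>)
  have bd: "\<forall>\<^sub>F \<tau> in ?F. \<bar>q \<tau>\<bar> \<le> (p * B powr (p - 1)) * \<bar>h \<tau>\<bar>"
    using J
  proof eventually_elim
    case (elim \<tau>)
    have dsq: "sq_int M (\<lambda>x. v \<tau> x - v t x)" by (intro sq_int_diff vsq elim t)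
    have "\<bar>q \<tau>\<bar> \<le> (LINT x|M. \<bar>Gp p (v \<tau> x) (v t x)\<bar>)" unfolding q_def by (rule integral_abs_bound)
    also have "\<dots> \<le> (LINT x|M. (p * B powr (p - 1)) * (v \<tau> x - v t x)\<^sup>2)"
    proof (rule integral_mono_AE)
      show "integrable M (\<lambda>x. \<bar>Gp p (v \<tau> x) (v t x)\<bar>)" using Gi[OF elim] by (rule integrable_abs)
      show "integrable M (\<lambda>x. (p * B powr (p - 1)) * (v \<tau> x - v t x)\<^sup>2)"
        using dsq by (simp add: sq_int_def)
      show "AE x in M. \<bar>Gp p (v \<tau> x) (v t x)\<bar> \<le> (p * B powr (p - 1)) * (v \<tau> x - v t x)\<^sup>2"
        using v_bound[OF t] v_bound[OF elim] by eventually_elim (use p in \<open>auto intro: Gp_le_square\<close>)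
    qed
    also have "\<dots> = (p * B powr (p - 1)) * \<bar>h \<tau>\<bar>" unfolding h_def ip_self by simp
    finally show ?case .
  qed
  have q: "(q has_real_derivative 0) ?F" by (rule DERIV_zero_of_bound[OF hd h0 bd])
  have "((\<lambda>\<tau>. q \<tau> + ip M (v \<tau>) (\<lambda>x. fp p (v t x)) + ((LINT x|M. Fp p (v t x)) - ip M (v t) (\<lambda>x. fp p (v t x))))
      has_real_derivative 0 + ip M (vt t) (\<lambda>x. fp p (v t x)) + 0) ?F"
    by (intro DERIV_add q L2_deriv_ip_const v_deriv t fv_sq DERIV_const)
  then have "((\<lambda>\<tau>. q \<tau> + ip M (v \<tau>) (\<lambda>x. fp p (v t x)) + ((LINT x|M. Fp p (v t x)) - ip M (v t) (\<lambda>x. fp p (v t x))))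
      has_real_derivative ip M (vt t) (\<lambda>x. fp p (v t x))) ?F" by simp
  then show ?thesis
  proof (rule has_field_derivative_transform_within[of _ _ _ _ 1])
    fix \<tau> assume \<tau>: "\<tau> \<in> {0..T}"
    have "q \<tau> = (LINT x|M. Fp p (v \<tau> x)) - (LINT x|M. Fp p (v t x)) - ip M (\<lambda>x. fp p (v t x)) (\<lambda>x. v \<tau> x - v t x)"
      unfolding q_def Gp_def ip_def
      using Fv_integrable[OF \<tau>] Fv_integrable[OF t] sq_int_mult[OF fv_sq[OF t] sq_int_diff[OF vsq[OF \<tau>] vsq[OF t]]]
      by simp
    also have "ip M (\<lambda>x. fp p (v t x)) (\<lambda>x. v \<tau> x - v t x) = ip M (v \<tau>) (\<lambda>x. fp p (v t x)) - ip M (v t) (\<lambda>x. fp p (v t x))"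
      using vsq[OF \<tau>] vsq[OF t] fv_sq[OF t] by (simp add: ip_diff_right ip_commute)
    finally show "q \<tau> + ip M (v \<tau>) (\<lambda>x. fp p (v t x)) + ((LINT x|M. Fp p (v t x)) - ip M (v t) (\<lambda>x. fp p (v t x))) = (LINT x|M. Fp p (v \<tau> x))"
      by simp
  qed (use t in auto)
qed

definition kin :: "(real^'n \<Rightarrow> real) \<Rightarrow> (real^'n \<Rightarrow> real) \<Rightarrow> real" where
  "kin a b = (\<Sum>i\<in>Basis. ip M (wd Omega [i] a) (wd Omega [i] b))"

lemma energy_eq:
  assumes t: "t \<in> {0..T}"
  shows "energy p (u t) (ud t) = (ip M (ud t) (ud t) + kin (u t) (u t)) / 2 + (LINT x|M. Fp p (u t x))"
proof -
  have "integrable M (\<lambda>x. (ud t x)\<^sup>2)" "\<And>b. b \<in> Basis \<Longrightarrow> integrable M (\<lambda>x. (wd Omega [b] (u t) x)\<^sup>2)"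
    using sq_facts(1)[OF t] grad_sq[OF t] by (auto simp: sq_int_def)
  then have "(LINT x|M. (ud t x)\<^sup>2 + (\<Sum>b\<in>Basis. (wd Omega [b] (u t) x)\<^sup>2)) = ip M (ud t) (ud t) + kin (u t) (u t)"
    by (simp add: ip_self kin_def)
  then show ?thesis
    unfolding energy_def LINT_lebesgue_on[OF sets_Omega] M_def[symmetric] Fp_def by simp
qed

lemma kin_Green_u: "t \<in> {0..T} \<Longrightarrow> Hk 2 Omega a \<Longrightarrow> kin (u t) a = - ip M (u t) (lap Omega a)"
  unfolding kin_def M_def by (rule Green_H10[OF open_Omega u_H10])

lemma kin_Green_vt: "t \<in> {0..T} \<Longrightarrow> Hk 2 Omega a \<Longrightarrow> kin (vt t) a = - ip M (vt t) (lap Omega a)"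
  unfolding kin_def M_def by (rule Green_H10[OF open_Omega vt_H10])

text \<open>What remains of the relative energy when E(u(t)) is replaced by E(u(0)). The mixed
  gradient term appears as <u, \<Delta>v> by Green's formula: the gradient of u is only continuous
  in time, whereas u and \<Delta>v are differentiable in L2.\<close>

definition relative :: "real \<Rightarrow> real" where
  "relative t = energy p (u 0) (ud 0) + (ip M (vt t) (vt t) + kin (v t) (v t)) / 2 - ip M (ud t) (vt t)
     + ip M (u t) (lap Omega (v t)) - (LINT x|M. Fp p (v t x)) - ip M (\<lambda>x. u t x - v t x) (\<lambda>x. fp p (v t x))"

lemma w_deriv: "t \<in> {0..T} \<Longrightarrow> L2_deriv M (\<lambda>\<tau> x. u \<tau> x - v \<tau> x) (\<lambda>x. ud t x - vt t x) t {0..T}"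
  by (intro L2_deriv_diff u_deriv v_deriv)

lemma G_integrable:
  assumes t: "t \<in> {0..T}" shows "integrable M (\<lambda>x. Gp p (u t x) (v t x))"
  unfolding Gp_def using Fu_integrable[OF t] Fv_integrable[OF t]
  by (intro Bochner_Integration.integrable_diff sq_int_mult fv_sq sq_int_diff u_sq sq_facts(2) t)

lemma relative_energy_le:
  assumes t: "t \<in> {0..T}"
  shows "ip M (\<lambda>x. ud t x - vt t x) (\<lambda>x. ud t x - vt t x) / 2 + (LINT x|M. Gp p (u t x) (v t x)) \<le> relative t"
proof -
  \<comment> \<open>Of the gradient of w only the sign of its squared norm is kept; expanding it
    trades \<open>kin (u t) (u t)\<close> in the energy of u for terms that can be
    differentiated.\<close>
  have "0 \<le> (\<Sum>i\<in>Basis. ip M (\<lambda>x. wd Omega [i] (u t) x - wd Omega [i] (v t) x) (\<lambda>x. wd Omega [i] (u t) x - wd Omega [i] (v t) x))"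
    by (intro sum_nonneg ip_self_nonneg)
  also have "\<dots> = (\<Sum>i\<in>Basis. ip M (wd Omega [i] (u t)) (wd Omega [i] (u t)) + ip M (wd Omega [i] (v t)) (wd Omega [i] (v t))
      - 2 * ip M (wd Omega [i] (u t)) (wd Omega [i] (v t)))"
  proof (rule sum.cong[OF refl])
    fix i :: "real^'n" assume i: "i \<in> Basis"
    show "ip M (\<lambda>x. wd Omega [i] (u t) x - wd Omega [i] (v t) x) (\<lambda>x. wd Omega [i] (u t) x - wd Omega [i] (v t) x) =
      ip M (wd Omega [i] (u t)) (wd Omega [i] (u t)) + ip M (wd Omega [i] (v t)) (wd Omega [i] (v t))
      - 2 * ip M (wd Omega [i] (u t)) (wd Omega [i] (v t))"
      using grad_sq[OF t i] sq_facts(7)[OF t i]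
      by (simp add: ip_diff_left ip_diff_right sq_int_diff ip_commute[of M "wd Omega [i] (v t)" "wd Omega [i] (u t)"])
  qed
  also have "\<dots> = kin (u t) (u t) + kin (v t) (v t) - 2 * kin (u t) (v t)"
    by (simp add: kin_def sum.distrib sum_subtractf sum_distrib_left)
  finally have k: "0 \<le> kin (u t) (u t) + kin (v t) (v t) + 2 * ip M (u t) (lap Omega (v t))"
    using kin_Green_u[OF t v_H2[OF t]] by simp
  have w: "ip M (\<lambda>x. ud t x - vt t x) (\<lambda>x. ud t x - vt t x) = ip M (ud t) (ud t) + ip M (vt t) (vt t) - 2 * ip M (ud t) (vt t)"
    using sq_facts[OF t] by (simp add: ip_diff_left ip_diff_right sq_int_diff ip_commute[of M "vt t" "ud t"])
  have G: "(LINT x|M. Gp p (u t x) (v t x)) = (LINT x|M. Fp p (u t x)) - (LINT x|M. Fp p (v t x)) - ip M (\<lambda>x. u t x - v t x) (\<lambda>x. fp p (v t x))"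
    unfolding Gp_def ip_commute[of M "\<lambda>x. u t x - v t x"] unfolding ip_def
    using Fu_integrable[OF t] Fv_integrable[OF t] sq_int_mult[OF fv_sq[OF t] sq_int_diff[OF u_sq[OF t] sq_facts(2)[OF t]]]
    by simp
  show ?thesis
    using energy_ineq[OF t] k unfolding energy_eq[OF t] w G relative_def by (simp add: field_simps)
qed

lemma relative_0: "relative 0 = 0"
proof -
  have 0: "0 \<in> {0..T}" using T by simp
  note sq = sq_facts[OF 0] u_sq[OF 0]
  note m = sq(1-5,9)[THEN sq_int_measurable] sq_int_measurable[OF fv_sq[OF 0]]
  have ud: "ip M (ud 0) a = ip M (vt 0) a" if "a \<in> borel_measurable M" for a
    using init(2) m that by (intro ip_cong_AE) auto
  have uu: "ip M (u 0) a = ip M (v 0) a" if "a \<in> borel_measurable M" for a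
    using init(1) m that by (intro ip_cong_AE) auto
  have w: "ip M (\<lambda>x. u 0 x - v 0 x) (\<lambda>x. fp p (v 0 x)) = 0"
    using uu[OF m(7)] sq fv_sq[OF 0] by (simp add: ip_diff_left)
  have F: "(LINT x|M. Fp p (u 0 x)) = (LINT x|M. Fp p (v 0 x))"
  proof (rule integral_cong_AE)
    show "AE x in M. Fp p (u 0 x) = Fp p (v 0 x)" using init(1) by eventually_elim simp
  qed (use m in \<open>auto intro: Fp_measurable\<close>)
  \<comment> \<open>The data agree almost everywhere only and \<open>wd\<close> chooses a
    representative for each function, so the gradients are compared through uniqueness of weak
    derivatives.\<close>
  have g: "AE x in M. wd Omega [i] (u 0) x = wd Omega [i] (v 0) x" if i: "i \<in> Basis" for i
    unfolding M_def
  proof (rule wd_cong_AE[OF open_Omega u_H1[OF 0]])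
    show "Hk 1 Omega (v 0)" using v_H2[OF 0] by (auto simp: Hk_def multi_idx_def)
    show "[i] \<in> multi_idx 1" using i by (simp add: multi_idx_def)
    show "AE x in lebesgue_on Omega. u 0 x = v 0 x" using init(1) unfolding M_def .
  qed
  have mg: "wd Omega [i] (u 0) \<in> borel_measurable M" "wd Omega [i] (v 0) \<in> borel_measurable M" if "i \<in> Basis" for i
    using grad_sq[OF 0 that] sq_facts(7)[OF 0 that] by (auto dest: sq_int_measurable)
  have k: "kin (u 0) (u 0) = kin (v 0) (v 0)" "kin (u 0) (v 0) = kin (v 0) (v 0)"
    unfolding kin_def using g mg by (auto intro!: sum.cong ip_cong_AE)
  have "ip M (ud 0) (ud 0) = ip M (vt 0) (vt 0)" using ud[of "ud 0"] ud[of "vt 0"] m by (simp add: ip_commute)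
  then show ?thesis
    unfolding relative_def energy_eq[OF 0] w F k(1) ud[OF m(3)]
    using kin_Green_u[OF 0 v_H2[OF 0]] k(2) by (simp add: field_simps)
qed

definition remainder :: "real \<Rightarrow> real" where
  "remainder t = (LINT x|M. (fp p (u t x) - fp p (v t x) - fp' p (v t x) * (u t x - v t x)) * vt t x)"

text \<open>Inserting v_tt = \<Delta>v - f(v) and the weak equation of u, all Laplacian terms cancel
  in pairs. What is left is f(u) v_t from the force term, -f(v) v_t, and -f'(v) v_t w from
  differentiating f(v): the first-order remainder of f tested with v_t.\<close>

lemma relative_deriv:
  assumes t: "t \<in> {0..T}"
  shows "(relative has_real_derivative remainder t) (at t within {0..T})"
proof -
  let ?F = "at t within {0..T}" and ?f = "\<lambda>x. fp p (v t x)" and ?w = "\<lambda>x. u t x - v t x" and ?f' = "\<lambda>x. fp' p (v t x) * vt t x"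
  let ?I = "LINT x|M. fp p (u t x) * vt t x"
  note sq = sq_facts[OF t] u_sq[OF t] fv_sq[OF t] f'v_sq[OF t]
  have d1: "((\<lambda>\<tau>. ip M (vt \<tau>) (vt \<tau>)) has_real_derivative ip M (vtt t) (vt t) + ip M (vt t) (vtt t)) ?F"
    by (intro L2_deriv_ip vt_deriv t)
  have d2: "((\<lambda>\<tau>. kin (v \<tau>) (v \<tau>)) has_real_derivative kin (vt t) (v t) + kin (v t) (vt t)) ?F"
    unfolding kin_def sum.distrib[symmetric] by (intro DERIV_sum L2_deriv_ip grad_deriv t)
  have d3: "((\<lambda>\<tau>. ip M (ud \<tau>) (vt \<tau>)) has_real_derivative force (vt t) (\<lambda>b. wd Omega [b] (vt t)) t + ip M (ud t) (vtt t)) ?F"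
    by (rule ip_product_rule[OF ud_cont[OF t] vt_deriv[OF t] H10_weak_equation[OF vt_H10[OF t] vt_bound[OF t] t]])
  have d4: "((\<lambda>\<tau>. ip M (u \<tau>) (lap Omega (v \<tau>))) has_real_derivative ip M (ud t) (lap Omega (v t)) + ip M (u t) (lap Omega (vt t))) ?F"
    by (intro L2_deriv_ip u_deriv lap_deriv t)
  have d5: "((\<lambda>\<tau>. ip M (\<lambda>x. u \<tau> x - v \<tau> x) (\<lambda>x. fp p (v \<tau> x))) has_real_derivative
      ip M (\<lambda>x. ud t x - vt t x) ?f + ip M ?w ?f') ?F"
    by (intro L2_deriv_ip w_deriv fv_deriv t)
  have "(relative has_real_derivative
      0 + ((ip M (vtt t) (vt t) + ip M (vt t) (vtt t)) + (kin (vt t) (v t) + kin (v t) (vt t))) / 2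
      - (force (vt t) (\<lambda>b. wd Omega [b] (vt t)) t + ip M (ud t) (vtt t))
      + (ip M (ud t) (lap Omega (v t)) + ip M (u t) (lap Omega (vt t)))
      - ip M (vt t) ?f - (ip M (\<lambda>x. ud t x - vt t x) ?f + ip M ?w ?f')) ?F"
    unfolding relative_def[abs_def]
    by (intro DERIV_diff DERIV_add DERIV_const DERIV_cdivide d1 d2 d3 d4 d5 Fv_deriv t)
  also have "0 + ((ip M (vtt t) (vt t) + ip M (vt t) (vtt t)) + (kin (vt t) (v t) + kin (v t) (vt t))) / 2
      - (force (vt t) (\<lambda>b. wd Omega [b] (vt t)) t + ip M (ud t) (vtt t))
      + (ip M (ud t) (lap Omega (v t)) + ip M (u t) (lap Omega (vt t)))
      - ip M (vt t) ?f - (ip M (\<lambda>x. ud t x - vt t x) ?f + ip M ?w ?f') = ?I - ip M (vt t) ?f - ip M ?w ?f'"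
  proof -
    have vtt: "ip M a (vtt t) = ip M a (lap Omega (v t)) - ip M a ?f" if a: "sq_int M a" for a
    proof -
      have "ip M a (vtt t) = ip M a (\<lambda>x. lap Omega (v t) x - ?f x)"
      proof (rule ip_cong_AE)
        show "AE x in M. vtt t x = lap Omega (v t) x - ?f x" using eqn[OF t] by eventually_elim simp
      qed (use a sq in \<open>auto dest: sq_int_measurable intro: borel_measurable_diff\<close>)
      then show ?thesis using a sq by (simp add: ip_diff_right)
    qed
    have kin_sym: "kin (v t) (vt t) = kin (vt t) (v t)" unfolding kin_def by (simp add: ip_commute)
    have fo: "force (vt t) (\<lambda>b. wd Omega [b] (vt t)) t = ip M (u t) (lap Omega (vt t)) - ?I"
      using kin_Green_u[OF t vt_H2[OF t]] unfolding force_def kin_def by simp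
    show ?thesis
      unfolding kin_sym fo kin_Green_vt[OF t v_H2[OF t]] ip_commute[of M "vtt t"]
        vtt[OF sq(3)] vtt[OF sq(1)] ip_diff_left[OF sq(1) sq(3) sq(10)]
      by simp
  qed
  also have "?I - ip M (vt t) ?f - ip M ?w ?f' = remainder t"
  proof -
    have wsq: "sq_int M ?w" by (intro sq_int_diff sq)
    have i: "integrable M (\<lambda>x. fp p (u t x) * vt t x)" "integrable M (\<lambda>x. vt t x * ?f x)" "integrable M (\<lambda>x. ?w x * ?f' x)"
      using fp_u_mult_integrable[OF t sq_int_measurable[OF sq(3)] vt_bound[OF t]] sq_int_mult[OF sq(3) sq(10)] sq_int_mult[OF wsq sq(11)] by auto
    have "remainder t = (LINT x|M. fp p (u t x) * vt t x - vt t x * ?f x - ?w x * ?f' x)"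
      unfolding remainder_def by (rule Bochner_Integration.integral_cong) (auto simp: algebra_simps)
    also have "\<dots> = ?I - ip M (vt t) ?f - ip M ?w ?f'" using i by (simp add: ip_def)
    finally show ?thesis by simp
  qed
  finally show ?thesis .
qed

theorem uniqueness:
  assumes t: "t \<in> {0..T}" shows "AE x in M. u t x = v t x"
proof -
  obtain A where A: "A \<ge> 0"
    "\<And>a b. \<bar>b\<bar> \<le> B \<Longrightarrow> \<bar>fp p a - fp p b - fp' p b * (a - b)\<bar> \<le> A * ((a - b)\<^sup>2 + Gp p a b)"
    using fp_remainder_bound[OF p] by metis
  \<comment> \<open>A nonnegative bound for v_t, so that the product \<open>A * b\<close> below is
    monotone in the other factor.\<close>
  define b where "b = max B 0"
  define z where "z \<tau> = ip M (\<lambda>x. u \<tau> x - v \<tau> x) (\<lambda>x. u \<tau> x - v \<tau> x)" for \<tau>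
  define G where "G \<tau> = (LINT x|M. Gp p (u \<tau> x) (v \<tau> x))" for \<tau>
  define y where "y \<tau> = ip M (\<lambda>x. ud \<tau> x - vt \<tau> x) (\<lambda>x. ud \<tau> x - vt \<tau> x)" for \<tau>
  have wsq: "sq_int M (\<lambda>x. u \<tau> x - v \<tau> x)" "sq_int M (\<lambda>x. ud \<tau> x - vt \<tau> x)" if "\<tau> \<in> {0..T}" for \<tau>
    by (intro sq_int_diff u_sq sq_facts that)+
  have nn: "z \<tau> \<ge> 0" "y \<tau> \<ge> 0" "G \<tau> \<ge> 0" for \<tau>
    using p by (auto simp: z_def y_def G_def ip_self_nonneg Gp_nonneg)
  have yG: "y \<tau> / 2 + G \<tau> \<le> relative \<tau>" if "\<tau> \<in> {0..T}" for \<tau>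
    using relative_energy_le[OF that] by (simp add: y_def G_def)
  have rem: "remainder \<tau> \<le> A * b * (z \<tau> + G \<tau>)" if \<tau>: "\<tau> \<in> {0..T}" for \<tau>
  proof -
    have zi: "integrable M (\<lambda>x. (u \<tau> x - v \<tau> x)\<^sup>2)" using wsq(1)[OF \<tau>] by (simp add: sq_int_def)
    have ri: "integrable M (\<lambda>x. A * b * ((u \<tau> x - v \<tau> x)\<^sup>2 + Gp p (u \<tau> x) (v \<tau> x)))"
      using zi G_integrable[OF \<tau>] by simp
    have "remainder \<tau> \<le> (LINT x|M. A * b * ((u \<tau> x - v \<tau> x)\<^sup>2 + Gp p (u \<tau> x) (v \<tau> x)))"
      unfolding remainder_def
    \<comment> \<open>Under a nonnegative majorant only the majorant has to be integrable.\<close>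
    proof (rule integral_mono_AE')
      show "AE x in M. (fp p (u \<tau> x) - fp p (v \<tau> x) - fp' p (v \<tau> x) * (u \<tau> x - v \<tau> x)) * vt \<tau> x \<le>
          A * b * ((u \<tau> x - v \<tau> x)\<^sup>2 + Gp p (u \<tau> x) (v \<tau> x))"
        using v_bound[OF \<tau>] vt_bound[OF \<tau>]
      proof eventually_elim
        case (elim x)
        let ?r = "fp p (u \<tau> x) - fp p (v \<tau> x) - fp' p (v \<tau> x) * (u \<tau> x - v \<tau> x)"
        have "?r * vt \<tau> x \<le> \<bar>?r\<bar> * \<bar>vt \<tau> x\<bar>" by (metis abs_ge_self abs_mult)
        also have "\<dots> \<le> (A * ((u \<tau> x - v \<tau> x)\<^sup>2 + Gp p (u \<tau> x) (v \<tau> x))) * b"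
          using A elim Gp_nonneg[of p "u \<tau> x" "v \<tau> x"] p by (intro mult_mono) (auto simp: b_def)
        finally show ?case by (simp add: mult.commute mult.left_commute)
      qed
      show "AE x in M. 0 \<le> A * b * ((u \<tau> x - v \<tau> x)\<^sup>2 + Gp p (u \<tau> x) (v \<tau> x))"
        using A(1) Gp_nonneg p by (intro AE_I2 mult_nonneg_nonneg add_nonneg_nonneg) (auto simp: b_def)
    qed (rule ri)
    also have "\<dots> = A * b * (z \<tau> + G \<tau>)" using zi G_integrable[OF \<tau>] by (simp add: z_def G_def ip_self)
    finally show ?thesis .
  qed
  have zd: "(z has_real_derivative 2 * ip M (\<lambda>x. u \<tau> x - v \<tau> x) (\<lambda>x. ud \<tau> x - vt \<tau> x)) (at \<tau> within {0..T})" if "\<tau> \<in> {0..T}" for \<tau>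
    using L2_deriv_ip[OF w_deriv[OF that] w_deriv[OF that]] unfolding z_def[abs_def]
    by (simp add: ip_commute[of M "\<lambda>x. ud \<tau> x - vt \<tau> x"])
  have cross: "2 * ip M (\<lambda>x. u \<tau> x - v \<tau> x) (\<lambda>x. ud \<tau> x - vt \<tau> x) \<le> z \<tau> + y \<tau>" if \<tau>: "\<tau> \<in> {0..T}" for \<tau>
  proof -
    let ?a = "\<lambda>x. u \<tau> x - v \<tau> x" and ?b = "\<lambda>x. ud \<tau> x - vt \<tau> x"
    have "0 \<le> ip M (\<lambda>x. ?a x - ?b x) (\<lambda>x. ?a x - ?b x)" by (rule ip_self_nonneg)
    also have "\<dots> = ip M ?a ?a - 2 * ip M ?a ?b + ip M ?b ?b"
      using wsq[OF \<tau>] by (simp only: ip_diff_left ip_diff_right sq_int_diff ip_commute[of M ?b ?a])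
    finally show ?thesis by (simp add: z_def y_def)
  qed
  \<comment> \<open>\<open>A * b\<close> comes from the remainder. The derivative of z is at most z
    + y, and y is at most twice \<open>relative\<close>, which accounts for the 2.\<close>
  define c where "c = A * b + 2"
  have "relative t + z t \<le> 0"
  proof (rule Gronwall_zero[where S = "\<lambda>\<tau>. relative \<tau> + z \<tau>" and c = c, OF _ _ _ t])
    show "((\<lambda>\<tau>. relative \<tau> + z \<tau>) has_real_derivative
        remainder \<tau> + 2 * ip M (\<lambda>x. u \<tau> x - v \<tau> x) (\<lambda>x. ud \<tau> x - vt \<tau> x)) (at \<tau> within {0..T})" if "\<tau> \<in> {0..T}" for \<tau>
      by (intro DERIV_add relative_deriv zd that)
    show "remainder \<tau> + 2 * ip M (\<lambda>x. u \<tau> x - v \<tau> x) (\<lambda>x. ud \<tau> x - vt \<tau> x) \<le> c * (relative \<tau> + z \<tau>)" if \<tau>: "\<tau> \<in> {0..T}" for \<tau>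
    proof -
      have Ab: "A * b \<ge> 0" using A(1) by (simp add: b_def)
      have "A * b * (z \<tau> + G \<tau>) \<le> A * b * (z \<tau> + relative \<tau>)"
        using yG[OF \<tau>] nn(2)[of \<tau>] Ab by (intro mult_left_mono) auto
      moreover have "z \<tau> + y \<tau> \<le> 2 * (z \<tau> + relative \<tau>)" using yG[OF \<tau>] nn[of \<tau>] by simp
      ultimately have "remainder \<tau> + 2 * ip M (\<lambda>x. u \<tau> x - v \<tau> x) (\<lambda>x. ud \<tau> x - vt \<tau> x) \<le>
          A * b * (z \<tau> + relative \<tau>) + 2 * (z \<tau> + relative \<tau>)"
        using rem[OF \<tau>] cross[OF \<tau>] by linarith
      then show ?thesis by (simp add: c_def algebra_simps)
    qed
    have "AE x in M. (u 0 x - v 0 x) * (u 0 x - v 0 x) = 0" using init(1) by eventually_elim simp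
    then have "z 0 = 0" unfolding z_def ip_def by (rule integral_eq_zero_AE)
    then show "relative 0 + z 0 \<le> 0" by (simp add: relative_0)
  qed
  moreover have "relative t \<ge> 0" using yG[OF t] nn[of t] by linarith
  ultimately have "z t = 0" using nn(1)[of t] by linarith
  then have "AE x in M. (u t x - v t x)\<^sup>2 = 0"
    using integral_nonneg_eq_0_iff_AE[of M "\<lambda>x. (u t x - v t x)\<^sup>2"] wsq(1)[OF t]
    by (simp add: z_def ip_self sq_int_def)
  then show ?thesis by eventually_elim simp
qed

end

subsection \<open>The uniqueness theorem\<close>

lemma L2_lim_at_subset:
  "L2_lim M V v (at t within J) \<Longrightarrow> S \<subseteq> J \<Longrightarrow> L2_lim M V v (at t within S)"
  by (rule L2_lim_compose[where g = "\<lambda>x. x"]) (auto simp: filterlim_def intro: at_le)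

lemma L2_deriv_subset: "L2_deriv M V W t J \<Longrightarrow> S \<subseteq> J \<Longrightarrow> L2_deriv M V W t S"
  unfolding L2_deriv_def using at_le[of S J t] by (auto intro: L2_lim_at_subset filter_leD)

lemma Hk_mono: "Hk s U f \<Longrightarrow> r \<le> s \<Longrightarrow> Hk r U f"
  by (auto simp: Hk_def multi_idx_def)

lemma Hk_diff:
  assumes U: "open U" and f: "Hk s U f" and g: "Hk s U g" shows "Hk s U (\<lambda>x. f x - g x)"
  unfolding Hk_def
proof (intro conjI ballI)
  show "L2 U (\<lambda>x. f x - g x)"
    using Hk_sq_int[OF U f] Hk_sq_int[OF U g] by (simp add: L2_iff_sq_int open_lebesgue U sq_int_diff)
  fix \<alpha> :: "'a list" assume \<alpha>: "\<alpha> \<in> multi_idx s"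
  show "\<exists>h. L2 U h \<and> weak_deriv U \<alpha> (\<lambda>x. f x - g x) h"
    using weak_deriv_diff[OF U multi_idxD[OF \<alpha>] Hk_wd(1)[OF U f \<alpha>] Hk_wd(1)[OF U g \<alpha>]]
      sq_int_diff[OF Hk_wd(2)[OF U f \<alpha>] Hk_wd(2)[OF U g \<alpha>]]
    by (auto simp: L2_iff_sq_int open_lebesgue U)
qed

lemma Hnorm_continuous:
  assumes U: "open U" and V: "cont_H s U J V" shows "continuous_on J (\<lambda>t. Hnorm s U (V t))"
proof -
  have "Hnorm s U f = sqrt (\<Sum>\<alpha>\<in>multi_idx s. ip (lebesgue_on U) (wd U \<alpha> f) (wd U \<alpha> f))" for f
    by (simp add: Hnorm_def ip_self LINT_lebesgue_on open_lebesgue U)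
  moreover have "continuous_on J (\<lambda>t. ip (lebesgue_on U) (wd U \<alpha> (V t)) (wd U \<alpha> (V t)))" if "\<alpha> \<in> multi_idx s" for \<alpha>
    unfolding continuous_on_def using cont_H_wd[OF U V _ that] by (auto intro: L2_lim_ip)
  ultimately show ?thesis by (simp add: continuous_on_real_sqrt continuous_on_sum)
qed

lemma AE_open_ex:
  fixes S :: "real set"
  assumes "AE s in lborel. P s" "open S" "S \<noteq> {}" shows "\<exists>s\<in>S. P s"
proof (rule ccontr)
  assume no: "\<not> (\<exists>s\<in>S. P s)"
  obtain N where N: "N \<in> null_sets lborel" "{s. \<not> P s} \<subseteq> N"
    using assms(1) by (auto simp: eventually_ae_filter)
  have "negligible N" using N(1) by (simp add: negligible_iff_null_sets null_sets_completionI)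
  then have "negligible S" by (rule negligible_subset) (use N(2) no in auto)
  then show False using open_not_negligible[OF assms(2,3)] by blast
qed

text \<open>The bound holds at almost every time, hence at times s converging to t. Continuity in L2
  gives pointwise convergence along a subsequence, and Fatou's lemma passes the bound to t.\<close>

lemma AE_Lp_bound_everywhere:
  fixes u :: "real \<Rightarrow> 'a \<Rightarrow> real"
  assumes I: "open I" and t: "t \<in> I" and cont: "L2_cont M u t I" and q: "q > 0"
    and bound: "AE s in lborel. s \<in> I \<longrightarrow> integrable M (\<lambda>x. \<bar>u s x\<bar> powr q) \<and> (LINT x|M. \<bar>u s x\<bar> powr q) \<le> C"
  shows "integrable M (\<lambda>x. \<bar>u t x\<bar> powr q)" "(LINT x|M. \<bar>u t x\<bar> powr q) \<le> C"
proof -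
  have ex: "\<exists>s. s \<in> I \<and> s \<noteq> t \<and> \<bar>s - t\<bar> < inverse (real (Suc k)) \<and>
      integrable M (\<lambda>x. \<bar>u s x\<bar> powr q) \<and> (LINT x|M. \<bar>u s x\<bar> powr q) \<le> C" for k
  proof -
    \<comment> \<open>The point t is removed because the filter \<open>at t within I\<close> ignores
      it; the remaining open set is nonempty since t is a limit point.\<close>
    let ?S = "I \<inter> ball t (inverse (real (Suc k))) - {t}"
    have "t islimpt UNIV" by (simp add: islimpt_UNIV)
    moreover have "open (I \<inter> ball t (inverse (real (Suc k))))" "t \<in> I \<inter> ball t (inverse (real (Suc k)))" using I t by auto
    ultimately have "?S \<noteq> {}" unfolding islimpt_def by blast
    moreover have "open ?S" using I by (intro open_Diff) auto
    ultimately obtain s where "s \<in> ?S" "s \<in> I \<longrightarrow> integrable M (\<lambda>x. \<bar>u s x\<bar> powr q) \<and> (LINT x|M. \<bar>u s x\<bar> powr q) \<le> C"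
      using AE_open_ex[OF bound] by blast
    then show ?thesis by (intro exI[of _ s]) (auto simp: dist_real_def abs_minus_commute)
  qed
  then obtain s where s: "\<And>k. s k \<in> I" "\<And>k. s k \<noteq> t" "\<And>k. \<bar>s k - t\<bar> < inverse (real (Suc k))"
    "\<And>k. integrable M (\<lambda>x. \<bar>u (s k) x\<bar> powr q)" "\<And>k. (LINT x|M. \<bar>u (s k) x\<bar> powr q) \<le> C"
    by metis
  have "(\<lambda>k. s k - t) \<longlonglongrightarrow> 0"
    by (rule Lim_null_comparison[OF _ LIMSEQ_inverse_real_of_nat]) (use s(3) in \<open>auto intro!: always_eventually less_imp_le\<close>)
  then have "filterlim s (at t within I) sequentially"
    unfolding filterlim_at using s(1,2) by (auto simp: LIM_zero_iff)
  from L2_lim_compose[OF cont this] obtain r where r: "AE x in M. (\<lambda>k. u (s (r k)) x) \<longlonglongrightarrow> u t x"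
    using L2_lim_AE_subseq by blast
  show "integrable M (\<lambda>x. \<bar>u t x\<bar> powr q)" "(LINT x|M. \<bar>u t x\<bar> powr q) \<le> C"
    using Fatou_powr[OF r sq_int_measurable[OF L2_limD(1)[OF cont]] q s(4) s(5)] by auto
qed

section \<open>Sup bounds for curves in H^n of the exterior domain\<close>

lemma Omega_sup_bound:
  obtains C where "C \<ge> 0" "\<And>g :: real^'n::finite \<Rightarrow> real. Hk CARD('n) Omega g \<Longrightarrow>
    AE x in lebesgue_on Omega. \<bar>g x\<bar> \<le> C * Hnorm CARD('n) Omega g"
  using Sobolev_exterior_sup[where 'a = "real^'n"] unfolding Omega_def[symmetric] by auto

lemma cont_H_sup_bounded:
  fixes V :: "real \<Rightarrow> real^'n::finite \<Rightarrow> real"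
  assumes V: "cont_H CARD('n) Omega {0..} V"
  obtains B where "\<And>t. t \<in> {0..T} \<Longrightarrow> AE x in lebesgue_on Omega. \<bar>V t x\<bar> \<le> B"
proof -
  obtain C where C: "C \<ge> 0" "\<And>g :: real^'n \<Rightarrow> real. Hk CARD('n) Omega g \<Longrightarrow>
    AE x in lebesgue_on Omega. \<bar>g x\<bar> \<le> C * Hnorm CARD('n) Omega g" using Omega_sup_bound[where 'n = 'n] by blast
  have "continuous_on {0..T} (\<lambda>t. Hnorm CARD('n) Omega (V t))"
    by (rule continuous_on_subset[OF Hnorm_continuous[OF open_Omega V]]) auto
  then have "bounded ((\<lambda>t. Hnorm CARD('n) Omega (V t)) ` {0..T})"
    by (intro compact_imp_bounded compact_continuous_image) auto
  then obtain K where K: "\<And>t. t \<in> {0..T} \<Longrightarrow> \<bar>Hnorm CARD('n) Omega (V t)\<bar> \<le> K"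
    unfolding bounded_real by blast
  have "AE x in lebesgue_on Omega. \<bar>V t x\<bar> \<le> C * K" if t: "t \<in> {0..T}" for t
  proof -
    have "Hk CARD('n) Omega (V t)" using V t by (simp add: cont_H_def)
    moreover have "C * Hnorm CARD('n) Omega (V t) \<le> C * K"
      using K[OF t] C(1) by (intro mult_left_mono) auto
    ultimately show ?thesis using C(2)[of "V t"] by (auto elim!: eventually_mono)
  qed
  then show thesis by (rule that)
qed

text \<open>The embedding is applied to the difference of the curve at two times. This is the
  uniform smallness behind \<open>fv_deriv\<close>.\<close>

lemma cont_H_sup_cont:
  fixes V :: "real \<Rightarrow> real^'n::finite \<Rightarrow> real"
  assumes V: "cont_H CARD('n) Omega J V" and t: "t \<in> J" and e: "e > 0"
  shows "\<forall>\<^sub>F \<tau> in at t within J. AE x in lebesgue_on Omega. \<bar>V \<tau> x - V t x\<bar> \<le> e"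
proof -
  obtain C where C: "C \<ge> 0" "\<And>g :: real^'n \<Rightarrow> real. Hk CARD('n) Omega g \<Longrightarrow>
    AE x in lebesgue_on Omega. \<bar>g x\<bar> \<le> C * Hnorm CARD('n) Omega g" using Omega_sup_bound[where 'n = 'n] by blast
  have "((\<lambda>\<tau>. C * Hnorm CARD('n) Omega (\<lambda>x. V \<tau> x - V t x)) \<longlongrightarrow> C * 0) (at t within J)"
    using V t by (intro tendsto_intros) (auto simp: cont_H_def)
  then have "\<forall>\<^sub>F \<tau> in at t within J. C * Hnorm CARD('n) Omega (\<lambda>x. V \<tau> x - V t x) < e"
    using e by (intro order_tendstoD(2)) auto
  moreover have "\<forall>\<^sub>F \<tau> in at t within J. \<tau> \<in> J" by (simp add: eventually_at_filter)
  ultimately show ?thesis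
  proof eventually_elim
    case (elim \<tau>)
    have "Hk CARD('n) Omega (\<lambda>x. V \<tau> x - V t x)"
      using V t elim(2) by (intro Hk_diff[OF open_Omega]) (auto simp: cont_H_def)
    from C(2)[OF this] show ?case by eventually_elim (use elim(1) in linarith)
  qed
qed

theorem theorem1p6:
  fixes N :: nat and p M \<epsilon> T :: real and I :: "real set"
    and u0 u1 v0 v1 :: "real^'n::finite \<Rightarrow> real"
    and v vu vud :: "real \<Rightarrow> real^'n \<Rightarrow> real"
  assumes n3: "CARD('n) \<ge> 3"
    and N_ge: "real N \<ge> 5/2 * real CARD('n)"
    and p1: "p > real CARD('n) + 3" and p2: "p > real N"
    and p3: "p > 2 * real CARD('n) / (real CARD('n) - 2)"
    and u_reg: "Hk (N + 1) Omega u0" "Hk N Omega u1"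
    and u_rad: "radial_on Omega u0" "radial_on Omega u1"
    and u_compat: "compat N Omega u0 u1 (fp p)"
    and M1: "M > 1" and u_M: "M_norm_finite p M u0 u1"
    and eps_pos: "\<epsilon> > 0"
    and eps_prop: "\<forall>w0 w1. compat N Omega w0 w1 (fp p) \<and>
                    Hnorm (N + 1) Omega (\<lambda>x. u0 x - w0 x) < \<epsilon> \<and>
                    Hnorm N Omega (\<lambda>x. u1 x - w1 x) < \<epsilon>
                    \<longrightarrow> (\<exists>w. global_sol N (fp p) w0 w1 w)"
    and v_compat: "compat N Omega v0 v1 (fp p)"
    and v_close: "Hnorm (N + 1) Omega (\<lambda>x. u0 x - v0 x) < \<epsilon>"
                 "Hnorm N Omega (\<lambda>x. u1 x - v1 x) < \<epsilon>"
    and v_sol: "global_sol N (fp p) v0 v1 v"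
    and T_pos: "T > 0"
    and I_int: "is_interval I" "open I" "{0..T} \<subseteq> I"
    and vu_C0H10: "cont_H 1 Omega I vu" "\<forall>t\<in>I. H10 Omega (vu t)"
    and vu_C1L2: "cont_H 0 Omega I vu" "deriv_H 0 Omega I vu vud" "cont_H 0 Omega I vud"
    and vu_Linf: "\<exists>C. AE t in lborel. t \<in> I \<longrightarrow>
                    (\<lambda>x. indicator Omega x * vu t x) \<in> borel_measurable lebesgue \<and>
                    set_integrable lebesgue Omega (\<lambda>x. \<bar>vu t x\<bar> powr (p + 1)) \<and>
                    (LINT x:Omega|lebesgue. \<bar>vu t x\<bar> powr (p + 1)) \<le> C"
    and vu_sol: "distr_sol T (fp p) vu"
    and vu_init: "AE x in lebesgue. x \<in> Omega \<longrightarrow> vu 0 x = v0 x"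
                 "AE x in lebesgue. x \<in> Omega \<longrightarrow> vud 0 x = v1 x"
    and vu_energy: "\<forall>t\<in>{0..T}. energy p (vu t) (vud t) \<le> energy p (vu 0) (vud 0)"
  shows "\<forall>t\<in>{0..T}. AE x in lebesgue. x \<in> Omega \<longrightarrow> vu t x = v t x"
proof -
  let ?M = "lebesgue_on (Omega :: (real^'n) set)" and ?n = "CARD('n)"
  have "real ?n \<ge> 3" using n3 by simp
  \<comment> \<open>As n >= 3, half of n exceeds 1. The consequences drawn are n <= N - 1 and 2 <= N
    - 1: v_t, a curve in H^(N-1), is bounded and has a Laplacian in L2.\<close>
  then have "2 * real ?n + 1 \<le> real N" using N_ge by linarith
  then have "2 * ?n + 1 \<le> N" by linarith
  then have N: "?n \<le> N - 1" "2 \<le> N - 1" "?n \<le> N" "2 \<le> N" using n3 by linarith+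
  obtain ws where ws_all: "ws 0 = v \<and>
        (\<forall>k\<le>N. (\<forall>j\<le>k. cont_H (N - k) Omega {0..} (ws j)) \<and>
                (\<forall>j<k. deriv_H (N - k) Omega {0..} (ws j) (ws (Suc j)))) \<and>
        (\<forall>j\<le>N - 1. \<forall>t\<ge>0. H10 Omega (ws j t)) \<and>
        (AE x in lebesgue. x \<in> Omega \<longrightarrow> v 0 x = v0 x) \<and>
        (AE x in lebesgue. x \<in> Omega \<longrightarrow> ws 1 0 x = v1 x) \<and>
        (\<forall>t\<ge>0. AE x in lebesgue. x \<in> Omega \<longrightarrow> ws 2 t x - lap Omega (v t) x + fp p (v t x) = 0)"
    using v_sol[unfolded global_sol_def] by (elim exE) (rule that)
  have ws0: "ws 0 = v"
    and ws: "\<And>k j. k \<le> N \<Longrightarrow> j \<le> k \<Longrightarrow> cont_H (N - k) Omega {0..} (ws j)"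
      "\<And>k j. k \<le> N \<Longrightarrow> j < k \<Longrightarrow> deriv_H (N - k) Omega {0..} (ws j) (ws (Suc j))"
    and wsH: "\<And>j t. j \<le> N - 1 \<Longrightarrow> t \<ge> 0 \<Longrightarrow> H10 Omega (ws j t)"
    and ws_init: "AE x in lebesgue. x \<in> Omega \<longrightarrow> v 0 x = v0 x" "AE x in lebesgue. x \<in> Omega \<longrightarrow> ws 1 0 x = v1 x"
    and ws_eq: "\<And>t. t \<ge> 0 \<Longrightarrow> AE x in lebesgue. x \<in> Omega \<longrightarrow> ws 2 t x - lap Omega (v t) x + fp p (v t x) = 0"
    using ws_all by blast+
  have vN: "cont_H N Omega {0..} v" using ws(1)[of 0 0] ws0 by simp
  \<comment> \<open>Each time derivative costs one space derivative, so v is differentiable as a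
    curve in H^(N-1), and v_t as a curve in H^(N-2).\<close>
  have v1: "cont_H (N - 1) Omega {0..} v" "cont_H (N - 1) Omega {0..} (ws 1)" "deriv_H (N - 1) Omega {0..} v (ws 1)"
    using ws(1)[of 1 0] ws(1)[of 1 1] ws(2)[of 1 0] ws0 N by auto
  have v2: "cont_H (N - 2) Omega {0..} (ws 1)" "cont_H (N - 2) Omega {0..} (ws 2)" "deriv_H (N - 2) Omega {0..} (ws 1) (ws 2)"
    using ws(1)[of 2 1] ws(1)[of 2 2] ws(2)[of 2 1] N by (auto simp: numeral_2_eq_2)
  have J: "{0..T} \<subseteq> {0..}" by auto
  obtain B1 where B1: "\<And>t. t \<in> {0..T} \<Longrightarrow> AE x in ?M. \<bar>v t x\<bar> \<le> B1"
    using cont_H_sup_bounded[OF cont_H_mono[OF open_Omega vN N(3)]] by blast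
  obtain B2 where B2: "\<And>t. t \<in> {0..T} \<Longrightarrow> AE x in ?M. \<bar>ws 1 t x\<bar> \<le> B2"
    using cont_H_sup_bounded[OF cont_H_mono[OF open_Omega v1(2) N(1)]] by blast
  \<comment> \<open>The essential bound in time; \<open>Lp\<close> turns it into a bound at every
    time of [0,T], using that I is an open neighbourhood.\<close>
  obtain C where C: "AE t in lborel. t \<in> I \<longrightarrow> integrable ?M (\<lambda>x. \<bar>vu t x\<bar> powr (p + 1)) \<and> (LINT x|?M. \<bar>vu t x\<bar> powr (p + 1)) \<le> C"
  proof -
    obtain C where "AE t in lborel. t \<in> I \<longrightarrow>
        (\<lambda>x. indicator Omega x * vu t x) \<in> borel_measurable lebesgue \<and>
        integrable ?M (\<lambda>x. \<bar>vu t x\<bar> powr (p + 1)) \<and> (LINT x|?M. \<bar>vu t x\<bar> powr (p + 1)) \<le> C"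
      using vu_Linf[unfolded set_integrable_lebesgue_on[OF sets_Omega] LINT_lebesgue_on[OF sets_Omega]] by (elim exE) (rule that)
    then have "AE t in lborel. t \<in> I \<longrightarrow> integrable ?M (\<lambda>x. \<bar>vu t x\<bar> powr (p + 1)) \<and> (LINT x|?M. \<bar>vu t x\<bar> powr (p + 1)) \<le> C"
      by eventually_elim blast
    then show thesis by (rule that)
  qed
  have Lp: "integrable ?M (\<lambda>x. \<bar>vu t x\<bar> powr (p + 1))" "(LINT x|?M. \<bar>vu t x\<bar> powr (p + 1)) \<le> C" if t: "t \<in> {0..T}" for t
  proof -
    have tI: "t \<in> I" using t I_int(3) by blast
    have q: "p + 1 > 0" using p1 by simp
    show "integrable ?M (\<lambda>x. \<bar>vu t x\<bar> powr (p + 1))" "(LINT x|?M. \<bar>vu t x\<bar> powr (p + 1)) \<le> C"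
      by (rule AE_Lp_bound_everywhere[OF I_int(2) tI cont_H_L2[OF open_Omega vu_C1L2(1) tI] q C])+
  qed
  interpret weak_strong p T C vu vud ?M v "ws 1" "ws 2" "max B1 B2"
  proof (unfold_locales)
    show "p > 2" using p1 by simp
    show "T > 0" by fact
    show "distr_sol T (fp p) vu" by fact
    show "AE x in ?M. vu 0 x = v 0 x" "AE x in ?M. vud 0 x = ws 1 0 x"
      unfolding AE_lebesgue_on[OF sets_Omega]
      using vu_init(1) ws_init(1) vu_init(2) ws_init(2) by (eventually_elim, simp)+
    fix t assume t: "t \<in> {0..T}"
    then have tI: "t \<in> I" and t0: "t \<in> {0..}" using I_int(3) by auto
    show "Hk 1 Omega (vu t)" using vu_C0H10(1) tI by (simp add: cont_H_def)
    show "L2_deriv ?M vu (vud t) t {0..T}"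
      by (rule L2_deriv_subset[OF deriv_H_L2[OF open_Omega vu_C1L2(1,3,2) tI] I_int(3)])
    show "L2_cont ?M vud t {0..T}"
      by (rule L2_lim_at_subset[OF cont_H_L2[OF open_Omega vu_C1L2(3) tI] I_int(3)])
    show "integrable ?M (\<lambda>x. \<bar>vu t x\<bar> powr (p + 1))" "(LINT x|?M. \<bar>vu t x\<bar> powr (p + 1)) \<le> C" by (rule Lp[OF t])+
    show "AE x in ?M. \<bar>v t x\<bar> \<le> max B1 B2" using B1[OF t] by eventually_elim simp
    show "AE x in ?M. \<bar>ws 1 t x\<bar> \<le> max B1 B2" using B2[OF t] by eventually_elim simp
    show "L2_deriv ?M v (ws 1 t) t {0..T}"
      by (rule L2_deriv_subset[OF deriv_H_L2[OF open_Omega v1 t0] J])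
    show "L2_deriv ?M (ws 1) (ws 2 t) t {0..T}"
      by (rule L2_deriv_subset[OF deriv_H_L2[OF open_Omega v2 t0] J])
    \<comment> \<open>The Laplacian is a finite sum of weak derivatives along \<open>[b, b]\<close>,
      and each of these is controlled by the norm of H^(N-1) because N - 1 >= 2.\<close>
    show "L2_deriv ?M (\<lambda>\<tau>. lap Omega (v \<tau>)) (lap Omega (ws 1 t)) t {0..T}"
      unfolding lap_def using N(2)
      by (intro L2_deriv_sum L2_deriv_subset[OF deriv_H_wd[OF open_Omega v1 t0] J]) (auto simp: multi_idx_def)
    show "Hk 2 Omega (v t)" using v1(1) t0 N(2) by (auto simp: cont_H_def intro: Hk_mono)
    show "Hk 2 Omega (ws 1 t)" using v1(2) t0 N(2) by (auto simp: cont_H_def intro: Hk_mono)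
    show "H10 Omega (ws 1 t)" using wsH[of 1 t] t0 N(2) by simp
    show "H10 Omega (vu t)" using vu_C0H10(2) tI by blast
    show "AE x in ?M. ws 2 t x - lap Omega (v t) x + fp p (v t x) = 0"
      using ws_eq[of t] t0 unfolding AE_lebesgue_on[OF sets_Omega] by simp
    show "energy p (vu t) (vud t) \<le> energy p (vu 0) (vud 0)" using vu_energy t by blast
    show "\<forall>\<^sub>F \<tau> in at t within {0..T}. AE x in ?M. \<bar>v \<tau> x - v t x\<bar> \<le> e" if "e > 0" for e
      using cont_H_sup_cont[OF cont_H_mono[OF open_Omega vN N(3)] t0 that] at_le[OF J, of t] by (rule filter_leD[rotated])
    fix b :: "real^'n" assume b: "b \<in> Basis"
    show "L2_cont ?M (\<lambda>\<tau>. wd Omega [b] (vu \<tau>)) t {0..T}"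
      using b by (intro L2_lim_at_subset[OF cont_H_wd[OF open_Omega vu_C0H10(1) tI] I_int(3)]) (simp add: multi_idx_def)
    show "L2_deriv ?M (\<lambda>\<tau>. wd Omega [b] (v \<tau>)) (wd Omega [b] (ws 1 t)) t {0..T}"
      using b N(2) by (intro L2_deriv_subset[OF deriv_H_wd[OF open_Omega v1 t0] J]) (simp add: multi_idx_def)
  qed
  show ?thesis
    using uniqueness unfolding AE_lebesgue_on[OF sets_Omega] by blast
qed

end
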